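(* Let $(M,g)$ be a smooth $n$-dimensional Riemannian manifold, let $A$ be a real constant and let $v:(0,\infty)\to\mathbf{R}$ be a smooth function such that $A>0$ and $v(t)>-\frac{A}{2\sqrt{t}}$ for all $t>0$. Let $G$ be the Riemannian metric and $J$ the almost complex structure on the nonzero cotangent bundle $T^*_0M$ determined by $A$ and $v$ as defined in the context. Then $(T^*_0M,G,J)$ is an almost Kähler manifold.
   Context: Let $\pi:T^*M\to M$ be the cotangent bundle and $T^*_0M$ the complement of the zero section in $T^*M$. A local chart $(U,x^1,\dots,x^n)$ on $M$ induces a local chart $(\pi^{-1}(U),q^1,\dots,q^n,p_1,\dots,p_n)$ on $T^*M$, where $q^i=x^i\circ\pi$ and $p=p_i\,dx^i_{\pi(p)}$. The summation convention is used. Let $g_{ij}$ be the components of $g$, $(g^{kl})$ the inverse matrix of $(g_{ij})$, $\Gamma^k_{ij}$ the Christoffel symbols of the Levi-Civita connection of $g$, and put $g^{0i}=p_hg^{hi}$ and $\Gamma^0_{ih}=p_k\Gamma^k_{ih}$. The energy density is $t=\frac12 g^{ik}p_ip_k$; it takes values in $(0,\infty)$ on $T^*_0M$. The adapted local frame on $T^*_0M$ is $\left(\frac{\delta}{\delta q^1},\dots,\frac{\delta}{\delta q^n},\frac{\partial}{\partial p_1},\dots,\frac{\partial}{\partial p_n}\right)$ with $\frac{\delta}{\delta q^i}=\frac{\partial}{\partial q^i}+\Gamma^0_{ih}\frac{\partial}{\partial p_h}$. Its dual frame is $(dq^i,Dp_i)$ with $Dp_i=dp_i-\Gamma^0_{ij}dq^j$.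 Define $G_{ij}=A\sqrt{t}\,g_{ij}+v(t)p_ip_j$. Under the conditions $A>0$, $v>-\frac{A}{2\sqrt t}$ the matrix $(G_{ij})$ is positive definite, and its inverse has entries $H^{kl}=\frac{1}{A\sqrt t}g^{kl}+w(t)g^{0k}g^{0l}$ with $w(t)=\frac{-v}{At(A+2\sqrt t\,v)}$. The Riemannian metric is $G=G_{ij}dq^idq^j+H^{ij}Dp_iDp_j$, i.e. $G(\frac{\delta}{\delta q^i},\frac{\delta}{\delta q^j})=G_{ij}$, $G(\frac{\partial}{\partial p_i},\frac{\partial}{\partial p_j})=H^{ij}$, $G(\frac{\partial}{\partial p_i},\frac{\delta}{\delta q^j})=0$. The almost complex structure is given by $J\frac{\delta}{\delta q^i}=G_{ik}\frac{\partial}{\partial p_k}$, $J\frac{\partial}{\partial p_i}=-H^{ik}\frac{\delta}{\delta q^k}$. These definitions are independent of the chart, so $G$ and $J$ are globally defined on $T^*_0M$. $(T^*_0M,G,J)$ is almost Kähler if $G(JX,JY)=G(X,Y)$ for all vector fields $X,Y$ and the fundamental $2$-form $\phi(X,Y)=G(X,JY)$ is closed. *)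

theory Defs
  imports "HOL-Analysis.Analysis"
begin

section \<open>Smooth functions\<close>

text \<open>Only used on open sets \<open>S\<close>, where \<open>Ck_on k S f\<close> says that \<open>f\<close> is of class $C^k$.\<close>

primrec Ck_on :: "nat \<Rightarrow> 'e::euclidean_space set \<Rightarrow> ('e \<Rightarrow> 'b::real_normed_vector) \<Rightarrow> bool" where
  "Ck_on 0 S f \<longleftrightarrow> continuous_on S f"
| "Ck_on (Suc k) S f \<longleftrightarrow>
     (\<forall>x\<in>S. f differentiable (at x)) \<and>
     (\<forall>u. Ck_on k S (\<lambda>x. frechet_derivative f (at x) u))"

definition smooth_on :: "'e::euclidean_space set \<Rightarrow> ('e \<Rightarrow> 'b::real_normed_vector) \<Rightarrow> bool" where
  "smooth_on S f \<longleftrightarrow> (\<forall>k. Ck_on k S f)"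


section \<open>Smooth manifolds\<close>

text \<open>A chart is a pair of a domain and a coordinate map, whose values outside the domain are
  irrelevant. A manifold is represented by an atlas (not necessarily maximal) on the union of the
  chart domains; its topology is the one determined by the atlas.\<close>

type_synonym ('a, 'e) chart = "'a set \<times> ('a \<Rightarrow> 'e)"

type_synonym ('a, 'e) atlas = "('a, 'e) chart set"

definition carrier :: "('a, 'e) atlas \<Rightarrow> 'a set" where
  "carrier M = \<Union> (fst ` M)"

definition chart_inv :: "('a, 'e) chart \<Rightarrow> 'e \<Rightarrow> 'a" where
  "chart_inv c = inv_into (fst c) (snd c)"

definition transition :: "('a, 'e) chart \<Rightarrow> ('a, 'e) chart \<Rightarrow> 'e \<Rightarrow> 'e" where
  "transition c d = snd d \<circ> chart_inv c"

definition atlas_topology :: "('a, 'e::topological_space) atlas \<Rightarrow> 'a topology" where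
  "atlas_topology M =
     topology (\<lambda>W. W \<subseteq> carrier M \<and> (\<forall>c\<in>M. open (snd c ` (W \<inter> fst c))))"

lemma openin_atlas_topology:
  assumes "\<And>c. c \<in> M \<Longrightarrow> inj_on (snd c) (fst c)"
  shows "openin (atlas_topology M) W \<longleftrightarrow>
           W \<subseteq> carrier M \<and> (\<forall>c\<in>M. open (snd c ` (W \<inter> fst c)))"
proof -
  let ?P = "\<lambda>W. W \<subseteq> carrier M \<and> (\<forall>c\<in>M. open (snd c ` (W \<inter> fst c)))"
  have "istopology ?P"
    unfolding istopology_def
  proof (intro conjI allI impI)
    fix S T assume S: "?P S" and T: "?P T"
    have "snd c ` ((S \<inter> T) \<inter> fst c) = snd c ` (S \<inter> fst c) \<inter> snd c ` (T \<inter> fst c)"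
      if "c \<in> M" for c
      using inj_on_image_Int[OF assms[OF that], of "S \<inter> fst c" "T \<inter> fst c"]
      by (simp add: Int_ac)
    with S T show "S \<inter> T \<subseteq> carrier M" and "\<forall>c\<in>M. open (snd c ` ((S \<inter> T) \<inter> fst c))"
      by auto
  next
    fix \<K> assume \<K>: "\<forall>K\<in>\<K>. ?P K"
    have "snd c ` (\<Union>\<K> \<inter> fst c) = (\<Union>K\<in>\<K>. snd c ` (K \<inter> fst c))" for c :: "('a, 'b) chart"
      by blast
    with \<K> show "\<Union>\<K> \<subseteq> carrier M" and "\<forall>c\<in>M. open (snd c ` (\<Union>\<K> \<inter> fst c))"
      by auto
  qed
  then show ?thesis
    by (simp add: atlas_topology_def)
qed

text \<open>In the first two conditions, \<open>c = d\<close> is allowed: chart images are open.\<close>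

definition smooth_manifold :: "('a, 'e::euclidean_space) atlas \<Rightarrow> bool" where
  "smooth_manifold M \<longleftrightarrow>
     (\<forall>c\<in>M. inj_on (snd c) (fst c)) \<and>
     (\<forall>c\<in>M. \<forall>d\<in>M. open (snd c ` (fst c \<inter> fst d))) \<and>
     (\<forall>c\<in>M. \<forall>d\<in>M. smooth_on (snd c ` (fst c \<inter> fst d)) (transition c d)) \<and>
     Hausdorff_space (atlas_topology M) \<and>
     second_countable (atlas_topology M)"

definition open_submanifold :: "'a set \<Rightarrow> ('a, 'e) atlas \<Rightarrow> ('a, 'e) atlas" where
  "open_submanifold S M = (\<lambda>c. (fst c \<inter> S, snd c)) ` M"


section \<open>Tangent and cotangent vectors\<close>

text \<open>A tangent vector at \<open>a\<close> is the family of its coordinate representations in all charts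
  around \<open>a\<close>, related by the derivatives of the transition maps. It is \<open>0\<close> on all other
  charts, so that equality of tangent vectors at \<open>a\<close> is equality of functions. Linear
  combinations are formed pointwise. Cotangent vectors are the linear functionals on the tangent
  space, again extended by \<open>0\<close>.\<close>

type_synonym ('a, 'e) tvec = "('a, 'e) chart \<Rightarrow> 'e"

type_synonym ('a, 'e) covec = "('a, 'e) tvec \<Rightarrow> real"

definition charts_at :: "('a, 'e) atlas \<Rightarrow> 'a \<Rightarrow> ('a, 'e) chart set" where
  "charts_at M a = {c \<in> M. a \<in> fst c}"

definition tangent_space :: "('a, 'e::euclidean_space) atlas \<Rightarrow> 'a \<Rightarrow> ('a, 'e) tvec set" where
  "tangent_space M a =
     {X. (\<forall>c. c \<notin> charts_at M a \<longrightarrow> X c = 0) \<and>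
         (\<forall>c\<in>charts_at M a. \<forall>d\<in>charts_at M a.
            X d = frechet_derivative (transition c d) (at (snd c a)) (X c))}"

text \<open>The tangent vector at \<open>a\<close> whose representation in the chart \<open>c\<close> is \<open>u\<close>; for a basis
  vector \<open>u\<close> this is a coordinate vector.\<close>

definition coord_vec ::
  "('a, 'e::euclidean_space) atlas \<Rightarrow> ('a, 'e) chart \<Rightarrow> 'a \<Rightarrow> 'e \<Rightarrow> ('a, 'e) tvec" where
  "coord_vec M c a u =
     (\<lambda>d. if d \<in> charts_at M a
          then frechet_derivative (transition c d) (at (snd c a)) u else 0)"

definition tangent_linear ::
  "('a, 'e::euclidean_space) atlas \<Rightarrow> 'a \<Rightarrow> (('a, 'e) tvec \<Rightarrow> real) \<Rightarrow> bool" where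
  "tangent_linear M a f \<longleftrightarrow>
     (\<forall>X\<in>tangent_space M a. \<forall>Y\<in>tangent_space M a. \<forall>r s.
        f (\<lambda>c. r *\<^sub>R X c + s *\<^sub>R Y c) = r * f X + s * f Y)"

definition cotangent_space :: "('a, 'e::euclidean_space) atlas \<Rightarrow> 'a \<Rightarrow> ('a, 'e) covec set" where
  "cotangent_space M a =
     {p. tangent_linear M a p \<and> (\<forall>X. X \<notin> tangent_space M a \<longrightarrow> p X = 0)}"

text \<open>Derivative at \<open>a\<close>, in the coordinates of the chart \<open>c\<close> and in the direction \<open>u\<close>, of a
  function on the manifold.\<close>

definition chart_deriv ::
  "('a, 'e::euclidean_space) chart \<Rightarrow> ('a \<Rightarrow> real) \<Rightarrow> 'a \<Rightarrow> 'e \<Rightarrow> real" where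
  "chart_deriv c f a u = frechet_derivative (f \<circ> chart_inv c) (at (snd c a)) u"


section \<open>Tensor fields\<close>

type_synonym ('a, 'e) bform = "'a \<Rightarrow> ('a, 'e) tvec \<Rightarrow> ('a, 'e) tvec \<Rightarrow> real"

type_synonym ('a, 'e) endo = "'a \<Rightarrow> ('a, 'e) tvec \<Rightarrow> ('a, 'e) tvec"

definition smooth_bilinear_field ::
  "('a, 'e::euclidean_space) atlas \<Rightarrow> ('a, 'e) bform \<Rightarrow> bool" where
  "smooth_bilinear_field M B \<longleftrightarrow>
     (\<forall>a\<in>carrier M. \<forall>X\<in>tangent_space M a.
        tangent_linear M a (\<lambda>Y. B a X Y) \<and> tangent_linear M a (\<lambda>Y. B a Y X)) \<and>
     (\<forall>c\<in>M. \<forall>u w. smooth_on (snd c ` fst c)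
        ((\<lambda>a. B a (coord_vec M c a u) (coord_vec M c a w)) \<circ> chart_inv c))"

definition riemannian_metric ::
  "('a, 'e::euclidean_space) atlas \<Rightarrow> ('a, 'e) bform \<Rightarrow> bool" where
  "riemannian_metric M g \<longleftrightarrow>
     smooth_bilinear_field M g \<and>
     (\<forall>a\<in>carrier M. \<forall>X\<in>tangent_space M a. \<forall>Y\<in>tangent_space M a. g a X Y = g a Y X) \<and>
     (\<forall>a\<in>carrier M. \<forall>X\<in>tangent_space M a. X \<noteq> (\<lambda>_. 0) \<longrightarrow> g a X X > 0)"

definition two_form :: "('a, 'e::euclidean_space) atlas \<Rightarrow> ('a, 'e) bform \<Rightarrow> bool" where
  "two_form M \<phi> \<longleftrightarrow>
     smooth_bilinear_field M \<phi> \<and>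
     (\<forall>a\<in>carrier M. \<forall>X\<in>tangent_space M a. \<forall>Y\<in>tangent_space M a. \<phi> a X Y = - \<phi> a Y X)"

text \<open>The components of the exterior derivative of a 2-form on the coordinate vectors of a chart
  (whose Lie brackets vanish).\<close>

definition ext_deriv2 ::
  "('a, 'e::euclidean_space) atlas \<Rightarrow> ('a, 'e) bform \<Rightarrow>
     ('a, 'e) chart \<Rightarrow> 'a \<Rightarrow> 'e \<Rightarrow> 'e \<Rightarrow> 'e \<Rightarrow> real" where
  "ext_deriv2 M \<phi> c a u1 u2 u3 =
     chart_deriv c (\<lambda>b. \<phi> b (coord_vec M c b u2) (coord_vec M c b u3)) a u1
   - chart_deriv c (\<lambda>b. \<phi> b (coord_vec M c b u1) (coord_vec M c b u3)) a u2
   + chart_deriv c (\<lambda>b. \<phi> b (coord_vec M c b u1) (coord_vec M c b u2)) a u3"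

definition closed_two_form :: "('a, 'e::euclidean_space) atlas \<Rightarrow> ('a, 'e) bform \<Rightarrow> bool" where
  "closed_two_form M \<phi> \<longleftrightarrow>
     two_form M \<phi> \<and>
     (\<forall>c\<in>M. \<forall>a\<in>fst c. \<forall>u1 u2 u3. ext_deriv2 M \<phi> c a u1 u2 u3 = 0)"

definition almost_complex_structure ::
  "('a, 'e::euclidean_space) atlas \<Rightarrow> ('a, 'e) endo \<Rightarrow> bool" where
  "almost_complex_structure M J \<longleftrightarrow>
     (\<forall>a\<in>carrier M. \<forall>X\<in>tangent_space M a. J a X \<in> tangent_space M a) \<and>
     (\<forall>a\<in>carrier M. \<forall>X\<in>tangent_space M a. \<forall>Y\<in>tangent_space M a. \<forall>r s.
        J a (\<lambda>c. r *\<^sub>R X c + s *\<^sub>R Y c) = (\<lambda>c. r *\<^sub>R J a X c + s *\<^sub>R J a Y c)) \<and>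
     (\<forall>c\<in>M. \<forall>u. smooth_on (snd c ` fst c)
        ((\<lambda>a. J a (coord_vec M c a u) c) \<circ> chart_inv c)) \<and>
     (\<forall>a\<in>carrier M. \<forall>X\<in>tangent_space M a. J a (J a X) = (\<lambda>c. - X c))"

definition fundamental_form ::
  "('a, 'e) bform \<Rightarrow> ('a, 'e) endo \<Rightarrow> ('a, 'e) bform" where
  "fundamental_form G J = (\<lambda>a X Y. G a X (J a Y))"

definition almost_kaehler_manifold ::
  "('a, 'e::euclidean_space) atlas \<Rightarrow> ('a, 'e) bform \<Rightarrow> ('a, 'e) endo \<Rightarrow> bool" where
  "almost_kaehler_manifold M G J \<longleftrightarrow>
     smooth_manifold M \<and> riemannian_metric M G \<and> almost_complex_structure M J \<and>
     (\<forall>a\<in>carrier M. \<forall>X\<in>tangent_space M a. \<forall>Y\<in>tangent_space M a.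
        G a (J a X) (J a Y) = G a X Y) \<and>
     closed_two_form M (fundamental_form G J)"


section \<open>The nonzero cotangent bundle\<close>

type_synonym ('a, 'n) cpoint = "'a \<times> ('a, real ^ 'n) covec"

abbreviation (input) base_vec ::
  "('a, real ^ 'n) atlas \<Rightarrow> ('a, real ^ 'n) chart \<Rightarrow> 'a \<Rightarrow> 'n \<Rightarrow> ('a, real ^ 'n) tvec" where
  "base_vec M c a i \<equiv> coord_vec M c a (axis i 1)"

definition p_coord ::
  "('a, real ^ 'n) atlas \<Rightarrow> ('a, real ^ 'n) chart \<Rightarrow> ('a, 'n) cpoint \<Rightarrow> 'n \<Rightarrow> real" where
  "p_coord M c z i = snd z (base_vec M c (fst z) i)"

definition cotangent_set :: "('a, real ^ 'n) atlas \<Rightarrow> ('a, 'n) cpoint set" where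
  "cotangent_set M = (SIGMA a:carrier M. cotangent_space M a)"

definition cotangent_chart ::
  "('a, real ^ 'n) atlas \<Rightarrow> ('a, real ^ 'n) chart \<Rightarrow>
     (('a, 'n) cpoint, (real ^ 'n) \<times> (real ^ 'n)) chart" where
  "cotangent_chart M c =
     ({z \<in> cotangent_set M. fst z \<in> fst c}, \<lambda>z. (snd c (fst z), \<chi> i. p_coord M c z i))"

definition cotangent_bundle ::
  "('a, real ^ 'n) atlas \<Rightarrow> (('a, 'n) cpoint, (real ^ 'n) \<times> (real ^ 'n)) atlas" where
  "cotangent_bundle M = cotangent_chart M ` M"

definition nonzero_cotangent_set :: "('a, real ^ 'n) atlas \<Rightarrow> ('a, 'n) cpoint set" where
  "nonzero_cotangent_set M = {z \<in> cotangent_set M. snd z \<noteq> (\<lambda>_. 0)}"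

definition nonzero_cotangent_bundle ::
  "('a, real ^ 'n) atlas \<Rightarrow> (('a, 'n) cpoint, (real ^ 'n) \<times> (real ^ 'n)) atlas" where
  "nonzero_cotangent_bundle M =
     open_submanifold (nonzero_cotangent_set M) (cotangent_bundle M)"

definition induced_chart ::
  "('a, real ^ 'n) atlas \<Rightarrow> ('a, real ^ 'n) chart \<Rightarrow>
     (('a, 'n) cpoint, (real ^ 'n) \<times> (real ^ 'n)) chart" where
  "induced_chart M c =
     (fst (cotangent_chart M c) \<inter> nonzero_cotangent_set M, snd (cotangent_chart M c))"


section \<open>Local expressions\<close>

text \<open>Below, \<open>c\<close> is a chart of \<open>M\<close>, \<open>a\<close> a point of its domain, and \<open>z\<close> a nonzero
  covector at such a point.\<close>

definition g_low ::
  "('a, real ^ 'n) atlas \<Rightarrow> ('a, real ^ 'n) bform \<Rightarrow> ('a, real ^ 'n) chart \<Rightarrow> 'a \<Rightarrow>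
     real ^ 'n ^ 'n" where
  "g_low M g c a = (\<chi> i j. g a (base_vec M c a i) (base_vec M c a j))"

definition g_up ::
  "('a, real ^ 'n) atlas \<Rightarrow> ('a, real ^ 'n) bform \<Rightarrow> ('a, real ^ 'n) chart \<Rightarrow> 'a \<Rightarrow>
     real ^ 'n ^ 'n" where
  "g_up M g c a = matrix_inv (g_low M g c a)"

text \<open>\<open>christoffel M g c a k i j\<close> is $\Gamma^k_{ij}$.\<close>

definition christoffel ::
  "('a, real ^ 'n) atlas \<Rightarrow> ('a, real ^ 'n) bform \<Rightarrow> ('a, real ^ 'n) chart \<Rightarrow> 'a \<Rightarrow>
     'n \<Rightarrow> 'n \<Rightarrow> 'n \<Rightarrow> real" where
  "christoffel M g c a k i j =
     (1 / 2) * (\<Sum>l\<in>UNIV. g_up M g c a $ k $ l *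
       (chart_deriv c (\<lambda>b. g_low M g c b $ j $ l) a (axis i 1)
      + chart_deriv c (\<lambda>b. g_low M g c b $ i $ l) a (axis j 1)
      - chart_deriv c (\<lambda>b. g_low M g c b $ i $ j) a (axis l 1)))"

definition g0 ::
  "('a, real ^ 'n) atlas \<Rightarrow> ('a, real ^ 'n) bform \<Rightarrow> ('a, real ^ 'n) chart \<Rightarrow>
     ('a, 'n) cpoint \<Rightarrow> 'n \<Rightarrow> real" where
  "g0 M g c z i = (\<Sum>h\<in>UNIV. p_coord M c z h * g_up M g c (fst z) $ h $ i)"

definition Gamma0 ::
  "('a, real ^ 'n) atlas \<Rightarrow> ('a, real ^ 'n) bform \<Rightarrow> ('a, real ^ 'n) chart \<Rightarrow>
     ('a, 'n) cpoint \<Rightarrow> 'n \<Rightarrow> 'n \<Rightarrow> real" where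
  "Gamma0 M g c z i h = (\<Sum>k\<in>UNIV. p_coord M c z k * christoffel M g c (fst z) k i h)"

definition energy ::
  "('a, real ^ 'n) atlas \<Rightarrow> ('a, real ^ 'n) bform \<Rightarrow> ('a, real ^ 'n) chart \<Rightarrow>
     ('a, 'n) cpoint \<Rightarrow> real" where
  "energy M g c z =
     (1 / 2) * (\<Sum>i\<in>UNIV. \<Sum>k\<in>UNIV. g_up M g c (fst z) $ i $ k * p_coord M c z i * p_coord M c z k)"

definition G_low ::
  "('a, real ^ 'n) atlas \<Rightarrow> ('a, real ^ 'n) bform \<Rightarrow> real \<Rightarrow> (real \<Rightarrow> real) \<Rightarrow>
     ('a, real ^ 'n) chart \<Rightarrow> ('a, 'n) cpoint \<Rightarrow> 'n \<Rightarrow> 'n \<Rightarrow> real" where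
  "G_low M g A v c z i j =
     (let t = energy M g c z in
        A * sqrt t * g_low M g c (fst z) $ i $ j + v t * p_coord M c z i * p_coord M c z j)"

definition w_coeff :: "real \<Rightarrow> (real \<Rightarrow> real) \<Rightarrow> real \<Rightarrow> real" where
  "w_coeff A v t = - v t / (A * t * (A + 2 * sqrt t * v t))"

definition H_up ::
  "('a, real ^ 'n) atlas \<Rightarrow> ('a, real ^ 'n) bform \<Rightarrow> real \<Rightarrow> (real \<Rightarrow> real) \<Rightarrow>
     ('a, real ^ 'n) chart \<Rightarrow> ('a, 'n) cpoint \<Rightarrow> 'n \<Rightarrow> 'n \<Rightarrow> real" where
  "H_up M g A v c z k l =
     (let t = energy M g c z in
        1 / (A * sqrt t) * g_up M g c (fst z) $ k $ l
        + w_coeff A v t * g0 M g c z k * g0 M g c z l)"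

type_synonym ('a, 'n) ctvec = "(('a, 'n) cpoint, (real ^ 'n) \<times> (real ^ 'n)) tvec"

definition d_dq ::
  "('a, real ^ 'n) atlas \<Rightarrow> ('a, real ^ 'n) chart \<Rightarrow> ('a, 'n) cpoint \<Rightarrow> 'n \<Rightarrow> ('a, 'n) ctvec" where
  "d_dq M c z i = coord_vec (nonzero_cotangent_bundle M) (induced_chart M c) z (axis i 1, 0)"

definition d_dp ::
  "('a, real ^ 'n) atlas \<Rightarrow> ('a, real ^ 'n) chart \<Rightarrow> ('a, 'n) cpoint \<Rightarrow> 'n \<Rightarrow> ('a, 'n) ctvec" where
  "d_dp M c z i = coord_vec (nonzero_cotangent_bundle M) (induced_chart M c) z (0, axis i 1)"

definition delta_dq ::
  "('a, real ^ 'n) atlas \<Rightarrow> ('a, real ^ 'n) bform \<Rightarrow> ('a, real ^ 'n) chart \<Rightarrow>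
     ('a, 'n) cpoint \<Rightarrow> 'n \<Rightarrow> ('a, 'n) ctvec" where
  "delta_dq M g c z i =
     (\<lambda>e. d_dq M c z i e + (\<Sum>h\<in>UNIV. Gamma0 M g c z i h *\<^sub>R d_dp M c z h e))"

definition dq ::
  "('a, real ^ 'n) atlas \<Rightarrow> ('a, real ^ 'n) chart \<Rightarrow> 'n \<Rightarrow> ('a, 'n) ctvec \<Rightarrow> real" where
  "dq M c i X = fst (X (induced_chart M c)) $ i"

definition dp ::
  "('a, real ^ 'n) atlas \<Rightarrow> ('a, real ^ 'n) chart \<Rightarrow> 'n \<Rightarrow> ('a, 'n) ctvec \<Rightarrow> real" where
  "dp M c i X = snd (X (induced_chart M c)) $ i"

definition Dp ::
  "('a, real ^ 'n) atlas \<Rightarrow> ('a, real ^ 'n) bform \<Rightarrow> ('a, real ^ 'n) chart \<Rightarrow>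
     ('a, 'n) cpoint \<Rightarrow> 'n \<Rightarrow> ('a, 'n) ctvec \<Rightarrow> real" where
  "Dp M g c z i X = dp M c i X - (\<Sum>j\<in>UNIV. Gamma0 M g c z i j * dq M c j X)"

definition G_local ::
  "('a, real ^ 'n) atlas \<Rightarrow> ('a, real ^ 'n) bform \<Rightarrow> real \<Rightarrow> (real \<Rightarrow> real) \<Rightarrow>
     ('a, real ^ 'n) chart \<Rightarrow> (('a, 'n) cpoint, (real ^ 'n) \<times> (real ^ 'n)) bform" where
  "G_local M g A v c z X Y =
     (\<Sum>i\<in>UNIV. \<Sum>j\<in>UNIV. G_low M g A v c z i j * dq M c i X * dq M c j Y)
   + (\<Sum>i\<in>UNIV. \<Sum>j\<in>UNIV. H_up M g A v c z i j * Dp M g c z i X * Dp M g c z j Y)"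

text \<open>The linear extension of
  $J\frac{\delta}{\delta q^i} = G_{ik}\frac{\partial}{\partial p_k}$ and
  $J\frac{\partial}{\partial p_i} = -H^{ik}\frac{\delta}{\delta q^k}$, the coefficients of \<open>X\<close>
  in the adapted frame being given by the dual frame.\<close>

definition J_local ::
  "('a, real ^ 'n) atlas \<Rightarrow> ('a, real ^ 'n) bform \<Rightarrow> real \<Rightarrow> (real \<Rightarrow> real) \<Rightarrow>
     ('a, real ^ 'n) chart \<Rightarrow> (('a, 'n) cpoint, (real ^ 'n) \<times> (real ^ 'n)) endo" where
  "J_local M g A v c z X =
     (\<lambda>e. (\<Sum>i\<in>UNIV. dq M c i X *\<^sub>R (\<Sum>k\<in>UNIV. G_low M g A v c z i k *\<^sub>R d_dp M c z k e))
        + (\<Sum>i\<in>UNIV. Dp M g c z i X *\<^sub>R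
             (- (\<Sum>k\<in>UNIV. H_up M g A v c z i k *\<^sub>R delta_dq M g c z k e))))"


section \<open>The metric and the almost complex structure\<close>

text \<open>The local expressions do not depend on the chart. Nothing below presupposes this: at each
  point an arbitrary chart is used, so that smoothness of \<open>kaehler_G\<close> and \<open>kaehler_J\<close> is a
  genuine claim.\<close>

definition kaehler_G ::
  "('a, real ^ 'n) atlas \<Rightarrow> ('a, real ^ 'n) bform \<Rightarrow> real \<Rightarrow> (real \<Rightarrow> real) \<Rightarrow>
     (('a, 'n) cpoint, (real ^ 'n) \<times> (real ^ 'n)) bform" where
  "kaehler_G M g A v z = G_local M g A v (SOME c. c \<in> charts_at M (fst z)) z"

definition kaehler_J ::
  "('a, real ^ 'n) atlas \<Rightarrow> ('a, real ^ 'n) bform \<Rightarrow> real \<Rightarrow> (real \<Rightarrow> real) \<Rightarrow>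
     (('a, 'n) cpoint, (real ^ 'n) \<times> (real ^ 'n)) endo" where
  "kaehler_J M g A v z = J_local M g A v (SOME c. c \<in> charts_at M (fst z)) z"

end

theory Submission
  imports Defs
begin

text \<open>At each covector everything reduces to linear algebra in the adapted frame. There the metric is the
  block matrix with diagonal blocks \<open>G_mat\<close> and \<open>H_mat\<close>, and the complex structure has the
  off-diagonal blocks \<open>- H_mat\<close> and \<open>G_mat\<close>. The matrix \<open>G_mat\<close> is a rank one
  modification of a positive multiple of \<open>g\<close>. By the Cauchy--Schwarz inequality the bound on \<open>v\<close>
  makes it positive definite (\<open>pos_def_rank_one_update\<close>), and \<open>H_mat\<close> is its inverse by the
  Sherman--Morrison formula (\<open>matrix_inv_rank_one_update\<close>). Hence the metric is Riemannian, the
  square of the complex structure is \<open>- 1\<close>, and the complex structure is an isometry.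

  In the fundamental form the two blocks cancel, which leaves the pairing of \<open>Dp\<close> with \<open>dq\<close>. The
  Christoffel symbols in \<open>Dp\<close> contribute nothing because they are symmetric. The fundamental form is
  therefore the canonical symplectic form, whatever \<open>A\<close> and \<open>v\<close> are
  (\<open>fundamental_form_canonical\<close>). Its coefficients in an induced chart are constant, so it is closed.

  The global definitions use an arbitrary chart at each point, so smoothness requires that the local
  expressions do not depend on the chart. In the invariant formulation used here, a transition map with
  derivative \<open>L\<close> acts on vectors by \<open>L\<close>, and momenta, metric and \<open>Dp\<close> are invariant when
  evaluated on vectors transported by \<open>L\<close>. For \<open>Dp\<close> this is the point that needs the
  transformation law of the Christoffel symbols (\<open>christoffel_form_change\<close>): its second derivatives
  of the transition map compensate those produced by differentiating the law of the momenta
  (\<open>induced_chart_tangent_change\<close>). The law itself rests on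
  the symmetry of second derivatives (\<open>second_derivative_symmetric\<close>).

  The cotangent bundle inherits its manifold structure from the base. Momenta transform by the
  derivative of the reverse transition map, so the induced transition maps are smooth. A countable cover by
  charts of the base induces one of the bundle, and covectors are separated either in the base or within
  a single induced chart.\<close>


section \<open>Calculus of smooth functions\<close>

lemma frechet_derivative_cong:
  assumes "open S" "x \<in> S" "\<And>y. y \<in> S \<Longrightarrow> f y = g y"
  shows "frechet_derivative f (at x) = frechet_derivative g (at x)"
proof -
  have "(f has_derivative D) (at x) \<longleftrightarrow> (g has_derivative D) (at x)" for D
    using assms has_derivative_transform_within_open[of f D x UNIV S g]
      has_derivative_transform_within_open[of g D x UNIV S f] by auto
  then show ?thesis
    by (simp add: frechet_derivative_def)
qed

lemma differentiable_cong:
  assumes "open S" "x \<in> S" "\<And>y. y \<in> S \<Longrightarrow> f y = g y"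
  shows "f differentiable (at x) \<longleftrightarrow> g differentiable (at x)"
  using assms has_derivative_transform_within_open[of f _ x UNIV S g]
    has_derivative_transform_within_open[of g _ x UNIV S f] unfolding differentiable_def by metis

lemma Ck_on_cong:
  assumes "open S" "\<And>y. y \<in> S \<Longrightarrow> f y = g y"
  shows "Ck_on k S f \<longleftrightarrow> Ck_on k S g"
  using assms(2)
proof (induction k arbitrary: f g)
  case 0
  then show ?case
    by (simp cong: continuous_on_cong)
next
  case (Suc k)
  have "Ck_on k S (\<lambda>x. frechet_derivative f (at x) u) \<longleftrightarrow>
      Ck_on k S (\<lambda>x. frechet_derivative g (at x) u)" for u
    by (rule Suc.IH) (metis frechet_derivative_cong[OF assms(1)] Suc.prems)
  moreover have "f differentiable (at x) \<longleftrightarrow> g differentiable (at x)" if "x \<in> S" for x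
    using differentiable_cong[OF assms(1) that, of f g] Suc.prems by simp
  ultimately show ?case
    by simp
qed

lemma Ck_on_SucD: "Ck_on (Suc k) S f \<Longrightarrow> Ck_on k S f"
proof (induction k arbitrary: f)
  case 0
  then show ?case
    by (auto intro!: continuous_at_imp_continuous_on differentiable_imp_continuous_within)
next
  case (Suc k)
  then show ?case
    using Ck_on.simps(2) by blast
qed

lemma Ck_on_const: "Ck_on k S (\<lambda>x. c)"
  by (induction k arbitrary: c) (auto simp: frechet_derivative_const)

lemma Ck_on_bounded_linear:
  assumes "bounded_linear f"
  shows "Ck_on k S f"
proof (cases k)
  case 0
  then show ?thesis
    using assms by (simp add: linear_continuous_on)
next
  case (Suc m)
  then show ?thesis
    using assms by (auto simp: bounded_linear_imp_differentiable Ck_on_const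
        frechet_derivative_at[OF bounded_linear_imp_has_derivative, symmetric])
qed

lemma Ck_on_add:
  assumes "open S" "Ck_on k S f" "Ck_on k S g"
  shows "Ck_on k S (\<lambda>x. f x + g x)"
  using assms(2-)
proof (induction k arbitrary: f g)
  case 0
  then show ?case
    by (simp add: continuous_on_add)
next
  case (Suc k)
  have eq: "frechet_derivative (\<lambda>x. f x + g x) (at x) u
      = frechet_derivative f (at x) u + frechet_derivative g (at x) u" if "x \<in> S" for x u
  proof -
    have "((\<lambda>x. f x + g x) has_derivative
        (\<lambda>u. frechet_derivative f (at x) u + frechet_derivative g (at x) u)) (at x)"
      using Suc.prems that by (intro has_derivative_add) (auto simp: frechet_derivative_works)
    from frechet_derivative_at[OF this] show ?thesis
      by metis
  qed
  have "Ck_on k S (\<lambda>x. frechet_derivative (\<lambda>x. f x + g x) (at x) u)" for u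
    by (rule iffD2[OF Ck_on_cong[OF assms(1)]], erule eq) (use Suc in auto)
  then show ?case
    using Suc.prems by auto
qed

lemma Ck_on_sum:
  assumes "open S" "\<And>i. i \<in> I \<Longrightarrow> Ck_on k S (f i)"
  shows "Ck_on k S (\<lambda>x. \<Sum>i\<in>I. f i x)"
  using assms(2) by (induction I rule: infinite_finite_induct)
    (auto simp: Ck_on_const intro!: Ck_on_add assms(1))

lemma Ck_on_bilinear:
  assumes b: "bounded_bilinear b" and S: "open S" and "Ck_on k S f" "Ck_on k S g"
  shows "Ck_on k S (\<lambda>x. b (f x) (g x))"
  using assms(3-)
proof (induction k arbitrary: f g)
  case 0
  then show ?case
    using bounded_bilinear.continuous_on[OF b] by simp
next
  case (Suc k)
  have D: "((\<lambda>x. b (f x) (g x)) has_derivative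
      (\<lambda>u. b (f x) (frechet_derivative g (at x) u) + b (frechet_derivative f (at x) u) (g x))) (at x)"
    if "x \<in> S" for x
    using bounded_bilinear.FDERIV[OF b, of f _ x UNIV g] Suc.prems that
    by (auto simp: frechet_derivative_works)
  have eq: "frechet_derivative (\<lambda>x. b (f x) (g x)) (at x) u
      = b (f x) (frechet_derivative g (at x) u) + b (frechet_derivative f (at x) u) (g x)"
    if "x \<in> S" for x u
    using frechet_derivative_at[OF D[OF that]] by metis
  have "Ck_on k S (\<lambda>x. frechet_derivative (\<lambda>x. b (f x) (g x)) (at x) u)" for u
    by (rule iffD2[OF Ck_on_cong[OF S]], erule eq)
      (use Suc Ck_on_SucD[of k S f] Ck_on_SucD[of k S g] in \<open>auto intro!: Ck_on_add S\<close>)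
  then show ?case
    using D by (auto simp: differentiable_def)
qed

text \<open>Differentiability passes to a composition by the chain rule. For the induction on the order,
  the derivative of the outer function is expanded in the standard basis: this displays the
  derivative of the composition as a sum of products of functions of one order less, all but one of
  them compositions with the same inner function.\<close>

lemma Ck_on_compose:
  fixes f :: "'f::euclidean_space \<Rightarrow> 'b::real_normed_vector"
    and h :: "'e::euclidean_space \<Rightarrow> 'f"
  assumes S: "open S" and "Ck_on k T f" "Ck_on k S h" and ST: "h ` S \<subseteq> T"
  shows "Ck_on k S (\<lambda>x. f (h x))"
  using assms(2,3)
proof (induction k arbitrary: f)
  case 0
  then show ?case
    using ST by (auto intro: continuous_on_compose2)
next
  case (Suc k)
  have df: "(f has_derivative frechet_derivative f (at (h x))) (at (h x))" if "x \<in> S" for x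
    using Suc.prems ST that by (auto simp: frechet_derivative_works[symmetric])
  have dh: "(h has_derivative frechet_derivative h (at x)) (at x)" if "x \<in> S" for x
    using Suc.prems that by (auto simp: frechet_derivative_works[symmetric])
  have D: "((\<lambda>x. f (h x)) has_derivative
      (\<lambda>u. frechet_derivative f (at (h x)) (frechet_derivative h (at x) u))) (at x)"
    if "x \<in> S" for x
    using diff_chain_at[OF dh[OF that] df[OF that]] by (simp add: o_def)
  have eq: "frechet_derivative (\<lambda>x. f (h x)) (at x) u
      = (\<Sum>b\<in>Basis. (frechet_derivative h (at x) u \<bullet> b) *\<^sub>R frechet_derivative f (at (h x)) b)"
    if x: "x \<in> S" for x u
  proof -
    interpret bounded_linear "frechet_derivative f (at (h x))"
      using df[OF x] by (rule has_derivative_bounded_linear)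
    have "frechet_derivative (\<lambda>x. f (h x)) (at x) u
        = frechet_derivative f (at (h x)) (frechet_derivative h (at x) u)"
      using frechet_derivative_at[OF D[OF x]] by metis
    also have "\<dots> = frechet_derivative f (at (h x))
        (\<Sum>b\<in>Basis. (frechet_derivative h (at x) u \<bullet> b) *\<^sub>R b)"
      by (simp add: euclidean_representation)
    finally show ?thesis
      by (simp add: sum scaleR)
  qed
  have "Ck_on k S (\<lambda>x. frechet_derivative (\<lambda>x. f (h x)) (at x) u)" for u
  proof -
    have hk: "Ck_on k S h"
      using Suc.prems(2) Ck_on_SucD by blast
    have hu: "Ck_on k S (\<lambda>x. frechet_derivative h (at x) u)"
      using Suc.prems(2) by simp
    have "Ck_on k S (\<lambda>x. frechet_derivative h (at x) u \<bullet> b)" for b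
      by (rule Ck_on_bilinear[OF bounded_bilinear_inner S hu Ck_on_const])
    moreover have "Ck_on k S (\<lambda>x. frechet_derivative f (at (h x)) b)" for b
      using Suc.prems(1) hk by (intro Suc.IH) auto
    ultimately have "Ck_on k S (\<lambda>x. \<Sum>b\<in>Basis.
        (frechet_derivative h (at x) u \<bullet> b) *\<^sub>R frechet_derivative f (at (h x)) b)"
      by (intro Ck_on_sum S Ck_on_bilinear[OF bounded_bilinear_scaleR S])
    then show ?thesis
      by (rule iffD2[OF Ck_on_cong[OF S], rotated]) (erule eq)
  qed
  then show ?case
    using D by (auto simp: differentiable_def)
qed

text \<open>The inverse and the square root satisfy differential equations that express the derivative through
  the function itself. This lets an induction on the order pass from \<open>k\<close> to \<open>k + 1\<close>.\<close>

lemma Ck_on_inverse: "Ck_on k {0<..} (inverse :: real \<Rightarrow> real)"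
proof (induction k)
  case 0
  show ?case
    by (auto intro!: continuous_intros)
next
  case (Suc k)
  have D: "(inverse has_derivative (\<lambda>u. - (inverse x * u * inverse x))) (at x)"
    if "x \<in> {0<..}" for x :: real
    using that by (intro has_derivative_inverse') simp
  have eq: "frechet_derivative inverse (at x) u = (- u) * (inverse x * inverse x)"
    if "x \<in> {0<..}" for x u :: real
    using frechet_derivative_at[OF D[OF that]] by (metis mult.assoc mult.commute mult_minus_left)
  have "Ck_on k {0<..} (\<lambda>x::real. frechet_derivative inverse (at x) u)" for u
    by (rule iffD2[OF Ck_on_cong[OF open_greaterThan]], erule eq)
      (intro Ck_on_bilinear[OF bounded_bilinear_mult] open_greaterThan Ck_on_const Suc)
  then show ?case
    using D by (auto simp: differentiable_def)
qed

lemma Ck_on_sqrt: "Ck_on k {0<..} sqrt"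
proof (induction k)
  case 0
  show ?case
    by (auto intro!: continuous_intros)
next
  case (Suc k)
  have D: "(sqrt has_derivative (\<lambda>u. u * (inverse (sqrt x) / 2))) (at x)"
    if "x \<in> {0<..}" for x
  proof -
    have "(sqrt has_derivative (*) (inverse (sqrt x) / 2)) (at x)"
      using DERIV_real_sqrt[of x] that unfolding has_field_derivative_def by simp
    then show ?thesis
      by (rule has_derivative_eq_rhs) (simp add: fun_eq_iff)
  qed
  have eq: "frechet_derivative sqrt (at x) u = inverse (sqrt x) * (u / 2)"
    if "x \<in> {0<..}" for x u
    using frechet_derivative_at[OF D[OF that]]
    by (metis (no_types, lifting) mult.commute times_divide_eq_right)
  have "Ck_on k {0<..} (\<lambda>x. frechet_derivative sqrt (at x) u)" for u
    by (rule iffD2[OF Ck_on_cong[OF open_greaterThan]], erule eq)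
      (intro Ck_on_bilinear[OF bounded_bilinear_mult] open_greaterThan Ck_on_const
        Ck_on_compose[OF _ Ck_on_inverse Suc]; auto)
  then show ?case
    using D by (auto simp: differentiable_def)
qed

lemma smooth_on_cong:
  assumes "open S" "\<And>y. y \<in> S \<Longrightarrow> f y = g y"
  shows "smooth_on S f \<longleftrightarrow> smooth_on S g"
  unfolding smooth_on_def using Ck_on_cong[OF assms(1), of f g] assms(2) by simp

lemma smooth_on_const: "smooth_on S (\<lambda>x. c)"
  unfolding smooth_on_def using Ck_on_const by blast

lemma smooth_on_bounded_linear: "bounded_linear f \<Longrightarrow> smooth_on S f"
  unfolding smooth_on_def using Ck_on_bounded_linear by blast

lemma smooth_on_bilinear:
  "bounded_bilinear b \<Longrightarrow> open S \<Longrightarrow> smooth_on S f \<Longrightarrow> smooth_on S g \<Longrightarrow>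
    smooth_on S (\<lambda>x. b (f x) (g x))"
  unfolding smooth_on_def using Ck_on_bilinear by blast

lemmas smooth_on_mult = smooth_on_bilinear[OF bounded_bilinear_mult]

lemma smooth_on_add:
  "open S \<Longrightarrow> smooth_on S f \<Longrightarrow> smooth_on S g \<Longrightarrow> smooth_on S (\<lambda>x. f x + g x)"
  unfolding smooth_on_def using Ck_on_add by blast

lemma smooth_on_minus: "open S \<Longrightarrow> smooth_on S f \<Longrightarrow> smooth_on S (\<lambda>x. - f x)"
  using smooth_on_bilinear[OF bounded_bilinear_scaleR _ smooth_on_const[of S "- 1"], of f]
  by (simp only: scaleR_minus1_left)

lemma smooth_on_diff:
  "open S \<Longrightarrow> smooth_on S f \<Longrightarrow> smooth_on S g \<Longrightarrow> smooth_on S (\<lambda>x. f x - g x)"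
  using smooth_on_add[OF _ _ smooth_on_minus, of S f g] by (simp only: diff_conv_add_uminus)

lemma smooth_on_sum:
  "open S \<Longrightarrow> (\<And>i. i \<in> I \<Longrightarrow> smooth_on S (f i)) \<Longrightarrow> smooth_on S (\<lambda>x. \<Sum>i\<in>I. f i x)"
  by (simp add: smooth_on_def Ck_on_sum)

lemma smooth_on_prod:
  fixes f :: "'i \<Rightarrow> 'e::euclidean_space \<Rightarrow> real"
  assumes "open S" "\<And>i. i \<in> I \<Longrightarrow> smooth_on S (f i)"
  shows "smooth_on S (\<lambda>x. \<Prod>i\<in>I. f i x)"
  using assms(2) by (induction I rule: infinite_finite_induct)
    (auto simp: smooth_on_const intro!: smooth_on_mult assms(1))

lemma smooth_on_compose:
  fixes h :: "'e::euclidean_space \<Rightarrow> 'f::euclidean_space"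
  shows "open S \<Longrightarrow> smooth_on T f \<Longrightarrow> smooth_on S h \<Longrightarrow> h ` S \<subseteq> T \<Longrightarrow>
    smooth_on S (\<lambda>x. f (h x))"
  unfolding smooth_on_def using Ck_on_compose[of S _ T f h] by blast

lemma smooth_on_linear_compose:
  fixes h :: "'e::euclidean_space \<Rightarrow> 'f::euclidean_space"
  shows "bounded_linear f \<Longrightarrow> open S \<Longrightarrow> smooth_on S h \<Longrightarrow> smooth_on S (\<lambda>x. f (h x))"
  using smooth_on_compose[of S UNIV f h] by (simp add: smooth_on_bounded_linear)

lemma smooth_on_sqrt:
  assumes "open S" "smooth_on S f" "\<And>x. x \<in> S \<Longrightarrow> f x > 0"
  shows "smooth_on S (\<lambda>x. sqrt (f x))"
  by (rule smooth_on_compose[where T = "{0<..}" and f = sqrt and h = f])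
    (use assms Ck_on_sqrt in \<open>auto simp: smooth_on_def\<close>)

lemma smooth_on_inverse:
  fixes f :: "'e::euclidean_space \<Rightarrow> real"
  assumes S: "open S" and f: "smooth_on S f" and nz: "\<And>x. x \<in> S \<Longrightarrow> f x \<noteq> 0"
  shows "smooth_on S (\<lambda>x. inverse (f x))"
proof -
  \<comment> \<open>\<open>Ck_on_inverse\<close> covers positive arguments only; passing to the square removes the sign.\<close>
  have ff: "smooth_on S (\<lambda>x. f x * f x)"
    using smooth_on_mult[OF S f f] .
  have "smooth_on S (\<lambda>x. inverse (f x * f x))"
    using Ck_on_inverse ff nz
    by (intro smooth_on_compose[where T = "{0<..}" and f = inverse and h = "\<lambda>x. f x * f x"] S)
      (auto simp: smooth_on_def zero_less_mult_iff dest!: nz)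
  then have "smooth_on S (\<lambda>x. f x * inverse (f x * f x))"
    using smooth_on_mult[OF S f] by blast
  then show ?thesis
    using nz by (subst smooth_on_cong[OF S, of _ "\<lambda>x. f x * inverse (f x * f x)"])
      (auto simp: field_simps)
qed

lemma smooth_on_vec:
  fixes f :: "'e::euclidean_space \<Rightarrow> 'n::finite \<Rightarrow> 'b::euclidean_space"
  assumes S: "open S" and f: "\<And>i. smooth_on S (\<lambda>x. f x i)"
  shows "smooth_on S (\<lambda>x. \<chi> i. f x i)"
proof -
  have "bounded_linear (\<lambda>y::'b. axis i y)" for i :: 'n
    by (rule linear_conv_bounded_linear[THEN iffD1])
      (auto intro!: linearI simp: vec_eq_iff axis_def)
  then have "smooth_on S (\<lambda>x. axis i (f x i))" for i
    using smooth_on_linear_compose[OF _ S f[of i]] by blast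
  then have "smooth_on S (\<lambda>x. \<Sum>i\<in>UNIV. axis i (f x i))"
    by (intro smooth_on_sum S)
  moreover have "(\<Sum>i\<in>UNIV. axis i (f x i)) = (\<chi> i. f x i)" for x
    by (simp add: vec_eq_iff axis_def if_distrib cong: if_cong)
  ultimately show ?thesis
    by simp
qed

lemma smooth_on_nth:
  fixes f :: "'e::euclidean_space \<Rightarrow> 'b::euclidean_space ^ 'n"
  shows "open S \<Longrightarrow> smooth_on S f \<Longrightarrow> smooth_on S (\<lambda>x. f x $ i)"
  using smooth_on_linear_compose[OF bounded_linear_vec_nth] .

lemma smooth_on_Pair:
  fixes f :: "'e::euclidean_space \<Rightarrow> 'b::euclidean_space" and h :: "'e \<Rightarrow> 'c::euclidean_space"
  assumes S: "open S" and f: "smooth_on S f" and h: "smooth_on S h"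
  shows "smooth_on S (\<lambda>x. (f x, h x))"
proof -
  have "bounded_linear (\<lambda>y::'b. (y, 0::'c))" "bounded_linear (\<lambda>y::'c. (0::'b, y))"
    by (auto intro!: bounded_linear_Pair bounded_linear_ident bounded_linear_zero)
  then have "smooth_on S (\<lambda>x. (f x, 0::'c) + (0::'b, h x))"
    using smooth_on_linear_compose[of "\<lambda>y. (y, 0)", OF _ S f]
      smooth_on_linear_compose[of "\<lambda>y. (0, y)", OF _ S h]
    by (intro smooth_on_add S)
  then show ?thesis
    by simp
qed

lemma smooth_on_fst:
  fixes f :: "'e::euclidean_space \<Rightarrow> 'b::euclidean_space \<times> 'c::euclidean_space"
  shows "open S \<Longrightarrow> smooth_on S f \<Longrightarrow> smooth_on S (\<lambda>x. fst (f x))"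
  using smooth_on_linear_compose[OF bounded_linear_fst] .

lemma smooth_on_snd:
  fixes f :: "'e::euclidean_space \<Rightarrow> 'b::euclidean_space \<times> 'c::euclidean_space"
  shows "open S \<Longrightarrow> smooth_on S f \<Longrightarrow> smooth_on S (\<lambda>x. snd (f x))"
  using smooth_on_linear_compose[OF bounded_linear_snd] .

lemma smooth_on_ident: "smooth_on S (\<lambda>x. x)"
  by (rule smooth_on_bounded_linear) (rule bounded_linear_ident)

lemma smooth_on_has_derivative:
  assumes "smooth_on S f" "x \<in> S"
  shows "(f has_derivative frechet_derivative f (at x)) (at x)"
proof -
  have "Ck_on (Suc 0) S f"
    using assms(1) unfolding smooth_on_def by blast
  then show ?thesis
    using assms(2) by (simp add: frechet_derivative_works[symmetric])
qed

lemma smooth_on_frechet_derivative: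
  "smooth_on S f \<Longrightarrow> smooth_on S (\<lambda>x. frechet_derivative f (at x) u)"
  unfolding smooth_on_def
proof
  fix k
  assume "\<forall>k. Ck_on k S f"
  then have "Ck_on (Suc k) S f" ..
  then show "Ck_on k S (\<lambda>x. frechet_derivative f (at x) u)"
    by simp
qed

lemma smooth_on_imp_continuous_on: "smooth_on S f \<Longrightarrow> continuous_on S f"
  unfolding smooth_on_def by (drule spec[of _ 0]) simp


section \<open>Symmetry of second derivatives\<close>

text \<open>A mixed difference quotient of a function is, by the mean value theorem applied once in each
  direction, a value of the second derivative at a nearby point.\<close>

lemma second_difference_mean_value:
  fixes f :: "'e::euclidean_space \<Rightarrow> real"
  assumes f: "smooth_on S f" and h: "h > 0"
    and sub: "\<And>s t. 0 \<le> s \<Longrightarrow> s \<le> h \<Longrightarrow> 0 \<le> t \<Longrightarrow> t \<le> h \<Longrightarrow> x + s *\<^sub>R u + t *\<^sub>R w \<in> S"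
  obtains s t where "0 \<le> s" "s \<le> h" "0 \<le> t" "t \<le> h"
    "f (x + h *\<^sub>R u + h *\<^sub>R w) - f (x + h *\<^sub>R u) - f (x + h *\<^sub>R w) + f x
      = h * (h * frechet_derivative (\<lambda>y. frechet_derivative f (at y) u) (at (x + s *\<^sub>R u + t *\<^sub>R w)) w)"
proof -
  let ?D = "\<lambda>y. frechet_derivative f (at y)"
  have dline: "((\<lambda>s. k (y + s *\<^sub>R d)) has_derivative (\<lambda>r. r * frechet_derivative k (at (y + s *\<^sub>R d)) d))
      (at s within X)"
    if k: "smooth_on S k" and "y + s *\<^sub>R d \<in> S" for k :: "'e \<Rightarrow> real" and y d s X
  proof -
    note dk = smooth_on_has_derivative[OF that]
    have "((\<lambda>s. k (y + s *\<^sub>R d)) has_derivative (\<lambda>r. frechet_derivative k (at (y + s *\<^sub>R d)) (r *\<^sub>R d)))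
        (at s within X)"
      using has_derivative_at_withinI[OF dk]
      by (intro has_derivative_compose[where g = k and f = "\<lambda>s. y + s *\<^sub>R d"] dk)
        (auto intro!: derivative_eq_intros)
    then show ?thesis
      using linear_scale[OF has_derivative_linear[OF dk]] by simp
  qed
  let ?p = "\<lambda>s. f ((x + h *\<^sub>R w) + s *\<^sub>R u) - f (x + s *\<^sub>R u)"
  have "\<exists>s\<in>{0<..<h}. ?p h - ?p 0 =
      (h - 0) * ?D ((x + h *\<^sub>R w) + s *\<^sub>R u) u - (h - 0) * ?D (x + s *\<^sub>R u) u"
    using h sub[of _ h] sub[of _ 0]
    by (intro mvt_simple has_derivative_diff dline[OF f]) (auto simp: algebra_simps)
  then obtain s where s: "0 < s" "s < h"
    and ps: "?p h - ?p 0 = h * (?D ((x + s *\<^sub>R u) + h *\<^sub>R w) u - ?D ((x + s *\<^sub>R u) + 0 *\<^sub>R w) u)"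
    by (auto simp: algebra_simps)
  have "\<exists>t\<in>{0<..<h}. ?D ((x + s *\<^sub>R u) + h *\<^sub>R w) u - ?D ((x + s *\<^sub>R u) + 0 *\<^sub>R w) u =
      (h - 0) * frechet_derivative (\<lambda>y. ?D y u) (at ((x + s *\<^sub>R u) + t *\<^sub>R w)) w"
    using h s sub[of s] by (intro mvt_simple dline[OF smooth_on_frechet_derivative[OF f]]) auto
  then obtain t where "0 < t" "t < h"
    and "?D ((x + s *\<^sub>R u) + h *\<^sub>R w) u - ?D ((x + s *\<^sub>R u) + 0 *\<^sub>R w) u =
      h * frechet_derivative (\<lambda>y. ?D y u) (at ((x + s *\<^sub>R u) + t *\<^sub>R w)) w"
    by auto
  with ps s that[of s t] show ?thesis
    by (auto simp: algebra_simps)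
qed

text \<open>The difference quotient of the preceding lemma is symmetric in the two directions. It is thus a value
  of both second derivatives, at points that tend to \<open>x\<close> with the size of the parallelogram, and
  continuity identifies the two limits.\<close>

lemma second_derivative_symmetric_real:
  fixes f :: "'e::euclidean_space \<Rightarrow> real"
  assumes S: "open S" and f: "smooth_on S f" and x: "x \<in> S"
  shows "frechet_derivative (\<lambda>y. frechet_derivative f (at y) u) (at x) w
       = frechet_derivative (\<lambda>y. frechet_derivative f (at y) w) (at x) u"
proof (rule ccontr)
  let ?E = "\<lambda>u w y. frechet_derivative (\<lambda>y. frechet_derivative f (at y) u) (at y) w"
  assume "\<not> ?thesis"
  then have pos: "\<bar>?E u w x - ?E w u x\<bar> / 2 > 0" (is "?e > 0")
    by simp
  have cont: "isCont (?E u w) x" for u w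
    using smooth_on_imp_continuous_on[OF smooth_on_frechet_derivative[OF
          smooth_on_frechet_derivative[OF f]]] S x
    by (auto simp: continuous_on_eq_continuous_at)
  obtain d1 where d1: "d1 > 0" "\<And>y. dist y x < d1 \<Longrightarrow> dist (?E u w y) (?E u w x) < ?e"
    using cont[of u w] pos unfolding continuous_at_eps_delta by blast
  obtain d2 where d2: "d2 > 0" "\<And>y. dist y x < d2 \<Longrightarrow> dist (?E w u y) (?E w u x) < ?e"
    using cont[of w u] pos unfolding continuous_at_eps_delta by blast
  obtain d3 where d3: "d3 > 0" "ball x d3 \<subseteq> S"
    using S x openE by blast
  define d where "d = min d1 (min d2 d3)"
  \<comment> \<open>A parallelogram of side \<open>h\<close> at \<open>x\<close> stays within distance \<open>d\<close> of \<open>x\<close>.\<close>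
  define h where "h = d / (norm u + norm w + 1)"
  have dpos: "d > 0" and h: "h > 0"
    using d1 d2 d3 by (auto simp: d_def h_def add_nonneg_pos)
  have near: "dist (x + s *\<^sub>R a + t *\<^sub>R b) x < d"
    if "0 \<le> s" "s \<le> h" "0 \<le> t" "t \<le> h" "norm a + norm b = norm u + norm w" for s t a b
  proof -
    have "norm (s *\<^sub>R a + t *\<^sub>R b) \<le> s * norm a + t * norm b"
      using that norm_triangle_ineq[of "s *\<^sub>R a" "t *\<^sub>R b"] by simp
    also have "\<dots> \<le> h * norm a + h * norm b"
      using that by (intro add_mono mult_right_mono) auto
    also have "\<dots> = h * (norm u + norm w)"
      using that by (metis distrib_left)
    also have "\<dots> < h * (norm u + norm w + 1)"
      using h by simp
    also have "\<dots> = d"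
      unfolding h_def by (smt (verit) nonzero_eq_divide_eq norm_ge_zero)
    finally show ?thesis
      by (simp add: dist_norm add.assoc)
  qed
  have inS: "x + s *\<^sub>R a + t *\<^sub>R b \<in> S"
    if "0 \<le> s" "s \<le> h" "0 \<le> t" "t \<le> h" "norm a + norm b = norm u + norm w" for s t a b
    using near[OF that] d3 by (auto simp: d_def dist_commute)
  obtain s t where st: "0 \<le> s" "s \<le> h" "0 \<le> t" "t \<le> h"
    and E1: "f (x + h *\<^sub>R u + h *\<^sub>R w) - f (x + h *\<^sub>R u) - f (x + h *\<^sub>R w) + f x
      = h * (h * ?E u w (x + s *\<^sub>R u + t *\<^sub>R w))"
    by (rule second_difference_mean_value[OF f h, of x u w]) (use inS in auto)
  obtain s' t' where st': "0 \<le> s'" "s' \<le> h" "0 \<le> t'" "t' \<le> h"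
    and E2: "f (x + h *\<^sub>R w + h *\<^sub>R u) - f (x + h *\<^sub>R w) - f (x + h *\<^sub>R u) + f x
      = h * (h * ?E w u (x + s' *\<^sub>R w + t' *\<^sub>R u))"
    by (rule second_difference_mean_value[OF f h, of x w u]) (use inS in auto)
  have "x + h *\<^sub>R w + h *\<^sub>R u = x + h *\<^sub>R u + h *\<^sub>R w"
    by (simp add: algebra_simps)
  with E2 have "f (x + h *\<^sub>R u + h *\<^sub>R w) - f (x + h *\<^sub>R u) - f (x + h *\<^sub>R w) + f x
      = h * (h * ?E w u (x + s' *\<^sub>R w + t' *\<^sub>R u))"
    by simp
  with E1 have "h * (h * ?E u w (x + s *\<^sub>R u + t *\<^sub>R w)) = h * (h * ?E w u (x + s' *\<^sub>R w + t' *\<^sub>R u))"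
    by (rule trans[OF sym])
  with h have "?E u w (x + s *\<^sub>R u + t *\<^sub>R w) = ?E w u (x + s' *\<^sub>R w + t' *\<^sub>R u)"
    by simp
  moreover have "dist (?E u w (x + s *\<^sub>R u + t *\<^sub>R w)) (?E u w x) < ?e"
    using near[OF st] by (intro d1) (simp add: d_def)
  moreover have "dist (?E w u (x + s' *\<^sub>R w + t' *\<^sub>R u)) (?E w u x) < ?e"
    using near[OF st'] by (intro d2) (simp add: d_def)
  ultimately show False
    by (simp add: dist_real_def abs_if field_simps split: if_splits)
qed

lemma frechet_derivative_inner:
  assumes "f differentiable (at x)"
  shows "frechet_derivative (\<lambda>y. f y \<bullet> b) (at x) u = frechet_derivative f (at x) u \<bullet> b"
  using frechet_derivative_at[OF bounded_linear.has_derivative[OF bounded_linear_inner_left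
        assms[unfolded frechet_derivative_works]]] by metis

text \<open>Vector-valued functions are reduced to their components.\<close>

lemma second_derivative_symmetric:
  fixes f :: "'e::euclidean_space \<Rightarrow> 'b::euclidean_space"
  assumes S: "open S" and f: "smooth_on S f" and x: "x \<in> S"
  shows "frechet_derivative (\<lambda>y. frechet_derivative f (at y) u) (at x) w
       = frechet_derivative (\<lambda>y. frechet_derivative f (at y) w) (at x) u"
proof (rule euclidean_eqI)
  fix b :: 'b
  have diff: "f differentiable (at y)" if "y \<in> S" for y
    using smooth_on_has_derivative[OF f that] by (auto simp: differentiable_def)
  have E: "frechet_derivative (\<lambda>y. frechet_derivative (\<lambda>z. f z \<bullet> b) (at y) u) (at x) w
      = frechet_derivative (\<lambda>y. frechet_derivative f (at y) u) (at x) w \<bullet> b" for u w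
  proof -
    have "frechet_derivative (\<lambda>y. frechet_derivative (\<lambda>z. f z \<bullet> b) (at y) u) (at x)
        = frechet_derivative (\<lambda>y. frechet_derivative f (at y) u \<bullet> b) (at x)"
      by (rule frechet_derivative_cong[OF S x]) (simp add: frechet_derivative_inner diff)
    moreover have "(\<lambda>y. frechet_derivative f (at y) u) differentiable (at x)"
      using smooth_on_has_derivative[OF smooth_on_frechet_derivative[OF f] x]
      by (auto simp: differentiable_def)
    ultimately show ?thesis
      by (simp add: frechet_derivative_inner)
  qed
  have "smooth_on S (\<lambda>z. f z \<bullet> b)"
    by (intro smooth_on_bilinear[OF bounded_bilinear_inner] S f smooth_on_const)
  from second_derivative_symmetric_real[OF S this x]
  show "frechet_derivative (\<lambda>y. frechet_derivative f (at y) u) (at x) w \<bullet> b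
      = frechet_derivative (\<lambda>y. frechet_derivative f (at y) w) (at x) u \<bullet> b"
    by (simp add: E)
qed


section \<open>Smooth atlases and tangent vectors\<close>

text \<open>The conditions of a smooth manifold that do not concern the topology of the atlas. For the
  cotangent bundle they are established first: the calculus of tangent vectors and the description of
  the open sets are then available when its topology is studied.\<close>

definition smooth_atlas :: "('a, 'e::euclidean_space) atlas \<Rightarrow> bool" where
  "smooth_atlas M \<longleftrightarrow>
     (\<forall>c\<in>M. inj_on (snd c) (fst c)) \<and>
     (\<forall>c\<in>M. \<forall>d\<in>M. open (snd c ` (fst c \<inter> fst d))) \<and>
     (\<forall>c\<in>M. \<forall>d\<in>M. smooth_on (snd c ` (fst c \<inter> fst d)) (transition c d))"

lemma smooth_manifold_iff:
  "smooth_manifold M \<longleftrightarrow> smooth_atlas M \<and>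
     Hausdorff_space (atlas_topology M) \<and> second_countable (atlas_topology M)"
  by (auto simp: smooth_manifold_def smooth_atlas_def)

lemma chart_inv_in: "x \<in> snd c ` fst c \<Longrightarrow> chart_inv c x \<in> fst c"
  by (auto simp: chart_inv_def intro: inv_into_into)

lemma chart_chart_inv: "x \<in> snd c ` fst c \<Longrightarrow> snd c (chart_inv c x) = x"
  by (auto simp: chart_inv_def intro: f_inv_into_f)

lemma charts_at_iff: "c \<in> charts_at M a \<longleftrightarrow> c \<in> M \<and> a \<in> fst c"
  by (auto simp: charts_at_def)

context
  fixes M :: "('a, 'e::euclidean_space) atlas"
  assumes M: "smooth_atlas M"
begin

lemma chart_inj: "c \<in> M \<Longrightarrow> inj_on (snd c) (fst c)"
  using M by (auto simp: smooth_atlas_def)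

lemma open_chart_image_Int: "c \<in> M \<Longrightarrow> d \<in> M \<Longrightarrow> open (snd c ` (fst c \<inter> fst d))"
  using M by (auto simp: smooth_atlas_def)

lemma open_chart_image: "c \<in> M \<Longrightarrow> open (snd c ` fst c)"
  using open_chart_image_Int[of c c] by simp

lemma smooth_transition:
  "c \<in> M \<Longrightarrow> d \<in> M \<Longrightarrow> smooth_on (snd c ` (fst c \<inter> fst d)) (transition c d)"
  using M by (auto simp: smooth_atlas_def)

lemma chart_inv_chart: "c \<in> M \<Longrightarrow> a \<in> fst c \<Longrightarrow> chart_inv c (snd c a) = a"
  by (simp add: chart_inv_def chart_inj inv_into_f_f)

lemma transition_at: "c \<in> M \<Longrightarrow> a \<in> fst c \<Longrightarrow> transition c d (snd c a) = snd d a"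
  by (simp add: transition_def chart_inv_chart)

abbreviation (input) tr_deriv :: "('a, 'e) chart \<Rightarrow> ('a, 'e) chart \<Rightarrow> 'a \<Rightarrow> 'e \<Rightarrow> 'e" where
  "tr_deriv c d a \<equiv> frechet_derivative (transition c d) (at (snd c a))"

lemma transition_has_derivative:
  "c \<in> M \<Longrightarrow> d \<in> M \<Longrightarrow> a \<in> fst c \<Longrightarrow> a \<in> fst d \<Longrightarrow>
    (transition c d has_derivative tr_deriv c d a) (at (snd c a))"
  by (rule smooth_on_has_derivative[OF smooth_transition]) auto

lemma tr_deriv_linear:
  "c \<in> M \<Longrightarrow> d \<in> M \<Longrightarrow> a \<in> fst c \<Longrightarrow> a \<in> fst d \<Longrightarrow> linear (tr_deriv c d a)"
  using transition_has_derivative has_derivative_linear by blast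

lemma tr_deriv_chain:
  assumes c: "c \<in> M" "a \<in> fst c" and d: "d \<in> M" "a \<in> fst d" and e: "e \<in> M" "a \<in> fst e"
  shows "tr_deriv d e a (tr_deriv c d a u) = tr_deriv c e a u"
proof -
  let ?U = "snd c ` (fst c \<inter> fst d) \<inter> snd c ` (fst c \<inter> fst e)"
  have "((\<lambda>x. transition d e (transition c d x)) has_derivative
      (\<lambda>u. tr_deriv d e a (tr_deriv c d a u))) (at (snd c a))"
    using diff_chain_at[OF transition_has_derivative[OF c(1) d(1) c(2) d(2)],
        of "transition d e" "tr_deriv d e a"]
      transition_has_derivative[OF d(1) e(1) d(2) e(2)] c d
    by (simp add: transition_at o_def)
  from frechet_derivative_at[OF this]
  have "tr_deriv d e a (tr_deriv c d a u)
      = frechet_derivative (\<lambda>x. transition d e (transition c d x)) (at (snd c a)) u"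
    by metis
  also have "frechet_derivative (\<lambda>x. transition d e (transition c d x)) (at (snd c a)) = tr_deriv c e a"
  proof (rule frechet_derivative_cong[of ?U])
    show "open ?U"
      using c d e by (intro open_Int open_chart_image_Int)
    fix y assume y: "y \<in> ?U"
    then obtain b where b: "b \<in> fst c" "b \<in> fst d" "y = snd c b"
      by auto
    moreover from this y have "b \<in> fst e"
      using chart_inj[OF c(1)] by (auto dest: inj_onD)
    ultimately show "transition d e (transition c d y) = transition c e y"
      using c d e by (simp add: transition_at)
  qed (use c d e in auto)
  finally show ?thesis .
qed

lemma tr_deriv_self:
  assumes c: "c \<in> M" "a \<in> fst c"
  shows "tr_deriv c c a u = u"
proof -
  have "tr_deriv c c a = frechet_derivative (\<lambda>x. x) (at (snd c a))"
    by (rule frechet_derivative_cong[OF open_chart_image[OF c(1)]])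
      (use c in \<open>auto simp: transition_at\<close>)
  then show ?thesis
    using frechet_derivative_at[OF has_derivative_ident, of "snd c a"] by metis
qed

lemma tr_deriv_inverse:
  "c \<in> M \<Longrightarrow> a \<in> fst c \<Longrightarrow> d \<in> M \<Longrightarrow> a \<in> fst d \<Longrightarrow> tr_deriv d c a (tr_deriv c d a u) = u"
  by (simp add: tr_deriv_chain tr_deriv_self)

lemma surj_tr_deriv:
  assumes "c \<in> M" "a \<in> fst c" "d \<in> M" "a \<in> fst d"
  shows "surj (tr_deriv c d a)"
  by (rule surjI[of _ "tr_deriv d c a"]) (use assms in \<open>simp add: tr_deriv_inverse\<close>)

lemma tangent_space_change:
  assumes "X \<in> tangent_space M a" "c \<in> M" "a \<in> fst c" "d \<in> M" "a \<in> fst d"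
  shows "X d = tr_deriv c d a (X c)"
  using assms unfolding tangent_space_def charts_at_def by blast

lemma tangent_space_outside:
  "X \<in> tangent_space M a \<Longrightarrow> c \<notin> charts_at M a \<Longrightarrow> X c = 0"
  unfolding tangent_space_def by blast

lemma tangent_spaceI:
  assumes "\<And>c. c \<notin> charts_at M a \<Longrightarrow> X c = 0"
    and "\<And>c d. c \<in> M \<Longrightarrow> a \<in> fst c \<Longrightarrow> d \<in> M \<Longrightarrow> a \<in> fst d \<Longrightarrow> X d = tr_deriv c d a (X c)"
  shows "X \<in> tangent_space M a"
  using assms unfolding tangent_space_def charts_at_def by blast

lemma coord_vec_tangent:
  assumes "c \<in> M" "a \<in> fst c"
  shows "coord_vec M c a u \<in> tangent_space M a"
  by (rule tangent_spaceI) (use assms in \<open>auto simp: coord_vec_def charts_at_iff tr_deriv_chain\<close>)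

lemma coord_vec_self: "c \<in> M \<Longrightarrow> a \<in> fst c \<Longrightarrow> coord_vec M c a u c = u"
  by (simp add: coord_vec_def charts_at_iff tr_deriv_self)

lemma coord_vec_at:
  "c \<in> M \<Longrightarrow> a \<in> fst c \<Longrightarrow> d \<in> M \<Longrightarrow> a \<in> fst d \<Longrightarrow> coord_vec M c a u d = tr_deriv c d a u"
  by (simp add: coord_vec_def charts_at_iff)

lemma tangent_eq_coord_vec:
  assumes "X \<in> tangent_space M a" "c \<in> M" "a \<in> fst c"
  shows "X = coord_vec M c a (X c)"
proof
  fix d
  show "X d = coord_vec M c a (X c) d"
    using tangent_space_outside[OF assms(1), of d] tangent_space_change[OF assms, of d]
    by (simp add: coord_vec_def charts_at_iff)
qed

lemma tangent_space_eqI: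
  assumes "X \<in> tangent_space M a" "Y \<in> tangent_space M a" "c \<in> M" "a \<in> fst c" "X c = Y c"
  shows "X = Y"
  using tangent_eq_coord_vec[OF assms(1,3,4)] tangent_eq_coord_vec[OF assms(2,3,4)] assms(5)
  by metis

lemma coord_vec_change:
  assumes "c \<in> M" "a \<in> fst c" "d \<in> M" "a \<in> fst d"
  shows "coord_vec M c a u = coord_vec M d a (tr_deriv c d a u)"
  using tangent_eq_coord_vec[OF coord_vec_tangent[OF assms(1,2)] assms(3,4), of u]
  by (simp only: coord_vec_at[OF assms])

lemma tangent_space_lincomb:
  assumes X: "X \<in> tangent_space M a" and Y: "Y \<in> tangent_space M a"
  shows "(\<lambda>c. r *\<^sub>R X c + s *\<^sub>R Y c) \<in> tangent_space M a"
proof (rule tangent_spaceI)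
  fix c d assume cd: "c \<in> M" "a \<in> fst c" "d \<in> M" "a \<in> fst d"
  note L = tr_deriv_linear[OF cd(1,3,2,4)]
  show "r *\<^sub>R X d + s *\<^sub>R Y d = tr_deriv c d a (r *\<^sub>R X c + s *\<^sub>R Y c)"
    unfolding linear_add[OF L] linear_scale[OF L]
      tangent_space_change[OF X cd] tangent_space_change[OF Y cd] ..
qed (simp add: tangent_space_outside[OF X] tangent_space_outside[OF Y])

lemma tangent_space_zero: "(\<lambda>c. 0) \<in> tangent_space M a"
  by (rule tangent_spaceI) (simp_all add: linear_0[OF tr_deriv_linear])

lemma tangent_space_scale:
  "X \<in> tangent_space M a \<Longrightarrow> (\<lambda>c. r *\<^sub>R X c) \<in> tangent_space M a"
  using tangent_space_lincomb[of X a X r 0] by simp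

lemma tangent_space_add:
  "X \<in> tangent_space M a \<Longrightarrow> Y \<in> tangent_space M a \<Longrightarrow> (\<lambda>c. X c + Y c) \<in> tangent_space M a"
  using tangent_space_lincomb[of X a Y 1 1] by simp

lemma tangent_space_sum:
  "(\<And>i. i \<in> I \<Longrightarrow> X i \<in> tangent_space M a) \<Longrightarrow> (\<lambda>c. \<Sum>i\<in>I. X i c) \<in> tangent_space M a"
  by (induction I rule: infinite_finite_induct) (auto simp: tangent_space_zero tangent_space_add)

lemma coord_vec_lincomb:
  assumes "c \<in> M" "a \<in> fst c"
  shows "coord_vec M c a (r *\<^sub>R u + s *\<^sub>R w)
       = (\<lambda>e. r *\<^sub>R coord_vec M c a u e + s *\<^sub>R coord_vec M c a w e)"
proof
  fix e
  show "coord_vec M c a (r *\<^sub>R u + s *\<^sub>R w) e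
      = r *\<^sub>R coord_vec M c a u e + s *\<^sub>R coord_vec M c a w e"
    using assms tr_deriv_linear[of c e a]
    by (simp add: coord_vec_def charts_at_iff linear_add linear_scale)
qed

lemma tangent_linear_imp_linear:
  assumes "tangent_linear M a f" "c \<in> M" "a \<in> fst c"
  shows "linear (\<lambda>u. f (coord_vec M c a u))"
proof -
  have *: "f (coord_vec M c a (r *\<^sub>R u + s *\<^sub>R w))
      = r * f (coord_vec M c a u) + s * f (coord_vec M c a w)" for r s u w
    using assms coord_vec_tangent[OF assms(2,3)]
    by (simp add: tangent_linear_def coord_vec_lincomb)
  show ?thesis
    using *[of 1 _ 1] *[of _ _ 0] by (intro linearI) auto
qed


section \<open>The topology of an atlas\<close>

lemma openin_atlas_iff:
  "openin (atlas_topology M) W \<longleftrightarrow> W \<subseteq> carrier M \<and> (\<forall>c\<in>M. open (snd c ` (W \<inter> fst c)))"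
  by (rule openin_atlas_topology) (rule chart_inj)

text \<open>Charts are continuous for the atlas topology: in any other chart, the preimage of an open set is one
  under a transition map.\<close>

lemma openin_chart_preimage:
  assumes c: "c \<in> M" and W: "open W"
  shows "openin (atlas_topology M) {a \<in> fst c. snd c a \<in> W}"
  unfolding openin_atlas_iff
proof (intro conjI ballI)
  show "{a \<in> fst c. snd c a \<in> W} \<subseteq> carrier M"
    using c by (auto simp: carrier_def)
  fix d assume d: "d \<in> M"
  have "snd d ` ({a \<in> fst c. snd c a \<in> W} \<inter> fst d)
      = snd d ` (fst d \<inter> fst c) \<inter> transition d c -` W"
    using d by (auto simp: transition_at)
  then show "open (snd d ` ({a \<in> fst c. snd c a \<in> W} \<inter> fst d))"
    using continuous_open_preimage[OF smooth_on_imp_continuous_on[OF smooth_transition[OF d c]]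
        open_chart_image_Int[OF d c] W] by simp
qed

lemma openin_chart_domain: "c \<in> M \<Longrightarrow> openin (atlas_topology M) (fst c)"
  using openin_chart_preimage[of c UNIV] by simp

lemma topspace_atlas: "topspace (atlas_topology M) \<subseteq> carrier M"
  by (rule openin_atlas_iff[THEN iffD1, THEN conjunct1]) (rule openin_topspace)

text \<open>The atlas topology is always Hausdorff within a chart; only points without a common chart can fail to
  be separated.\<close>

lemma points_in_chart_separated:
  assumes c: "c \<in> M" and xy: "x \<in> fst c" "y \<in> fst c" "x \<noteq> y"
  shows "\<exists>U V. openin (atlas_topology M) U \<and> openin (atlas_topology M) V \<and>
    x \<in> U \<and> y \<in> V \<and> disjnt U V"
proof -
  have "snd c x \<noteq> snd c y"
    using inj_on_eq_iff[OF chart_inj[OF c] xy(1,2)] xy(3) by simp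
  from hausdorff[OF this]
  obtain U V where UV: "open U" "open V" "snd c x \<in> U" "snd c y \<in> V" "U \<inter> V = {}"
    by (elim exE conjE)
  show ?thesis
  proof (intro exI conjI)
    show "openin (atlas_topology M) {a \<in> fst c. snd c a \<in> U}"
      "openin (atlas_topology M) {a \<in> fst c. snd c a \<in> V}"
      using openin_chart_preimage[OF c] UV by simp_all
  qed (use UV xy in \<open>auto simp: disjnt_def\<close>)
qed

text \<open>A countable basis of the model space pulls back under each chart of a countable cover, and together
  these preimages form a basis.\<close>

lemma second_countable_atlas:
  assumes C: "countable C" "C \<subseteq> M" and cov: "carrier M \<subseteq> \<Union> (fst ` C)"
  shows "second_countable (atlas_topology M)"
proof -
  obtain B :: "'e set set" where B: "countable B" "topological_basis B"
    using ex_countable_basis by blast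
  define N where "N c W = {a \<in> fst c. snd c a \<in> W}" for c :: "('a, 'e) chart" and W
  let ?\<B> = "(\<lambda>(c, W). N c W) ` (C \<times> B)"
  have "\<exists>V\<in>?\<B>. x \<in> V \<and> V \<subseteq> U" if U: "openin (atlas_topology M) U" "x \<in> U" for U x
  proof -
    obtain c where c: "c \<in> C" "x \<in> fst c"
      using U cov by (auto simp: openin_atlas_iff)
    then have cM: "c \<in> M"
      using C by auto
    have "open (snd c ` (U \<inter> fst c))"
      using U cM by (auto simp: openin_atlas_iff)
    moreover have "snd c x \<in> snd c ` (U \<inter> fst c)"
      using U c by auto
    ultimately obtain W where W: "W \<in> B" "snd c x \<in> W" "W \<subseteq> snd c ` (U \<inter> fst c)"
      using topological_basisE[OF B(2)] by metis
    have "N c W \<subseteq> U"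
    proof
      fix a assume a: "a \<in> N c W"
      then obtain b where "b \<in> U" "b \<in> fst c" "snd c a = snd c b"
        using W(3) by (auto simp: N_def)
      then show "a \<in> U"
        using a chart_inj[OF cM] by (auto simp: N_def dest: inj_onD)
    qed
    moreover have "x \<in> N c W"
      using c W by (simp add: N_def)
    ultimately show ?thesis
      using c W by (intro bexI[of _ "N c W"]) auto
  qed
  moreover have "countable ?\<B>"
    using B C by auto
  moreover have "openin (atlas_topology M) V" if V: "V \<in> ?\<B>" for V
  proof -
    obtain c W where "c \<in> C" "W \<in> B" "V = N c W"
      using V by auto
    then show ?thesis
      using openin_chart_preimage[of c W] B(2) C by (auto simp: N_def topological_basis_open)
  qed
  ultimately show ?thesis
    unfolding second_countable_def by (intro exI[of _ ?\<B>] conjI ballI allI impI) auto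
qed

text \<open>The basic open sets that lie in some chart domain already cover the manifold. There are countably many
  of them, and one chart for each suffices.\<close>

lemma countable_chart_cover:
  assumes "second_countable (atlas_topology M)"
  obtains C where "countable C" "C \<subseteq> M" "carrier M \<subseteq> \<Union> (fst ` C)"
proof -
  obtain \<B> where B: "countable \<B>"
    and basis: "\<forall>U x. openin (atlas_topology M) U \<and> x \<in> U \<longrightarrow> (\<exists>V\<in>\<B>. x \<in> V \<and> V \<subseteq> U)"
    using assms unfolding second_countable_def by (elim exE conjE)
  define ch where "ch V = (SOME c. c \<in> M \<and> V \<subseteq> fst c)" for V
  have ch: "ch V \<in> M \<and> V \<subseteq> fst (ch V)" if "c \<in> M" "V \<subseteq> fst c" for c V
    unfolding ch_def by (rule someI[of _ c]) (use that in blast)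
  let ?C = "ch ` {V \<in> \<B>. \<exists>c\<in>M. V \<subseteq> fst c}"
  show thesis
  proof (rule that)
    show "countable ?C"
      using B by auto
    show "?C \<subseteq> M"
      using ch by auto
    show "carrier M \<subseteq> \<Union> (fst ` ?C)"
    proof
      fix a assume "a \<in> carrier M"
      then obtain c where c: "c \<in> M" "a \<in> fst c"
        by (auto simp: carrier_def)
      then obtain V where "V \<in> \<B>" "a \<in> V" "V \<subseteq> fst c"
        using basis openin_chart_domain by blast
      then show "a \<in> \<Union> (fst ` ?C)"
        using ch[OF c(1)] c by blast
    qed
  qed
qed

end


section \<open>The nonzero cotangent bundle as a manifold\<close>

definition momentum ::
  "('a, real ^ 'n) atlas \<Rightarrow> ('a, real ^ 'n) chart \<Rightarrow> ('a, 'n) cpoint \<Rightarrow> real ^ 'n" where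
  "momentum M c z = (\<chi> i. p_coord M c z i)"

text \<open>The covector at \<open>a\<close> with momenta \<open>p\<close> in the chart \<open>c\<close>; outside the tangent
  space it takes the value \<open>0\<close> required of elements of \<open>cotangent_space\<close>.\<close>

definition covector_of ::
  "('a, real ^ 'n) atlas \<Rightarrow> ('a, real ^ 'n) chart \<Rightarrow> 'a \<Rightarrow> real ^ 'n \<Rightarrow> ('a, real ^ 'n) covec" where
  "covector_of M c a p = (\<lambda>X. if X \<in> tangent_space M a then p \<bullet> X c else 0)"

lemma linear_eq_inner:
  fixes f :: "real ^ 'n \<Rightarrow> real"
  assumes "linear f"
  shows "f u = (\<chi> i. f (axis i 1)) \<bullet> u"
proof -
  have "f u = f (\<Sum>i\<in>UNIV. u $ i *\<^sub>R axis i 1)"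
    using basis_expansion[of u] by (simp add: scalar_mult_eq_scaleR)
  then show ?thesis
    by (simp add: linear_sum[OF assms] linear_scale[OF assms] inner_vec_def mult.commute)
qed

lemma nonzero_cotangent_bundle_eq: "nonzero_cotangent_bundle M = induced_chart M ` M"
  by (auto simp: nonzero_cotangent_bundle_def open_submanifold_def cotangent_bundle_def
      induced_chart_def image_image)

lemma induced_chart_domain:
  "fst (induced_chart M c) = {z \<in> nonzero_cotangent_set M. fst z \<in> fst c}"
  by (auto simp: induced_chart_def cotangent_chart_def nonzero_cotangent_set_def)

lemma induced_chart_map: "snd (induced_chart M c) z = (snd c (fst z), momentum M c z)"
  by (simp add: induced_chart_def cotangent_chart_def momentum_def)

lemma nonzero_cotangentD: "z \<in> nonzero_cotangent_set M \<Longrightarrow> z \<in> cotangent_set M"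
  by (simp add: nonzero_cotangent_set_def)

lemma nonzero_cotangent_chart:
  assumes "z \<in> nonzero_cotangent_set M"
  obtains c where "c \<in> M" "fst z \<in> fst c"
  using assms by (auto simp: nonzero_cotangent_set_def cotangent_set_def carrier_def)

lemma induced_chart_in_bundle: "c \<in> M \<Longrightarrow> induced_chart M c \<in> nonzero_cotangent_bundle M"
  by (simp add: nonzero_cotangent_bundle_eq)

lemma carrier_nonzero_cotangent_bundle:
  "carrier (nonzero_cotangent_bundle M) = nonzero_cotangent_set M"
  by (auto simp: carrier_def nonzero_cotangent_bundle_eq induced_chart_domain
      nonzero_cotangent_set_def cotangent_set_def)

context
  fixes M :: "('a, real ^ 'n) atlas"
  assumes M: "smooth_atlas M"
begin

lemma covector_eq_momentum:
  assumes "z \<in> cotangent_set M" "c \<in> M" "fst z \<in> fst c"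
  shows "snd z (coord_vec M c (fst z) u) = momentum M c z \<bullet> u"
proof -
  have "tangent_linear M (fst z) (snd z)"
    using assms(1) by (auto simp: cotangent_set_def cotangent_space_def)
  then show ?thesis
    unfolding momentum_def p_coord_def
    by (intro linear_eq_inner[OF tangent_linear_imp_linear[OF M _ assms(2,3)]])
qed

lemma covector_of_momentum:
  assumes "z \<in> cotangent_set M" "c \<in> M" "fst z \<in> fst c"
  shows "covector_of M c (fst z) (momentum M c z) = snd z"
proof
  fix X
  show "covector_of M c (fst z) (momentum M c z) X = snd z X"
  proof (cases "X \<in> tangent_space M (fst z)")
    case True
    then have "covector_of M c (fst z) (momentum M c z) X = snd z (coord_vec M c (fst z) (X c))"
      by (simp add: covector_of_def covector_eq_momentum[OF assms])
    then show ?thesis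
      unfolding tangent_eq_coord_vec[OF M True assms(2,3), symmetric] .
  next
    case False
    then show ?thesis
      using assms(1) by (auto simp: covector_of_def cotangent_set_def cotangent_space_def)
  qed
qed

lemma covector_of_cotangent:
  assumes "c \<in> M" "a \<in> fst c"
  shows "covector_of M c a p \<in> cotangent_space M a"
  unfolding cotangent_space_def tangent_linear_def covector_of_def
  using tangent_space_lincomb[OF M] by (auto simp: inner_add_right)

lemma momentum_covector_of:
  assumes "c \<in> M" "a \<in> fst c"
  shows "momentum M c (a, covector_of M c a p) = p"
proof -
  have "momentum M c (a, covector_of M c a p) $ i = p $ i" for i
    by (simp add: momentum_def p_coord_def covector_of_def coord_vec_tangent[OF M assms]
        coord_vec_self[OF M assms] inner_axis)
  then show ?thesis
    by (simp add: vec_eq_iff)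
qed

lemma momentum_nonzero:
  assumes "z \<in> nonzero_cotangent_set M" "c \<in> M" "fst z \<in> fst c"
  shows "momentum M c z \<noteq> 0"
proof
  assume "momentum M c z = 0"
  then have "snd z = covector_of M c (fst z) 0"
    using covector_of_momentum[OF nonzero_cotangentD[OF assms(1)] assms(2,3)] by simp
  then show False
    using assms(1) by (auto simp: nonzero_cotangent_set_def covector_of_def)
qed

lemma covector_of_nonzero:
  assumes "c \<in> M" "a \<in> fst c" "p \<noteq> 0"
  shows "(a, covector_of M c a p) \<in> nonzero_cotangent_set M"
proof -
  have "covector_of M c a p \<noteq> (\<lambda>_. 0)"
  proof
    assume "covector_of M c a p = (\<lambda>_. 0)"
    then have "momentum M c (a, covector_of M c a p) = 0"
      by (simp add: momentum_def p_coord_def vec_eq_iff)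
    then show False
      using momentum_covector_of[OF assms(1,2)] assms(3) by simp
  qed
  then show ?thesis
    using covector_of_cotangent[OF assms(1,2)] assms
    by (auto simp: nonzero_cotangent_set_def cotangent_set_def carrier_def)
qed

text \<open>The momenta form the coordinate row vector of a covector, so they pull back along the derivative of
  the transition map. The later changes of chart use the law in this invariant form, which needs no inverse
  Jacobian matrix.\<close>

lemma momentum_change:
  assumes "z \<in> cotangent_set M" "c \<in> M" "fst z \<in> fst c" "d \<in> M" "fst z \<in> fst d"
  shows "momentum M d z \<bullet> tr_deriv c d (fst z) u = momentum M c z \<bullet> u"
  using covector_eq_momentum[OF assms(1,2,3), of u] coord_vec_change[OF M assms(2-5), of u]
    covector_eq_momentum[OF assms(1,4,5)] by simp

lemma inj_on_induced_chart:
  assumes c: "c \<in> M"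
  shows "inj_on (snd (induced_chart M c)) (fst (induced_chart M c))"
proof (rule inj_onI)
  fix z y
  assume z: "z \<in> fst (induced_chart M c)" and y: "y \<in> fst (induced_chart M c)"
    and eq: "snd (induced_chart M c) z = snd (induced_chart M c) y"
  have fst: "fst z = fst y"
    using inj_onD[OF chart_inj[OF M c]] z y eq by (simp add: induced_chart_domain induced_chart_map)
  have "snd z = snd y"
    using covector_of_momentum[OF _ c, of z] covector_of_momentum[OF _ c, of y] fst eq z y
    by (simp add: induced_chart_domain induced_chart_map nonzero_cotangentD)
  with fst show "z = y"
    by (simp add: prod_eq_iff)
qed

text \<open>Every nonzero row vector occurs as a momentum: the image of an induced chart is a product, which makes
  its openness evident.\<close>

lemma induced_chart_image:
  assumes c: "c \<in> M" and U: "U \<subseteq> fst c"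
  shows "snd (induced_chart M c) ` {z \<in> nonzero_cotangent_set M. fst z \<in> U}
       = (snd c ` U) \<times> (- {0})" (is "?L = ?R")
proof
  show "?L \<subseteq> ?R"
    using momentum_nonzero[OF _ c] U by (auto simp: induced_chart_map)
  show "?R \<subseteq> ?L"
  proof
    fix y assume "y \<in> ?R"
    then obtain a p where a: "a \<in> U" "p \<noteq> 0" "y = (snd c a, p)"
      by auto
    with U have "a \<in> fst c"
      by auto
    then have "y = snd (induced_chart M c) (a, covector_of M c a p)"
      and "(a, covector_of M c a p) \<in> nonzero_cotangent_set M"
      using a c by (auto simp: induced_chart_map momentum_covector_of covector_of_nonzero)
    with a show "y \<in> ?L"
      by (intro image_eqI[of _ _ "(a, covector_of M c a p)"]) auto
  qed
qed

lemma induced_chart_image_Int: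
  assumes "c \<in> M" "d \<in> M"
  shows "snd (induced_chart M c) ` (fst (induced_chart M c) \<inter> fst (induced_chart M d))
       = (snd c ` (fst c \<inter> fst d)) \<times> (- {0})"
proof -
  have "fst (induced_chart M c) \<inter> fst (induced_chart M d)
      = {z \<in> nonzero_cotangent_set M. fst z \<in> fst c \<inter> fst d}"
    by (auto simp: induced_chart_domain)
  then show ?thesis
    using induced_chart_image[OF assms(1), of "fst c \<inter> fst d"] by simp
qed

lemma transition_induced_chart:
  assumes c: "c \<in> M" "fst z \<in> fst c" and d: "d \<in> M" "fst z \<in> fst d"
    and z: "z \<in> nonzero_cotangent_set M"
  shows "transition (induced_chart M c) (induced_chart M d) (snd c (fst z), momentum M c z)
       = (snd d (fst z), momentum M d z)"
proof -
  have "z \<in> fst (induced_chart M c)"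
    using c z by (simp add: induced_chart_domain)
  then have "chart_inv (induced_chart M c) (snd (induced_chart M c) z) = z"
    using inj_on_induced_chart[OF c(1)] by (simp add: chart_inv_def)
  then show ?thesis
    by (simp add: transition_def induced_chart_map)
qed

lemma smooth_transition_induced_chart:
  assumes c: "c \<in> M" and d: "d \<in> M"
  shows "smooth_on ((snd c ` (fst c \<inter> fst d)) \<times> (- {0}))
    (transition (induced_chart M c) (induced_chart M d))"
proof -
  let ?U = "snd c ` (fst c \<inter> fst d)" and ?V = "snd d ` (fst d \<inter> fst c)"
  let ?S = "?U \<times> (- {0 :: real ^ 'n})"
  have S: "open ?S"
    using open_chart_image_Int[OF M c d] by (intro open_Times) auto
  \<comment> \<open>The momenta are transported by the inverse of the derivative of the transition map, which is the
    derivative of the reverse transition; this makes the smooth dependence visible.\<close>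
  have eq: "transition (induced_chart M c) (induced_chart M d) y
      = (transition c d (fst y), \<chi> i. snd y \<bullet>
          frechet_derivative (transition d c) (at (transition c d (fst y))) (axis i 1))"
    if y: "y \<in> ?S" for y
  proof -
    have "y \<in> snd (induced_chart M c) ` {z \<in> nonzero_cotangent_set M. fst z \<in> fst c \<inter> fst d}"
      unfolding induced_chart_image[OF c Int_lower1] by (rule y)
    then obtain z where z: "z \<in> nonzero_cotangent_set M" "fst z \<in> fst c" "fst z \<in> fst d"
      and y_eq: "y = snd (induced_chart M c) z"
      by (elim imageE CollectE conjE IntE)
    have "momentum M d z $ i = momentum M c z \<bullet> tr_deriv d c (fst z) (axis i 1)" for i
      using momentum_change[OF nonzero_cotangentD[OF z(1)] d z(3) c z(2), of "axis i 1"]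
      by (simp add: inner_axis)
    then show ?thesis
      using transition_induced_chart[OF c z(2) d z(3) z(1)] z c d
      by (simp add: y_eq induced_chart_map transition_at[OF M] vec_eq_iff)
  qed
  have fst: "smooth_on ?S (\<lambda>y. transition c d (fst y))"
    by (rule smooth_on_compose[OF S smooth_transition[OF M c d]])
      (auto intro!: smooth_on_fst S smooth_on_ident)
  have deriv: "smooth_on ?S
      (\<lambda>y. frechet_derivative (transition d c) (at (transition c d (fst y))) u)" for u
    by (rule smooth_on_compose[OF S smooth_on_frechet_derivative[OF smooth_transition[OF M d c]] fst])
      (auto simp: transition_at[OF M c])
  have "smooth_on ?S (\<lambda>y. (transition c d (fst y), \<chi> i. snd y \<bullet>
      frechet_derivative (transition d c) (at (transition c d (fst y))) (axis i 1)))"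
    by (intro smooth_on_Pair S fst smooth_on_vec smooth_on_bilinear[OF bounded_bilinear_inner]
        deriv smooth_on_snd smooth_on_ident)
  then show ?thesis
    by (rule iffD2[OF smooth_on_cong[OF S], rotated]) (erule eq)
qed

lemma smooth_atlas_nonzero_cotangent_bundle: "smooth_atlas (nonzero_cotangent_bundle M)"
proof -
  have "open ((snd c ` (fst c \<inter> fst d)) \<times> (- {0 :: real ^ 'n}))" if "c \<in> M" "d \<in> M" for c d
    using open_chart_image_Int[OF M that] by (intro open_Times) auto
  then show ?thesis
    by (auto simp: smooth_atlas_def nonzero_cotangent_bundle_eq inj_on_induced_chart
        induced_chart_image_Int smooth_transition_induced_chart)
qed

lemma openin_nonzero_cotangent_preimage:
  assumes U: "openin (atlas_topology M) U"
  shows "openin (atlas_topology (nonzero_cotangent_bundle M)) {z \<in> nonzero_cotangent_set M. fst z \<in> U}"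
  unfolding openin_atlas_iff[OF smooth_atlas_nonzero_cotangent_bundle]
proof (intro conjI ballI)
  show "{z \<in> nonzero_cotangent_set M. fst z \<in> U} \<subseteq> carrier (nonzero_cotangent_bundle M)"
    by (auto simp: carrier_nonzero_cotangent_bundle)
  fix e assume "e \<in> nonzero_cotangent_bundle M"
  then obtain c where c: "e = induced_chart M c" "c \<in> M"
    unfolding nonzero_cotangent_bundle_eq by (rule imageE)
  have "{z \<in> nonzero_cotangent_set M. fst z \<in> U} \<inter> fst e
      = {z \<in> nonzero_cotangent_set M. fst z \<in> U \<inter> fst c}"
    by (auto simp: c induced_chart_domain)
  moreover have "open ((snd c ` (U \<inter> fst c)) \<times> (- {0 :: real ^ 'n}))"
    using U c by (intro open_Times) (auto simp: openin_atlas_iff[OF M])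
  ultimately show "open (snd e ` ({z \<in> nonzero_cotangent_set M. fst z \<in> U} \<inter> fst e))"
    using induced_chart_image[OF c(2), of "U \<inter> fst c"] c(1) by simp
qed

end

text \<open>Covectors at different points are separated by preimages of open sets of the base, covectors at
  the same point by an induced chart.\<close>

lemma Hausdorff_nonzero_cotangent_bundle:
  fixes M :: "('a, real ^ 'n) atlas"
  assumes M: "smooth_atlas M" and H: "Hausdorff_space (atlas_topology M)"
  shows "Hausdorff_space (atlas_topology (nonzero_cotangent_bundle M))" (is "Hausdorff_space ?X")
  unfolding Hausdorff_space_def
proof (intro allI impI)
  note N = smooth_atlas_nonzero_cotangent_bundle[OF M]
  fix y z assume yz: "y \<in> topspace ?X \<and> z \<in> topspace ?X \<and> y \<noteq> z"
  then have y: "y \<in> nonzero_cotangent_set M" and z: "z \<in> nonzero_cotangent_set M"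
    using topspace_atlas[OF N] by (auto simp: carrier_nonzero_cotangent_bundle)
  obtain c where c: "c \<in> M" "fst y \<in> fst c"
    using nonzero_cotangent_chart[OF y] .
  obtain d where d: "d \<in> M" "fst z \<in> fst d"
    using nonzero_cotangent_chart[OF z] .
  show "\<exists>U V. openin ?X U \<and> openin ?X V \<and> y \<in> U \<and> z \<in> V \<and> disjnt U V"
  proof (cases "fst y = fst z")
    case True
    then show ?thesis
      using points_in_chart_separated[OF N induced_chart_in_bundle[OF c(1)], of y z] yz y z c
      by (simp add: induced_chart_domain)
  next
    case False
    have "fst y \<in> topspace (atlas_topology M)" "fst z \<in> topspace (atlas_topology M)"
      using c d openin_subset[OF openin_chart_domain[OF M c(1)]]
        openin_subset[OF openin_chart_domain[OF M d(1)]] by auto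
    with False obtain U V where U: "openin (atlas_topology M) U" "fst y \<in> U"
      and V: "openin (atlas_topology M) V" "fst z \<in> V" and UV: "disjnt U V"
      using H[unfolded Hausdorff_space_def, rule_format, of "fst y" "fst z"] by auto
    show ?thesis
    proof (intro exI conjI)
      show "openin ?X {w \<in> nonzero_cotangent_set M. fst w \<in> U}"
        by (rule openin_nonzero_cotangent_preimage[OF M U(1)])
      show "openin ?X {w \<in> nonzero_cotangent_set M. fst w \<in> V}"
        by (rule openin_nonzero_cotangent_preimage[OF M V(1)])
      show "disjnt {w \<in> nonzero_cotangent_set M. fst w \<in> U} {w \<in> nonzero_cotangent_set M. fst w \<in> V}"
        using UV by (auto simp: disjnt_iff)
    qed (simp_all add: U V y z)
  qed
qed

lemma smooth_manifold_nonzero_cotangent_bundle: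
  fixes M :: "('a, real ^ 'n) atlas"
  assumes "smooth_manifold M"
  shows "smooth_manifold (nonzero_cotangent_bundle M)"
proof -
  have M: "smooth_atlas M" and H: "Hausdorff_space (atlas_topology M)"
    and sc: "second_countable (atlas_topology M)"
    using assms by (auto simp: smooth_manifold_iff)
  obtain C where C: "countable C" "C \<subseteq> M" and cov: "carrier M \<subseteq> \<Union> (fst ` C)"
    by (rule countable_chart_cover[OF M sc])
  have "second_countable (atlas_topology (nonzero_cotangent_bundle M))"
  proof (rule second_countable_atlas[OF smooth_atlas_nonzero_cotangent_bundle[OF M]])
    show "countable (induced_chart M ` C)"
      using C by simp
    show "induced_chart M ` C \<subseteq> nonzero_cotangent_bundle M"
      using C by (auto simp: nonzero_cotangent_bundle_eq)
    show "carrier (nonzero_cotangent_bundle M) \<subseteq> \<Union> (fst ` induced_chart M ` C)"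
    proof
      fix z assume "z \<in> carrier (nonzero_cotangent_bundle M)"
      then have z: "z \<in> nonzero_cotangent_set M"
        by (simp add: carrier_nonzero_cotangent_bundle)
      then have "fst z \<in> carrier M"
        by (auto simp: nonzero_cotangent_set_def cotangent_set_def)
      then obtain c where "c \<in> C" "fst z \<in> fst c"
        using cov by auto
      with z show "z \<in> \<Union> (fst ` induced_chart M ` C)"
        unfolding image_image by (intro UN_I[of c]) (simp_all add: induced_chart_domain)
    qed
  qed
  then show ?thesis
    using Hausdorff_nonzero_cotangent_bundle[OF M H] smooth_atlas_nonzero_cotangent_bundle[OF M]
    by (simp add: smooth_manifold_iff)
qed


section \<open>Symmetric positive definite matrices\<close>

definition pos_def :: "real ^ 'n ^ 'n \<Rightarrow> bool" where
  "pos_def B \<longleftrightarrow> (\<forall>u w. u \<bullet> (B *v w) = w \<bullet> (B *v u)) \<and> (\<forall>u. u \<noteq> 0 \<longrightarrow> 0 < u \<bullet> (B *v u))"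

text \<open>The matrix of the rank one form $p \otimes p$.\<close>

definition outer :: "real ^ 'n \<Rightarrow> real ^ 'n ^ 'n" where
  "outer p = (\<chi> i j. p $ i * p $ j)"

lemma inner_matrix_vector: "u \<bullet> (B *v w) = (\<Sum>i\<in>UNIV. \<Sum>j\<in>UNIV. B $ i $ j * u $ i * w $ j)"
  for u :: "real ^ 'n"
  by (simp add: inner_vec_def matrix_vector_mult_def sum_distrib_left mult_ac)

lemma outer_vector: "outer p *v u = (p \<bullet> u) *\<^sub>R p"
  by (simp add: outer_def vec_eq_iff matrix_vector_mult_def inner_vec_def sum_distrib_left mult_ac)

lemma matrix_add_vector: "(B + C) *v u = B *v u + C *v u" for u :: "real ^ 'n"
  by (simp add: matrix_vector_mult_add_rdistrib)

lemma matrix_scaleR_vector: "(r *\<^sub>R B) *v u = r *\<^sub>R (B *v u)" for u :: "real ^ 'n"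
  by (simp add: scaleR_matrix_vector_assoc)

lemma inner_right_eqI: "(\<And>w. x \<bullet> w = y \<bullet> w) \<Longrightarrow> x = y" for x y :: "'e::euclidean_space"
  by (metis inner_commute vector_eq_rdot)

text \<open>Used to turn componentwise definitions (of \<open>g_low\<close>, of the Christoffel symbols) into identities
  between forms, for which a change of chart is a substitution of vectors.\<close>

lemma bilinear_eq_matrix:
  fixes f :: "real ^ 'n \<Rightarrow> real ^ 'n \<Rightarrow> real"
  assumes "bilinear f"
  shows "f u w = u \<bullet> ((\<chi> i j. f (axis i 1) (axis j 1)) *v w)"
proof -
  have l: "linear (\<lambda>u. f u w)" and r: "linear (f u)" for u w
    using assms by (auto simp: bilinear_def)
  have "f u w = (\<chi> i. f (axis i 1) w) \<bullet> u"
    by (rule linear_eq_inner[OF l])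
  also have "(\<chi> i. f (axis i 1) w) = (\<chi> i j. f (axis i 1) (axis j 1)) *v w"
  proof (subst vec_eq_iff, rule allI)
    fix i
    have "f (axis i 1) w = (\<chi> j. f (axis i 1) (axis j 1)) \<bullet> w"
      by (rule linear_eq_inner[OF r])
    then show "(\<chi> i. f (axis i 1) w) $ i = ((\<chi> i j. f (axis i 1) (axis j 1)) *v w) $ i"
      by (simp add: matrix_vector_mult_def inner_vec_def)
  qed
  finally show ?thesis
    by (simp add: inner_commute)
qed

lemma bounded_bilinear_matrix_vector:
  "bounded_bilinear (\<lambda>(B :: real ^ 'n ^ 'n) u. B *v u)"
  unfolding bilinear_conv_bounded_bilinear[symmetric] bilinear_def
  by (auto intro!: linearI simp: matrix_vector_right_distrib matrix_vector_mult_scaleR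
      matrix_add_vector matrix_scaleR_vector)

lemma matrix_inv_invertible:
  assumes "invertible B"
  shows "B ** matrix_inv B = mat 1" "matrix_inv B ** B = mat 1"
proof -
  have "B ** matrix_inv B = mat 1 \<and> matrix_inv B ** B = mat 1"
    unfolding matrix_inv_def by (rule someI_ex) (use assms in \<open>simp add: invertible_def\<close>)
  then show "B ** matrix_inv B = mat 1" "matrix_inv B ** B = mat 1"
    by auto
qed

lemma matrix_inv_vector:
  fixes B :: "real ^ 'n ^ 'n"
  assumes "invertible B"
  shows "B *v (matrix_inv B *v u) = u" "matrix_inv B *v (B *v u) = u"
  by (simp_all add: matrix_vector_mul_assoc matrix_inv_invertible[OF assms])

lemma matrix_inv_eqI:
  fixes B :: "real ^ 'n ^ 'n"
  assumes "invertible B" "\<And>u. B *v (C *v u) = u"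
  shows "matrix_inv B = C"
proof -
  have "matrix_inv B *v u = C *v u" for u
    using matrix_inv_vector(2)[OF assms(1), of "C *v u"] assms(2)[of u] by simp
  then show ?thesis
    by (simp add: matrix_eq)
qed

lemma pos_def_sym: "pos_def B \<Longrightarrow> u \<bullet> (B *v w) = w \<bullet> (B *v u)"
  unfolding pos_def_def by blast

lemma pos_def_pos: "pos_def B \<Longrightarrow> u \<noteq> 0 \<Longrightarrow> 0 < u \<bullet> (B *v u)"
  unfolding pos_def_def by blast

lemma pos_def_invertible:
  assumes "pos_def B"
  shows "invertible B"
proof -
  have "\<forall>x. B *v x = 0 \<longrightarrow> x = 0"
    using pos_def_pos[OF assms] by force
  then show ?thesis
    by (simp add: invertible_left_inverse matrix_left_invertible_ker)
qed

lemma pos_def_matrix_inv: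
  fixes B :: "real ^ 'n ^ 'n"
  assumes "pos_def B"
  shows "pos_def (matrix_inv B)"
proof -
  note inv = matrix_inv_vector[OF pos_def_invertible[OF assms]]
  have "u \<bullet> (matrix_inv B *v w) = (matrix_inv B *v w) \<bullet> (B *v (matrix_inv B *v u))" for u w
    by (simp only: inv inner_commute)
  then have "u \<bullet> (matrix_inv B *v w) = w \<bullet> (matrix_inv B *v u)" for u w
    using pos_def_sym[OF assms, of "matrix_inv B *v w" "matrix_inv B *v u"]
    by (metis inner_commute inv(1))
  moreover have "0 < u \<bullet> (matrix_inv B *v u)" if "u \<noteq> 0" for u
  proof -
    have "matrix_inv B *v u \<noteq> 0"
      using inv(1)[of u] that by force
    from pos_def_pos[OF assms this] show ?thesis
      by (simp only: inv inner_commute)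
  qed
  ultimately show ?thesis
    unfolding pos_def_def by blast
qed

text \<open>The Cauchy--Schwarz inequality for the form of \<open>B\<close>, with one of the vectors given by its
  covector \<open>p\<close>. It is the positivity of the form on the component of \<open>u\<close> orthogonal to
  \<open>x\<close>.\<close>

lemma pos_def_Cauchy_Schwarz:
  assumes B: "pos_def B" and x: "B *v x = p"
  shows "(p \<bullet> u)\<^sup>2 \<le> (p \<bullet> x) * (u \<bullet> (B *v u))"
proof (cases "x = 0")
  case True
  then show ?thesis
    using x by auto
next
  case False
  define s where "s = p \<bullet> x"
  have s: "s > 0"
    using pos_def_pos[OF B False] by (simp add: x s_def inner_commute)
  define r where "r = (p \<bullet> u) / s"
  have nonneg: "0 \<le> w \<bullet> (B *v w)" for w
    using pos_def_pos[OF B, of w] by (cases "w = 0") auto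
  have "x \<bullet> (B *v u) = p \<bullet> u"
    using pos_def_sym[OF B, of x u] by (simp add: x inner_commute)
  then have "(u - r *\<^sub>R x) \<bullet> (B *v (u - r *\<^sub>R x)) = u \<bullet> (B *v u) - 2 * r * (p \<bullet> u) + r * r * s"
    by (simp add: matrix_vector_mult_diff_distrib matrix_vector_mult_scaleR x inner_diff_left
        inner_diff_right s_def inner_commute algebra_simps)
  also have "\<dots> = u \<bullet> (B *v u) - (p \<bullet> u)\<^sup>2 / s"
    using s by (simp add: r_def power2_eq_square field_simps)
  finally have "(p \<bullet> u)\<^sup>2 / s \<le> u \<bullet> (B *v u)"
    using nonneg[of "u - r *\<^sub>R x"] by simp
  then show ?thesis
    using s by (simp add: s_def field_simps)
qed

text \<open>For \<open>b \<ge> 0\<close> both terms are nonnegative. A negative rank one term is at worst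
  \<open>b * (p \<bullet> x)\<close> times the form of \<open>B\<close>, by the Cauchy--Schwarz inequality, and the
  hypothesis says that this is outweighed by \<open>a\<close> times that form.\<close>

lemma pos_def_rank_one_update:
  fixes B :: "real ^ 'n ^ 'n"
  assumes B: "pos_def B" and x: "B *v x = p" and a: "a > 0" and ab: "a + b * (p \<bullet> x) > 0"
  shows "pos_def (a *\<^sub>R B + b *\<^sub>R outer p)"
  unfolding pos_def_def
proof (intro conjI allI impI)
  fix u w
  show "u \<bullet> ((a *\<^sub>R B + b *\<^sub>R outer p) *v w) = w \<bullet> ((a *\<^sub>R B + b *\<^sub>R outer p) *v u)"
    using pos_def_sym[OF B, of u w]
    by (simp add: matrix_add_vector matrix_scaleR_vector outer_vector inner_add_right inner_commute)
next
  fix u :: "real ^ 'n" assume u: "u \<noteq> 0"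
  let ?q = "u \<bullet> (B *v u)"
  have q: "?q > 0"
    by (rule pos_def_pos[OF B u])
  have "0 < a * ?q + b * (p \<bullet> u)\<^sup>2"
  proof (cases "b \<ge> 0")
    case True
    then show ?thesis
      using a q by (simp add: add_pos_nonneg)
  next
    case False
    have "0 < (a + b * (p \<bullet> x)) * ?q"
      using ab q by simp
    also have "\<dots> = a * ?q + b * ((p \<bullet> x) * ?q)"
      by (simp add: algebra_simps)
    also have "\<dots> \<le> a * ?q + b * (p \<bullet> u)\<^sup>2"
      using False pos_def_Cauchy_Schwarz[OF B x, of u] by (intro add_left_mono mult_left_mono_neg) auto
    finally show ?thesis .
  qed
  then show "0 < u \<bullet> ((a *\<^sub>R B + b *\<^sub>R outer p) *v u)"
    by (simp add: matrix_add_vector matrix_scaleR_vector outer_vector inner_add_right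
        inner_commute power2_eq_square)
qed

text \<open>This is the Sherman--Morrison formula.\<close>

lemma matrix_inv_rank_one_update:
  fixes B :: "real ^ 'n ^ 'n"
  assumes B: "pos_def B" and x: "B *v x = p" and a: "a > 0" and ab: "a + b * (p \<bullet> x) > 0"
  shows "matrix_inv (a *\<^sub>R B + b *\<^sub>R outer p)
       = (1 / a) *\<^sub>R matrix_inv B + (- b / (a * (a + b * (p \<bullet> x)))) *\<^sub>R outer x"
proof (rule matrix_inv_eqI)
  show "invertible (a *\<^sub>R B + b *\<^sub>R outer p)"
    using pos_def_invertible[OF pos_def_rank_one_update[OF assms]] .
  fix u
  note inv = matrix_inv_vector[OF pos_def_invertible[OF B]]
  have xu: "p \<bullet> (matrix_inv B *v u) = x \<bullet> u"
    using pos_def_sym[OF B, of x "matrix_inv B *v u"] by (simp only: inv x inner_commute)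
  define k where "k = - b / (a * (a + b * (p \<bullet> x)))"
  have k: "a * k + b * (1 / a + k * (p \<bullet> x)) = 0"
    using a ab unfolding k_def by (simp add: divide_simps)
  have "(a *\<^sub>R B + b *\<^sub>R outer p) *v (((1 / a) *\<^sub>R matrix_inv B + k *\<^sub>R outer x) *v u)
      = u + ((a * k + b * (1 / a + k * (p \<bullet> x))) * (x \<bullet> u)) *\<^sub>R p"
    using a by (simp add: matrix_add_vector matrix_scaleR_vector outer_vector inv x xu
        matrix_vector_right_distrib matrix_vector_mult_scaleR inner_add_right algebra_simps)
  then have "(a *\<^sub>R B + b *\<^sub>R outer p) *v (((1 / a) *\<^sub>R matrix_inv B + k *\<^sub>R outer x) *v u) = u"
    by (simp only: k mult_zero_left scaleR_zero_left add_0_right)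
  then show "(a *\<^sub>R B + b *\<^sub>R outer p) *v
      (((1 / a) *\<^sub>R matrix_inv B + (- b / (a * (a + b * (p \<bullet> x)))) *\<^sub>R outer x) *v u) = u"
    unfolding k_def .
qed

lemma smooth_on_det:
  fixes B :: "'e::euclidean_space \<Rightarrow> real ^ 'n ^ 'n"
  assumes S: "open S" and B: "\<And>i j. smooth_on S (\<lambda>x. B x $ i $ j)"
  shows "smooth_on S (\<lambda>x. det (B x))"
  unfolding det_def by (intro smooth_on_sum smooth_on_mult smooth_on_prod smooth_on_const S B)

text \<open>By Cramer's rule, the entries of the inverse are quotients of polynomials in the entries of the
  matrix.\<close>

lemma smooth_on_matrix_inv:
  fixes B :: "'e::euclidean_space \<Rightarrow> real ^ 'n ^ 'n"
  assumes S: "open S" and B: "smooth_on S B" and inv: "\<And>x. x \<in> S \<Longrightarrow> invertible (B x)"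
  shows "smooth_on S (\<lambda>x. matrix_inv (B x))"
proof -
  define N :: "'e \<Rightarrow> 'n \<Rightarrow> 'n \<Rightarrow> real"
    where "N x k l = det (\<chi> i j. if j = k then axis l 1 $ i else B x $ i $ j)" for x k l
  have entry: "smooth_on S (\<lambda>x. B x $ i $ j)" for i j
    by (intro smooth_on_nth S B)
  have "smooth_on S (\<lambda>x. (\<chi> i j. if j = k then axis l 1 $ i else B x $ i $ j) $ i $ j)"
    for i j k l :: 'n
    by (cases "j = k") (simp_all add: smooth_on_const entry)
  then have N: "smooth_on S (\<lambda>x. N x k l)" for k l
    unfolding N_def by (intro smooth_on_det S)
  have "smooth_on S (\<lambda>x. inverse (det (B x)))"
    using inv by (intro smooth_on_inverse smooth_on_det S entry) (simp add: invertible_det_nz)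
  then have smooth: "smooth_on S (\<lambda>x. \<chi> k l. N x k l * inverse (det (B x)))"
    by (intro smooth_on_vec smooth_on_mult S N)
  have eq: "matrix_inv (B x) = (\<chi> k l. N x k l * inverse (det (B x)))" if x: "x \<in> S" for x
  proof -
    have "matrix_inv (B x) $ k $ l = N x k l * inverse (det (B x))" for k l
    proof -
      have "B x *v (matrix_inv (B x) *v axis l 1) = axis l 1"
        by (rule matrix_inv_vector[OF inv[OF x]])
      then have "matrix_inv (B x) *v axis l 1 = (\<chi> k. N x k l / det (B x))"
        using cramer[of "B x"] inv[OF x] by (simp add: N_def invertible_det_nz)
      then have "(matrix_inv (B x) *v axis l 1) $ k = N x k l / det (B x)"
        by simp
      then show ?thesis
        by (simp add: matrix_vector_mult_basis column_def divide_inverse)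
    qed
    then show ?thesis
      by (simp add: vec_eq_iff)
  qed
  show ?thesis
    by (rule iffD2[OF smooth_on_cong[OF S], rotated, OF smooth]) (erule eq)
qed

text \<open>Raising an index commutes with a change of basis: as \<open>L\<close> is onto, the equation that
  characterises the vector on the left may be tested against the vectors \<open>L w\<close>.\<close>

lemma matrix_inv_change_basis:
  fixes B B' :: "real ^ 'n ^ 'n"
  assumes inv: "invertible B" "invertible B'" and L: "surj L"
    and B: "\<And>u w. L u \<bullet> (B' *v L w) = u \<bullet> (B *v w)"
    and p: "\<And>w. p' \<bullet> L w = p \<bullet> w"
  shows "matrix_inv B' *v p' = L (matrix_inv B *v p)"
proof -
  have "B' *v L (matrix_inv B *v p) = p'"
  proof (rule inner_right_eqI)
    fix y
    obtain w where y: "y = L w"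
      using L by (metis surjD)
    have "(B' *v L (matrix_inv B *v p)) \<bullet> y = w \<bullet> (B *v (matrix_inv B *v p))"
      unfolding y B[symmetric] by (rule inner_commute)
    also have "\<dots> = p' \<bullet> y"
      unfolding matrix_inv_vector(1)[OF inv(1)] y p by (rule inner_commute)
    finally show "(B' *v L (matrix_inv B *v p)) \<bullet> y = p' \<bullet> y" .
  qed
  then have "matrix_inv B' *v p' = matrix_inv B' *v (B' *v L (matrix_inv B *v p))"
    by simp
  then show ?thesis
    by (simp only: matrix_inv_vector(2)[OF inv(2)])
qed


section \<open>Second derivatives of the transition maps\<close>

text \<open>The derivative in the direction \<open>h\<close> of the transported vector \<open>u\<close>.\<close>

definition second_tr_deriv ::
  "('a, 'e::euclidean_space) chart \<Rightarrow> ('a, 'e) chart \<Rightarrow> 'a \<Rightarrow> 'e \<Rightarrow> 'e \<Rightarrow> 'e" where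
  "second_tr_deriv c d a h u =
     frechet_derivative (\<lambda>x. frechet_derivative (transition c d) (at x) u) (at (snd c a)) h"

context
  fixes M :: "('a, real ^ 'n) atlas"
  assumes M: "smooth_atlas M"
begin

lemma second_tr_deriv_sym:
  assumes "c \<in> M" "a \<in> fst c" "d \<in> M" "a \<in> fst d"
  shows "second_tr_deriv c d a u w = second_tr_deriv c d a w u"
  unfolding second_tr_deriv_def
  by (rule second_derivative_symmetric[OF open_chart_image_Int[OF M assms(1,3)]
        smooth_transition[OF M assms(1,3)]]) (use assms in auto)

text \<open>The first law is the chain rule for the projection to the base. The second one is the derivative of
  the law \<open>momentum_change\<close> in the direction of \<open>X\<close>; its second derivative of the
  transition map is what makes the momentum components of a tangent vector chart dependent.\<close>

lemma induced_chart_tangent_change: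
  assumes X: "X \<in> tangent_space (nonzero_cotangent_bundle M) z"
    and z: "z \<in> nonzero_cotangent_set M" and c: "c \<in> M" "fst z \<in> fst c" and d: "d \<in> M" "fst z \<in> fst d"
  shows "fst (X (induced_chart M d)) = tr_deriv c d (fst z) (fst (X (induced_chart M c)))"
    and "snd (X (induced_chart M d)) \<bullet> tr_deriv c d (fst z) w
       + momentum M d z \<bullet> second_tr_deriv c d (fst z) (fst (X (induced_chart M c))) w
       = snd (X (induced_chart M c)) \<bullet> w"
proof -
  let ?ic = "induced_chart M c" and ?id = "induced_chart M d"
  let ?T = "transition ?ic ?id" and ?y = "(snd c (fst z), momentum M c z)"
  let ?S = "snd ?ic ` (fst ?ic \<inter> fst ?id)"
  let ?D = "\<lambda>x. frechet_derivative (transition c d) (at x)"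
  note N = smooth_atlas_nonzero_cotangent_bundle[OF M]
  note ic = induced_chart_in_bundle[OF c(1)] and id = induced_chart_in_bundle[OF d(1)]
  have zc: "z \<in> fst ?ic" and zd: "z \<in> fst ?id"
    using z c d by (simp_all add: induced_chart_domain)
  have S: "open ?S" "?y \<in> ?S"
    by (rule open_chart_image_Int[OF N ic id])
      (rule image_eqI[of _ _ z], simp_all add: induced_chart_map zc zd)
  define DT where "DT = tr_deriv ?ic ?id z"
  have dT: "(?T has_derivative DT) (at ?y)"
    using transition_has_derivative[OF N ic id zc zd] by (simp add: induced_chart_map DT_def)
  have XDT: "X ?id = DT (X ?ic)"
    unfolding DT_def by (rule tangent_space_change[OF N X ic zc id zd])
  have T: "fst (?T y) = transition c d (fst y)" "snd (?T y) \<bullet> ?D (fst y) w = snd y \<bullet> w"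
    if "y \<in> ?S" for y w
  proof -
    obtain q where "y = snd ?ic q" "q \<in> fst ?ic \<inter> fst ?id"
      using \<open>y \<in> ?S\<close> by (rule imageE)
    then have q: "q \<in> nonzero_cotangent_set M" "fst q \<in> fst c" "fst q \<in> fst d"
      and y: "y = (snd c (fst q), momentum M c q)"
      by (simp_all add: induced_chart_domain induced_chart_map)
    have "?T y = (snd d (fst q), momentum M d q)"
      unfolding y by (rule transition_induced_chart[OF M c(1) q(2) d(1) q(3) q(1)])
    then show "fst (?T y) = transition c d (fst y)" "snd (?T y) \<bullet> ?D (fst y) w = snd y \<bullet> w"
      using momentum_change[OF M nonzero_cotangentD[OF q(1)] c(1) q(2) d(1) q(3), of w]
      by (simp_all add: y transition_at[OF M c(1) q(2)])
  qed
  have dfst: "(fst has_derivative fst) (at ?y)" and dsnd: "(snd has_derivative snd) (at ?y)"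
    by (auto intro!: derivative_eq_intros)
  have 1: "((\<lambda>y. transition c d (fst y)) has_derivative (\<lambda>k. tr_deriv c d (fst z) (fst k))) (at ?y)"
    using diff_chain_at[OF dfst, of "transition c d" "tr_deriv c d (fst z)"]
      transition_has_derivative[OF M c(1) d(1) c(2) d(2)] by (simp add: o_def)
  have "((\<lambda>y. fst (?T y)) has_derivative (\<lambda>k. fst (DT k))) (at ?y)"
    by (rule bounded_linear.has_derivative[OF bounded_linear_fst dT])
  then have 2: "((\<lambda>y. transition c d (fst y)) has_derivative (\<lambda>k. fst (DT k))) (at ?y)"
    by (rule has_derivative_transform_within_open[OF _ S]) (rule T(1))
  from fun_cong[OF has_derivative_unique[OF 2 1], of "X ?ic"]
  show "fst (X ?id) = tr_deriv c d (fst z) (fst (X ?ic))"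
    unfolding XDT .
  have "((\<lambda>x. ?D x w) has_derivative (\<lambda>h. second_tr_deriv c d (fst z) h w)) (at (snd c (fst z)))"
    unfolding second_tr_deriv_def using c d
    by (intro smooth_on_has_derivative[OF smooth_on_frechet_derivative[OF
            smooth_transition[OF M c(1) d(1)]]]) auto
  then have D: "((\<lambda>y. ?D (fst y) w) has_derivative (\<lambda>k. second_tr_deriv c d (fst z) (fst k) w)) (at ?y)"
    using diff_chain_at[OF dfst, of "\<lambda>x. ?D x w"] by (simp add: o_def)
  have "((\<lambda>y. snd (?T y)) has_derivative (\<lambda>k. snd (DT k))) (at ?y)"
    by (rule bounded_linear.has_derivative[OF bounded_linear_snd dT])
  from bounded_bilinear.FDERIV[OF bounded_bilinear_inner this D]
  have "((\<lambda>y. snd (?T y) \<bullet> ?D (fst y) w) has_derivative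
      (\<lambda>k. snd (?T ?y) \<bullet> second_tr_deriv c d (fst z) (fst k) w + snd (DT k) \<bullet> ?D (fst ?y) w)) (at ?y)" .
  then have 3: "((\<lambda>y. snd y \<bullet> w) has_derivative
      (\<lambda>k. snd (?T ?y) \<bullet> second_tr_deriv c d (fst z) (fst k) w + snd (DT k) \<bullet> ?D (fst ?y) w)) (at ?y)"
    by (rule has_derivative_transform_within_open[OF _ S]) (rule T(2))
  have 4: "((\<lambda>y. snd y \<bullet> w) has_derivative (\<lambda>k. snd k \<bullet> w)) (at ?y)"
    by (rule bounded_linear.has_derivative[OF bounded_linear_inner_left dsnd])
  from fun_cong[OF has_derivative_unique[OF 3 4], of "X ?ic"]
  show "snd (X ?id) \<bullet> tr_deriv c d (fst z) w
       + momentum M d z \<bullet> second_tr_deriv c d (fst z) (fst (X ?ic)) w = snd (X ?ic) \<bullet> w"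
    unfolding XDT transition_induced_chart[OF M c d z] fst_conv snd_conv
    by (simp only: add.commute)
qed

end


section \<open>The metric of the base and its Christoffel symbols\<close>

definition met_deriv ::
  "('a, real ^ 'n) atlas \<Rightarrow> ('a, real ^ 'n) bform \<Rightarrow> ('a, real ^ 'n) chart \<Rightarrow> 'a \<Rightarrow>
     real ^ 'n \<Rightarrow> real ^ 'n ^ 'n" where
  "met_deriv M g c a h =
     frechet_derivative (\<lambda>x. g_low M g c (chart_inv c x)) (at (snd c a)) h"

text \<open>The Christoffel symbols of the first kind $\Gamma_{l,ij} x^l u^i w^j$.\<close>

definition christoffel_form ::
  "('a, real ^ 'n) atlas \<Rightarrow> ('a, real ^ 'n) bform \<Rightarrow> ('a, real ^ 'n) chart \<Rightarrow> 'a \<Rightarrow>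
     real ^ 'n \<Rightarrow> real ^ 'n \<Rightarrow> real ^ 'n \<Rightarrow> real" where
  "christoffel_form M g c a x u w =
     (1 / 2) * (w \<bullet> (met_deriv M g c a u *v x) + u \<bullet> (met_deriv M g c a w *v x)
       - u \<bullet> (met_deriv M g c a x *v w))"

definition Gamma_mat ::
  "('a, real ^ 'n) atlas \<Rightarrow> ('a, real ^ 'n) bform \<Rightarrow> ('a, real ^ 'n) chart \<Rightarrow>
     ('a, 'n) cpoint \<Rightarrow> real ^ 'n ^ 'n" where
  "Gamma_mat M g c z = (\<chi> i j. Gamma0 M g c z i j)"

text \<open>The tangent vector $g^{0i}$ that the metric associates with the covector. Expressing the Christoffel
  symbols through it trades the second kind for the first, and the inverse metric disappears.\<close>

definition velocity ::
  "('a, real ^ 'n) atlas \<Rightarrow> ('a, real ^ 'n) bform \<Rightarrow> ('a, real ^ 'n) chart \<Rightarrow>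
     ('a, 'n) cpoint \<Rightarrow> real ^ 'n" where
  "velocity M g c z = g_up M g c (fst z) *v momentum M c z"

context
  fixes M :: "('a, real ^ 'n) atlas" and g :: "('a, real ^ 'n) bform"
  assumes M: "smooth_atlas M" and g: "riemannian_metric M g"
begin

lemma g_low_inner:
  assumes c: "c \<in> M" "a \<in> fst c"
  shows "u \<bullet> (g_low M g c a *v w) = g a (coord_vec M c a u) (coord_vec M c a w)"
proof -
  have a: "a \<in> carrier M"
    using c by (auto simp: carrier_def)
  have lin: "tangent_linear M a (g a X)" "tangent_linear M a (\<lambda>Y. g a Y X)"
    if "X \<in> tangent_space M a" for X
    using g a that unfolding riemannian_metric_def smooth_bilinear_field_def by blast+
  have "bilinear (\<lambda>u w. g a (coord_vec M c a u) (coord_vec M c a w))"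
    unfolding bilinear_def
  proof (intro conjI allI)
    note T = coord_vec_tangent[OF M c]
    show "linear (\<lambda>w. g a (coord_vec M c a u) (coord_vec M c a w))" for u
      by (rule tangent_linear_imp_linear[OF M lin(1)[OF T] c])
    show "linear (\<lambda>u. g a (coord_vec M c a u) (coord_vec M c a w))" for w
      by (rule tangent_linear_imp_linear[OF M lin(2)[OF T] c])
  qed
  from bilinear_eq_matrix[OF this, of u w] show ?thesis
    unfolding g_low_def by (rule sym)
qed

lemma pos_def_g_low:
  assumes c: "c \<in> M" "a \<in> fst c"
  shows "pos_def (g_low M g c a)"
  unfolding pos_def_def g_low_inner[OF c]
proof (intro conjI allI impI)
  have a: "a \<in> carrier M"
    using c by (auto simp: carrier_def)
  note T = coord_vec_tangent[OF M c]
  show "g a (coord_vec M c a u) (coord_vec M c a w) = g a (coord_vec M c a w) (coord_vec M c a u)"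
    for u w
    by (rule g[unfolded riemannian_metric_def, THEN conjunct2, THEN conjunct1, rule_format, OF a T T])
  fix u :: "real ^ 'n" assume "u \<noteq> 0"
  then have "coord_vec M c a u \<noteq> (\<lambda>_. 0)"
    using coord_vec_self[OF M c, of u] by auto
  then show "0 < g a (coord_vec M c a u) (coord_vec M c a u)"
    by (rule g[unfolded riemannian_metric_def, THEN conjunct2, THEN conjunct2, rule_format, OF a T])
qed

lemma g_low_change:
  assumes c: "c \<in> M" "a \<in> fst c" and d: "d \<in> M" "a \<in> fst d"
  shows "tr_deriv c d a u \<bullet> (g_low M g d a *v tr_deriv c d a w) = u \<bullet> (g_low M g c a *v w)"
  unfolding g_low_inner[OF c] g_low_inner[OF d] coord_vec_change[OF M c d] ..

lemma smooth_g_low: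
  assumes c: "c \<in> M"
  shows "smooth_on (snd c ` fst c) (\<lambda>x. g_low M g c (chart_inv c x))"
proof -
  have "smooth_on (snd c ` fst c) ((\<lambda>a. g a (coord_vec M c a u) (coord_vec M c a w)) \<circ> chart_inv c)"
    for u w
    using g c unfolding riemannian_metric_def smooth_bilinear_field_def by blast
  then show ?thesis
    unfolding g_low_def o_def by (intro smooth_on_vec open_chart_image[OF M c])
qed

lemma g_low_has_derivative:
  assumes c: "c \<in> M" "a \<in> fst c"
  shows "((\<lambda>x. g_low M g c (chart_inv c x)) has_derivative met_deriv M g c a) (at (snd c a))"
  unfolding met_deriv_def
  by (rule smooth_on_has_derivative[OF smooth_g_low[OF c(1)]]) (use c in auto)

lemma met_deriv_linear: "c \<in> M \<Longrightarrow> a \<in> fst c \<Longrightarrow> linear (met_deriv M g c a)"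
  using g_low_has_derivative by (rule has_derivative_linear)

lemma chart_deriv_g_low:
  assumes c: "c \<in> M" "a \<in> fst c"
  shows "chart_deriv c (\<lambda>b. g_low M g c b $ i $ j) a h = met_deriv M g c a h $ i $ j"
proof -
  have "((\<lambda>x. g_low M g c (chart_inv c x) $ i $ j) has_derivative
      (\<lambda>h. met_deriv M g c a h $ i $ j)) (at (snd c a))"
    by (intro bounded_linear.has_derivative[OF bounded_linear_vec_nth] g_low_has_derivative c)
  from frechet_derivative_at[OF this] show ?thesis
    unfolding chart_deriv_def o_def by metis
qed

lemma met_deriv_sym:
  assumes c: "c \<in> M" "a \<in> fst c"
  shows "u \<bullet> (met_deriv M g c a h *v w) = w \<bullet> (met_deriv M g c a h *v u)"
proof -
  have entry: "met_deriv M g c a h $ i $ j = met_deriv M g c a h $ j $ i" for i j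
  proof -
    have "g_low M g c (chart_inv c x) $ i $ j = g_low M g c (chart_inv c x) $ j $ i"
      if "x \<in> snd c ` fst c" for x
      using pos_def_sym[OF pos_def_g_low[OF c(1) chart_inv_in[OF that]], of "axis i 1" "axis j 1"]
      by (simp add: matrix_vector_mult_basis column_def inner_axis inner_axis')
    then have "frechet_derivative (\<lambda>x. g_low M g c (chart_inv c x) $ i $ j) (at (snd c a))
        = frechet_derivative (\<lambda>x. g_low M g c (chart_inv c x) $ j $ i) (at (snd c a))"
      using c by (intro frechet_derivative_cong[OF open_chart_image[OF M c(1)]]) auto
    then show ?thesis
      unfolding chart_deriv_g_low[OF c, symmetric] chart_deriv_def o_def by simp
  qed
  show ?thesis
    unfolding inner_matrix_vector
    by (subst sum.swap) (simp add: entry[of _ _] mult_ac cong: sum.cong)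
qed

text \<open>The law \<open>g_low_change\<close> holds near \<open>a\<close> and is differentiated there. The last two terms come
  from the vector arguments, which are transported by the varying derivative of the transition map.\<close>

lemma met_deriv_change:
  assumes c: "c \<in> M" "a \<in> fst c" and d: "d \<in> M" "a \<in> fst d"
  shows "u \<bullet> (met_deriv M g c a h *v w)
    = tr_deriv c d a u \<bullet> (met_deriv M g d a (tr_deriv c d a h) *v tr_deriv c d a w)
    + second_tr_deriv c d a h u \<bullet> (g_low M g d a *v tr_deriv c d a w)
    + tr_deriv c d a u \<bullet> (g_low M g d a *v second_tr_deriv c d a h w)"
proof -
  let ?U = "snd c ` (fst c \<inter> fst d)"
  let ?D = "\<lambda>x. frechet_derivative (transition c d) (at x)"
  let ?gd = "\<lambda>x. g_low M g d (chart_inv d (transition c d x))"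
  have aU: "snd c a \<in> ?U"
    using c d by auto
  have gd: "(?gd has_derivative (\<lambda>h. met_deriv M g d a (tr_deriv c d a h))) (at (snd c a))"
    using diff_chain_at[OF transition_has_derivative[OF M c(1) d(1) c(2) d(2)],
        of "\<lambda>x. g_low M g d (chart_inv d x)" "met_deriv M g d a"] g_low_has_derivative[OF d]
    by (simp add: transition_at[OF M c] o_def)
  have D: "((\<lambda>x. ?D x u) has_derivative (\<lambda>h. second_tr_deriv c d a h u)) (at (snd c a))" for u
    unfolding second_tr_deriv_def
    by (rule smooth_on_has_derivative[OF smooth_on_frechet_derivative[OF smooth_transition[OF M c(1) d(1)]] aU])
  have "((\<lambda>x. ?D x u \<bullet> (?gd x *v ?D x w)) has_derivative
      (\<lambda>h. tr_deriv c d a u \<bullet> (?gd (snd c a) *v second_tr_deriv c d a h w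
            + met_deriv M g d a (tr_deriv c d a h) *v tr_deriv c d a w)
         + second_tr_deriv c d a h u \<bullet> (?gd (snd c a) *v tr_deriv c d a w))) (at (snd c a))"
    by (intro bounded_bilinear.FDERIV[OF bounded_bilinear_inner]
        bounded_bilinear.FDERIV[OF bounded_bilinear_matrix_vector] D gd)
  moreover have "?D x u \<bullet> (?gd x *v ?D x w) = u \<bullet> (g_low M g c (chart_inv c x) *v w)"
    if "x \<in> ?U" for x
  proof -
    obtain b where b: "b \<in> fst c" "b \<in> fst d" "x = snd c b"
      using \<open>x \<in> ?U\<close> by auto
    show ?thesis
      unfolding b(3) transition_at[OF M c(1) b(1)] chart_inv_chart[OF M c(1) b(1)]
        chart_inv_chart[OF M d(1) b(2)] by (rule g_low_change[OF c(1) b(1) d(1) b(2)])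
  qed
  ultimately have 1: "((\<lambda>x. u \<bullet> (g_low M g c (chart_inv c x) *v w)) has_derivative
      (\<lambda>h. tr_deriv c d a u \<bullet> (?gd (snd c a) *v second_tr_deriv c d a h w
            + met_deriv M g d a (tr_deriv c d a h) *v tr_deriv c d a w)
         + second_tr_deriv c d a h u \<bullet> (?gd (snd c a) *v tr_deriv c d a w))) (at (snd c a))"
    by (rule has_derivative_transform_within_open[OF _ open_chart_image_Int[OF M c(1) d(1)] aU])
  have 2: "((\<lambda>x. u \<bullet> (g_low M g c (chart_inv c x) *v w)) has_derivative
      (\<lambda>h. u \<bullet> (met_deriv M g c a h *v w))) (at (snd c a))"
    by (intro bounded_linear.has_derivative[OF bounded_linear_inner_right]
        bounded_linear.has_derivative[OF bounded_bilinear.bounded_linear_left[OF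
            bounded_bilinear_matrix_vector]] g_low_has_derivative c)
  from fun_cong[OF has_derivative_unique[OF 2 1], of h] show ?thesis
    by (simp only: transition_at[OF M c] chart_inv_chart[OF M d] inner_add_right add_ac)
qed

text \<open>The law for the derivative of the metric contributes six terms with a second derivative of the
  transition map. By the symmetry of the metric and of second derivatives, four of them cancel and the
  other two, with their factor \<open>1 / 2\<close>, combine into the inhomogeneous term.\<close>

lemma christoffel_form_change:
  assumes c: "c \<in> M" "a \<in> fst c" and d: "d \<in> M" "a \<in> fst d"
  shows "christoffel_form M g c a x u w
    = christoffel_form M g d a (tr_deriv c d a x) (tr_deriv c d a u) (tr_deriv c d a w)
    + second_tr_deriv c d a u w \<bullet> (g_low M g d a *v tr_deriv c d a x)"
  unfolding christoffel_form_def met_deriv_change[OF c d]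
  using second_tr_deriv_sym[OF M c d, of w u] second_tr_deriv_sym[OF M c d, of x u]
    second_tr_deriv_sym[OF M c d, of x w]
    pos_def_sym[OF pos_def_g_low[OF d], of "second_tr_deriv c d a u x" "tr_deriv c d a w"]
  by (simp add: algebra_simps)

lemma christoffel_form_sym:
  assumes c: "c \<in> M" "a \<in> fst c"
  shows "christoffel_form M g c a x u w = christoffel_form M g c a x w u"
  unfolding christoffel_form_def using met_deriv_sym[OF c, of u x w] by simp

lemma g0_eq_velocity:
  assumes c: "c \<in> M" "fst z \<in> fst c"
  shows "g0 M g c z i = velocity M g c z $ i"
proof -
  have "velocity M g c z $ i = axis i 1 \<bullet> (g_up M g c (fst z) *v momentum M c z)"
    by (simp add: velocity_def inner_axis')
  also have "\<dots> = momentum M c z \<bullet> (g_up M g c (fst z) *v axis i 1)"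
    unfolding g_up_def by (rule pos_def_sym[OF pos_def_matrix_inv[OF pos_def_g_low[OF c]]])
  also have "\<dots> = g0 M g c z i"
    by (simp add: g0_def momentum_def inner_vec_def matrix_vector_mult_basis column_def)
  finally show ?thesis ..
qed

lemma g_low_velocity:
  assumes c: "c \<in> M" "fst z \<in> fst c"
  shows "g_low M g c (fst z) *v velocity M g c z = momentum M c z"
  unfolding velocity_def g_up_def
  by (rule matrix_inv_vector[OF pos_def_invertible[OF pos_def_g_low[OF c]]])

lemma Gamma0_eq_sum:
  assumes c: "c \<in> M" "fst z \<in> fst c"
  shows "Gamma0 M g c z i j = 1 / 2 * (\<Sum>l\<in>UNIV. velocity M g c z $ l *
    (met_deriv M g c (fst z) (axis i 1) $ j $ l + met_deriv M g c (fst z) (axis j 1) $ i $ l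
      - met_deriv M g c (fst z) (axis l 1) $ i $ j))"
proof -
  let ?a = "fst z"
  let ?T = "\<lambda>l. met_deriv M g c ?a (axis i 1) $ j $ l + met_deriv M g c ?a (axis j 1) $ i $ l
      - met_deriv M g c ?a (axis l 1) $ i $ j"
  have "Gamma0 M g c z i j
      = (\<Sum>k\<in>UNIV. \<Sum>l\<in>UNIV. 1 / 2 * (p_coord M c z k * g_up M g c ?a $ k $ l * ?T l))"
    by (simp add: Gamma0_def christoffel_def chart_deriv_g_low[OF c] sum_distrib_left mult_ac)
  also have "\<dots> = (\<Sum>l\<in>UNIV. \<Sum>k\<in>UNIV. 1 / 2 * (p_coord M c z k * g_up M g c ?a $ k $ l * ?T l))"
    by (rule sum.swap)
  also have "\<dots> = 1 / 2 * (\<Sum>l\<in>UNIV. g0 M g c z l * ?T l)"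
    by (simp add: g0_def sum_distrib_left sum_distrib_right mult_ac)
  finally show ?thesis
    by (simp add: g0_eq_velocity[OF c])
qed

lemma Gamma0_eq:
  assumes c: "c \<in> M" "fst z \<in> fst c"
  shows "Gamma0 M g c z i j = christoffel_form M g c (fst z) (velocity M g c z) (axis i 1) (axis j 1)"
proof -
  let ?a = "fst z" and ?x = "velocity M g c z"
  have "?x = (\<Sum>l\<in>UNIV. ?x $ l *\<^sub>R axis l 1)"
    using basis_expansion[of ?x] by (simp add: scalar_mult_eq_scaleR)
  then have "met_deriv M g c ?a ?x = met_deriv M g c ?a (\<Sum>l\<in>UNIV. ?x $ l *\<^sub>R axis l 1)"
    by (rule arg_cong)
  also have "\<dots> = (\<Sum>l\<in>UNIV. ?x $ l *\<^sub>R met_deriv M g c ?a (axis l 1))"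
    by (simp add: linear_sum[OF met_deriv_linear[OF c]] linear_scale[OF met_deriv_linear[OF c]])
  finally have "met_deriv M g c ?a ?x $ i $ j = (\<Sum>l\<in>UNIV. ?x $ l * met_deriv M g c ?a (axis l 1) $ i $ j)"
    by simp
  moreover have "axis i 1 \<bullet> (B *v axis j 1) = B $ i $ j" for B :: "real ^ 'n ^ 'n" and i j
    by (simp add: inner_axis' matrix_vector_mult_basis column_def)
  moreover have "axis i 1 \<bullet> (B *v w) = (\<Sum>l\<in>UNIV. w $ l * B $ i $ l)"
    for B :: "real ^ 'n ^ 'n" and i w
    by (simp add: inner_axis' matrix_vector_mult_def mult.commute)
  ultimately show ?thesis
    unfolding Gamma0_eq_sum[OF c] christoffel_form_def
    by (simp only: right_diff_distrib distrib_left sum.distrib sum_subtractf)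
qed

lemma Gamma_mat_inner:
  assumes c: "c \<in> M" "fst z \<in> fst c"
  shows "u \<bullet> (Gamma_mat M g c z *v w) = christoffel_form M g c (fst z) (velocity M g c z) u w"
proof -
  note L = met_deriv_linear[OF c]
  have "bilinear (christoffel_form M g c (fst z) (velocity M g c z))"
    unfolding bilinear_def christoffel_form_def
    by (auto intro!: linearI simp: linear_add[OF L] linear_scale[OF L] inner_add_left inner_add_right
        matrix_add_vector matrix_scaleR_vector matrix_vector_right_distrib matrix_vector_mult_scaleR
        add_divide_distrib diff_divide_distrib algebra_simps)
  from bilinear_eq_matrix[OF this, of u w] show ?thesis
    unfolding Gamma_mat_def Gamma0_eq[OF c] by (rule sym)
qed

lemma Gamma_mat_sym:
  assumes c: "c \<in> M" "fst z \<in> fst c"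
  shows "u \<bullet> (Gamma_mat M g c z *v w) = w \<bullet> (Gamma_mat M g c z *v u)"
  unfolding Gamma_mat_inner[OF c] by (rule christoffel_form_sym[OF c])

lemma velocity_change:
  assumes z: "z \<in> cotangent_set M" and c: "c \<in> M" "fst z \<in> fst c" and d: "d \<in> M" "fst z \<in> fst d"
  shows "velocity M g d z = tr_deriv c d (fst z) (velocity M g c z)"
  unfolding velocity_def g_up_def
  by (rule matrix_inv_change_basis)
    (use pos_def_invertible[OF pos_def_g_low] surj_tr_deriv[OF M c d] g_low_change[OF c d]
      momentum_change[OF M z c d] c d in auto)

end


section \<open>Components in the adapted frame\<close>

definition dq_vec ::
  "('a, real ^ 'n) atlas \<Rightarrow> ('a, real ^ 'n) chart \<Rightarrow> ('a, 'n) ctvec \<Rightarrow> real ^ 'n" where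
  "dq_vec M c X = fst (X (induced_chart M c))"

text \<open>Together with \<open>dq_vec\<close>, the coordinates of a vector in the adapted frame.\<close>

definition Dp_vec ::
  "('a, real ^ 'n) atlas \<Rightarrow> ('a, real ^ 'n) bform \<Rightarrow> ('a, real ^ 'n) chart \<Rightarrow>
     ('a, 'n) cpoint \<Rightarrow> ('a, 'n) ctvec \<Rightarrow> real ^ 'n" where
  "Dp_vec M g c z X = snd (X (induced_chart M c)) - Gamma_mat M g c z *v dq_vec M c X"

definition G_mat ::
  "('a, real ^ 'n) atlas \<Rightarrow> ('a, real ^ 'n) bform \<Rightarrow> real \<Rightarrow> (real \<Rightarrow> real) \<Rightarrow>
     ('a, real ^ 'n) chart \<Rightarrow> ('a, 'n) cpoint \<Rightarrow> real ^ 'n ^ 'n" where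
  "G_mat M g A v c z = (\<chi> i j. G_low M g A v c z i j)"

definition H_mat ::
  "('a, real ^ 'n) atlas \<Rightarrow> ('a, real ^ 'n) bform \<Rightarrow> real \<Rightarrow> (real \<Rightarrow> real) \<Rightarrow>
     ('a, real ^ 'n) chart \<Rightarrow> ('a, 'n) cpoint \<Rightarrow> real ^ 'n ^ 'n" where
  "H_mat M g A v c z = (\<chi> i j. H_up M g A v c z i j)"

lemma dq_eq: "dq M c i X = dq_vec M c X $ i"
  by (simp add: dq_def dq_vec_def)

lemma Dp_eq: "Dp M g c z i X = Dp_vec M g c z X $ i"
  by (simp add: Dp_def dp_def Dp_vec_def Gamma_mat_def matrix_vector_mult_def dq_eq)

lemma G_local_eq:
  "G_local M g A v c z X Y = dq_vec M c X \<bullet> (G_mat M g A v c z *v dq_vec M c Y)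
    + Dp_vec M g c z X \<bullet> (H_mat M g A v c z *v Dp_vec M g c z Y)"
  by (simp add: G_local_def dq_eq Dp_eq inner_matrix_vector G_mat_def H_mat_def)

lemma energy_eq: "energy M g c z = 1 / 2 * (momentum M c z \<bullet> velocity M g c z)"
  by (simp add: energy_def velocity_def inner_matrix_vector momentum_def)

lemma dq_vec_lincomb:
  "dq_vec M c (\<lambda>e. r *\<^sub>R X e + s *\<^sub>R Y e) = r *\<^sub>R dq_vec M c X + s *\<^sub>R dq_vec M c Y"
  by (simp add: dq_vec_def)

lemma Dp_vec_lincomb:
  "Dp_vec M g c z (\<lambda>e. r *\<^sub>R X e + s *\<^sub>R Y e) = r *\<^sub>R Dp_vec M g c z X + s *\<^sub>R Dp_vec M g c z Y"
  by (simp add: Dp_vec_def dq_vec_lincomb matrix_vector_right_distrib matrix_vector_mult_scaleR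
      algebra_simps)

lemma G_mat_eq:
  "G_mat M g A v c z = (A * sqrt (energy M g c z)) *\<^sub>R g_low M g c (fst z)
    + v (energy M g c z) *\<^sub>R outer (momentum M c z)"
  by (simp add: vec_eq_iff G_mat_def G_low_def Let_def outer_def momentum_def)

context
  fixes M :: "('a, real ^ 'n) atlas"
  assumes M: "smooth_atlas M"
begin

lemma tangent_eqI_components:
  assumes X: "X \<in> tangent_space (nonzero_cotangent_bundle M) z"
    and Y: "Y \<in> tangent_space (nonzero_cotangent_bundle M) z"
    and z: "z \<in> nonzero_cotangent_set M" and c: "c \<in> M" "fst z \<in> fst c"
    and dq: "dq_vec M c X = dq_vec M c Y" and Dp: "Dp_vec M g c z X = Dp_vec M g c z Y"
  shows "X = Y"
proof (rule tangent_space_eqI[OF smooth_atlas_nonzero_cotangent_bundle[OF M] X Y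
      induced_chart_in_bundle[OF c(1)]])
  show "X (induced_chart M c) = Y (induced_chart M c)"
    using dq Dp by (simp add: Dp_vec_def) (simp add: dq_vec_def prod_eq_iff)
qed (use z c in \<open>simp add: induced_chart_domain\<close>)

lemma coord_vec_components:
  assumes z: "z \<in> nonzero_cotangent_set M" and c: "c \<in> M" "fst z \<in> fst c"
  shows "coord_vec (nonzero_cotangent_bundle M) (induced_chart M c) z u (induced_chart M c) = u"
    and "coord_vec (nonzero_cotangent_bundle M) (induced_chart M c) z u
      \<in> tangent_space (nonzero_cotangent_bundle M) z"
proof -
  note N = smooth_atlas_nonzero_cotangent_bundle[OF M]
  have zc: "z \<in> fst (induced_chart M c)"
    using z c by (simp add: induced_chart_domain)
  show "coord_vec (nonzero_cotangent_bundle M) (induced_chart M c) z u (induced_chart M c) = u"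
    by (rule coord_vec_self[OF N induced_chart_in_bundle[OF c(1)] zc])
  show "coord_vec (nonzero_cotangent_bundle M) (induced_chart M c) z u
      \<in> tangent_space (nonzero_cotangent_bundle M) z"
    by (rule coord_vec_tangent[OF N induced_chart_in_bundle[OF c(1)] zc])
qed


section \<open>Smooth functions on the cotangent bundle\<close>

text \<open>Smoothness in the chart induced by \<open>c\<close>, for functions of the covector itself: local expressions
  can then be assembled from their constituents without a change to coordinates at each step.\<close>

definition bundle_smooth :: "('a, real ^ 'n) chart \<Rightarrow> (('a, 'n) cpoint \<Rightarrow> 'b::real_normed_vector) \<Rightarrow> bool" where
  "bundle_smooth c f \<longleftrightarrow>
     smooth_on (snd (induced_chart M c) ` fst (induced_chart M c)) (\<lambda>y. f (chart_inv (induced_chart M c) y))"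

lemma open_induced_image:
  "c \<in> M \<Longrightarrow> open (snd (induced_chart M c) ` fst (induced_chart M c))"
  by (rule open_chart_image[OF smooth_atlas_nonzero_cotangent_bundle[OF M] induced_chart_in_bundle])

lemma induced_chart_inv:
  assumes c: "c \<in> M" and y: "y \<in> snd (induced_chart M c) ` fst (induced_chart M c)"
  shows "chart_inv (induced_chart M c) y \<in> nonzero_cotangent_set M"
    and "fst (chart_inv (induced_chart M c) y) \<in> fst c"
    and "snd c (fst (chart_inv (induced_chart M c) y)) = fst y"
    and "momentum M c (chart_inv (induced_chart M c) y) = snd y"
    and "fst (chart_inv (induced_chart M c) y) = chart_inv c (fst y)"
    and "fst y \<in> snd c ` fst c"
proof -
  let ?z = "chart_inv (induced_chart M c) y"
  show z: "?z \<in> nonzero_cotangent_set M" and zc: "fst ?z \<in> fst c"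
    using chart_inv_in[OF y] by (simp_all add: induced_chart_domain)
  have *: "(snd c (fst ?z), momentum M c ?z) = y"
    using chart_chart_inv[OF y] by (simp only: induced_chart_map)
  show sc: "snd c (fst ?z) = fst y" and "momentum M c ?z = snd y"
    using arg_cong[OF *, of fst] arg_cong[OF *, of snd] by simp_all
  show "fst ?z = chart_inv c (fst y)"
    using chart_inv_chart[OF M c zc] unfolding sc by (rule sym)
  show "fst y \<in> snd c ` fst c"
    unfolding sc[symmetric] by (rule imageI[OF zc])
qed

lemma bundle_smooth_cong:
  assumes c: "c \<in> M"
    and eq: "\<And>z. z \<in> nonzero_cotangent_set M \<Longrightarrow> fst z \<in> fst c \<Longrightarrow> f z = h z"
    and h: "bundle_smooth c h"
  shows "bundle_smooth c f"
  using h unfolding bundle_smooth_def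
  by (rule iffD2[OF smooth_on_cong[OF open_induced_image[OF c]], rotated])
    (rule eq[OF induced_chart_inv(1,2)[OF c]])

lemma bundle_smooth_base:
  assumes c: "c \<in> M" and f: "smooth_on (snd c ` fst c) (\<lambda>x. f (chart_inv c x))"
  shows "bundle_smooth c (\<lambda>z. f (fst z))"
  unfolding bundle_smooth_def
proof (rule iffD2[OF smooth_on_cong[OF open_induced_image[OF c]]])
  let ?S = "snd (induced_chart M c) ` fst (induced_chart M c)"
  show "smooth_on ?S (\<lambda>y. f (chart_inv c (fst y)))"
    using induced_chart_inv(6)[OF c]
    by (intro smooth_on_compose[where h = fst, OF open_induced_image[OF c] f]
        smooth_on_bounded_linear bounded_linear_fst) auto
qed (simp only: induced_chart_inv(5)[OF c])

lemma bundle_smooth_momentum: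
  assumes c: "c \<in> M"
  shows "bundle_smooth c (momentum M c)"
  unfolding bundle_smooth_def
  by (rule iffD2[OF smooth_on_cong[OF open_induced_image[OF c]], OF induced_chart_inv(4)[OF c]])
    (auto intro!: smooth_on_bounded_linear bounded_linear_snd)

lemma bundle_smooth_bilinear:
  assumes "bounded_bilinear b" "c \<in> M" "bundle_smooth c f" "bundle_smooth c h"
  shows "bundle_smooth c (\<lambda>z. b (f z) (h z))"
  using smooth_on_bilinear[OF assms(1) open_induced_image[OF assms(2)]] assms(3,4)
  unfolding bundle_smooth_def .

lemma bundle_smooth_add:
  "c \<in> M \<Longrightarrow> bundle_smooth c f \<Longrightarrow> bundle_smooth c h \<Longrightarrow> bundle_smooth c (\<lambda>z. f z + h z)"
  unfolding bundle_smooth_def by (rule smooth_on_add[OF open_induced_image])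

lemma bundle_smooth_diff:
  "c \<in> M \<Longrightarrow> bundle_smooth c f \<Longrightarrow> bundle_smooth c h \<Longrightarrow> bundle_smooth c (\<lambda>z. f z - h z)"
  unfolding bundle_smooth_def by (rule smooth_on_diff[OF open_induced_image])

lemma bundle_smooth_minus:
  "c \<in> M \<Longrightarrow> bundle_smooth c f \<Longrightarrow> bundle_smooth c (\<lambda>z. - f z)"
  unfolding bundle_smooth_def by (rule smooth_on_minus[OF open_induced_image])

lemma bundle_smooth_const: "bundle_smooth c (\<lambda>z. k)"
  unfolding bundle_smooth_def by (rule smooth_on_const)

lemma bundle_smooth_vec:
  fixes f :: "('a, 'n) cpoint \<Rightarrow> 'n \<Rightarrow> 'b::euclidean_space"
  shows "c \<in> M \<Longrightarrow> (\<And>i. bundle_smooth c (\<lambda>z. f z i)) \<Longrightarrow> bundle_smooth c (\<lambda>z. \<chi> i. f z i)"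
  unfolding bundle_smooth_def by (rule smooth_on_vec[OF open_induced_image])

lemma bundle_smooth_nth:
  fixes f :: "('a, 'n) cpoint \<Rightarrow> 'b::euclidean_space ^ 'n"
  shows "c \<in> M \<Longrightarrow> bundle_smooth c f \<Longrightarrow> bundle_smooth c (\<lambda>z. f z $ i)"
  unfolding bundle_smooth_def by (rule smooth_on_nth[OF open_induced_image])

lemma bundle_smooth_matrix_inv:
  assumes "c \<in> M" "bundle_smooth c B"
    and "\<And>z. z \<in> nonzero_cotangent_set M \<Longrightarrow> fst z \<in> fst c \<Longrightarrow> pos_def (B z)"
  shows "bundle_smooth c (\<lambda>z. matrix_inv (B z))"
  using assms(2) unfolding bundle_smooth_def
  by (rule smooth_on_matrix_inv[OF open_induced_image[OF assms(1)]])
    (rule pos_def_invertible[OF assms(3)[OF induced_chart_inv(1,2)[OF assms(1)]]])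

lemmas bundle_smooth_mult = bundle_smooth_bilinear[OF bounded_bilinear_mult]

lemmas bundle_smooth_scaleR = bundle_smooth_bilinear[OF bounded_bilinear_scaleR]

lemmas bundle_smooth_inner = bundle_smooth_bilinear[OF bounded_bilinear_inner]

lemmas bundle_smooth_matrix_vector = bundle_smooth_bilinear[OF bounded_bilinear_matrix_vector]

context
  fixes g :: "('a, real ^ 'n) bform"
  assumes g: "riemannian_metric M g"
begin

lemma bundle_smooth_g_low: "c \<in> M \<Longrightarrow> bundle_smooth c (\<lambda>z. g_low M g c (fst z))"
  by (intro bundle_smooth_base smooth_g_low[OF M g])

lemma bundle_smooth_velocity:
  assumes c: "c \<in> M"
  shows "bundle_smooth c (velocity M g c)"
proof -
  have "bundle_smooth c (\<lambda>z. matrix_inv (g_low M g c (fst z)) *v momentum M c z)"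
    by (rule bundle_smooth_matrix_vector[OF c bundle_smooth_matrix_inv[OF c bundle_smooth_g_low[OF c]]
          bundle_smooth_momentum[OF c]]) (rule pos_def_g_low[OF M g c])
  then show ?thesis
    unfolding velocity_def g_up_def .
qed

lemma bundle_smooth_met_deriv:
  assumes c: "c \<in> M"
  shows "bundle_smooth c (\<lambda>z. met_deriv M g c (fst z) h)"
proof (rule bundle_smooth_base[OF c])
  show "smooth_on (snd c ` fst c) (\<lambda>x. met_deriv M g c (chart_inv c x) h)"
  proof (rule iffD2[OF smooth_on_cong[OF open_chart_image[OF M c]]])
    show "smooth_on (snd c ` fst c)
        (\<lambda>x. frechet_derivative (\<lambda>x. g_low M g c (chart_inv c x)) (at x) h)"
      by (rule smooth_on_frechet_derivative[OF smooth_g_low[OF M g c]])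
  qed (simp add: met_deriv_def chart_chart_inv)
qed

lemma bundle_smooth_Gamma_mat:
  assumes c: "c \<in> M"
  shows "bundle_smooth c (Gamma_mat M g c)"
proof (rule bundle_smooth_cong[OF c])
  let ?T = "\<lambda>z i j l. met_deriv M g c (fst z) (axis i 1) $ j $ l
      + met_deriv M g c (fst z) (axis j 1) $ i $ l - met_deriv M g c (fst z) (axis l 1) $ i $ j"
  show "Gamma_mat M g c z = (\<chi> i j. 1 / 2 * (velocity M g c z \<bullet> (\<chi> l. ?T z i j l)))"
    if "fst z \<in> fst c" for z
    by (simp add: vec_eq_iff Gamma_mat_def Gamma0_eq_sum[OF M g c that] inner_vec_def)
  show "bundle_smooth c (\<lambda>z. \<chi> i j. 1 / 2 * (velocity M g c z \<bullet> (\<chi> l. ?T z i j l)))"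
    by (intro bundle_smooth_vec bundle_smooth_mult bundle_smooth_inner bundle_smooth_const
        bundle_smooth_add bundle_smooth_diff bundle_smooth_nth bundle_smooth_met_deriv
        bundle_smooth_velocity c)
qed

lemma energy_pos:
  assumes z: "z \<in> nonzero_cotangent_set M" and c: "c \<in> M" "fst z \<in> fst c"
  shows "energy M g c z > 0"
proof -
  have "velocity M g c z \<noteq> 0"
    using g_low_velocity[OF M g c] momentum_nonzero[OF M z c] by force
  from pos_def_pos[OF pos_def_g_low[OF M g c] this] show ?thesis
    by (simp add: energy_eq g_low_velocity[OF M g c] inner_commute)
qed

text \<open>The components \<open>Dp\<close> transform without second derivatives: those of the transition map
  that enter the law for the momentum components are compensated by those in the law for the
  Christoffel symbols.\<close>

lemma Dp_vec_change:
  assumes X: "X \<in> tangent_space (nonzero_cotangent_bundle M) z"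
    and z: "z \<in> nonzero_cotangent_set M" and c: "c \<in> M" "fst z \<in> fst c" and d: "d \<in> M" "fst z \<in> fst d"
  shows "Dp_vec M g d z X \<bullet> tr_deriv c d (fst z) w = Dp_vec M g c z X \<bullet> w"
proof -
  let ?L = "tr_deriv c d (fst z)" and ?u = "dq_vec M c X"
  have u: "dq_vec M d X = ?L ?u"
    unfolding dq_vec_def by (rule induced_chart_tangent_change(1)[OF M X z c d])
  have "momentum M d z = g_low M g d (fst z) *v ?L (velocity M g c z)"
    using g_low_velocity[OF M g d] velocity_change[OF M g nonzero_cotangentD[OF z] c d] by simp
  then have G: "?L w \<bullet> (Gamma_mat M g d z *v ?L ?u)
      = w \<bullet> (Gamma_mat M g c z *v ?u) - momentum M d z \<bullet> second_tr_deriv c d (fst z) ?u w"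
    using second_tr_deriv_sym[OF M c d, of ?u w]
    by (simp add: Gamma_mat_inner[OF M g c] Gamma_mat_inner[OF M g d]
        velocity_change[OF M g nonzero_cotangentD[OF z] c d]
        christoffel_form_change[OF M g c d, of _ w ?u] inner_commute)
  have "snd (X (induced_chart M d)) \<bullet> ?L w
      = snd (X (induced_chart M c)) \<bullet> w - momentum M d z \<bullet> second_tr_deriv c d (fst z) ?u w"
    using induced_chart_tangent_change(2)[OF M X z c d, of w] by (simp add: dq_vec_def)
  then show ?thesis
    using G by (simp add: Dp_vec_def u inner_diff_left inner_diff_right inner_commute)
qed

context
  fixes A :: real and v :: "real \<Rightarrow> real"
  assumes A: "A > 0" and v: "\<And>t. t > 0 \<Longrightarrow> v t > - A / (2 * sqrt t)"
begin

text \<open>The lower bound on \<open>v\<close>, multiplied by twice the energy, is the condition of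
  \<open>pos_def_rank_one_update\<close>, because momentum and velocity pair to twice the energy.\<close>

lemma rank_one_coefficient_pos:
  assumes z: "z \<in> nonzero_cotangent_set M" and c: "c \<in> M" "fst z \<in> fst c"
  shows "A * sqrt (energy M g c z) > 0"
    and "A * sqrt (energy M g c z) + v (energy M g c z) * (momentum M c z \<bullet> velocity M g c z) > 0"
proof -
  let ?t = "energy M g c z"
  have t: "?t > 0"
    by (rule energy_pos[OF assms])
  then show "A * sqrt ?t > 0"
    using A by simp
  have "- A / (2 * sqrt ?t) * (2 * sqrt ?t) < v ?t * (2 * sqrt ?t)"
    using v[OF t] t by (intro mult_strict_right_mono) auto
  then have "- A < v ?t * (2 * sqrt ?t)"
    using t by simp
  then have "0 < sqrt ?t * (A + 2 * sqrt ?t * v ?t)"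
    using t by (simp add: mult_ac)
  also have "\<dots> = A * sqrt ?t + v ?t * (2 * ?t)"
    using t by (simp add: algebra_simps)
  finally show "A * sqrt ?t + v ?t * (momentum M c z \<bullet> velocity M g c z) > 0"
    by (simp add: energy_eq)
qed

lemma pos_def_G_mat:
  assumes z: "z \<in> nonzero_cotangent_set M" and c: "c \<in> M" "fst z \<in> fst c"
  shows "pos_def (G_mat M g A v c z)"
  unfolding G_mat_eq
  by (rule pos_def_rank_one_update[OF pos_def_g_low[OF M g c] g_low_velocity[OF M g c]
        rank_one_coefficient_pos[OF assms]])

text \<open>The coefficient \<open>w_coeff\<close> is the one in the Sherman--Morrison formula. As an inverse matrix,
  \<open>H_mat\<close> inherits its positivity, its smoothness and its behaviour under a change of chart from
  \<open>G_mat\<close>.\<close>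

lemma H_mat_eq:
  assumes z: "z \<in> nonzero_cotangent_set M" and c: "c \<in> M" "fst z \<in> fst c"
  shows "H_mat M g A v c z = matrix_inv (G_mat M g A v c z)"
proof -
  let ?t = "energy M g c z"
  have t: "?t > 0"
    by (rule energy_pos[OF assms])
  have p: "momentum M c z \<bullet> velocity M g c z = 2 * ?t"
    by (simp add: energy_eq)
  have "A * s * (A * s + k * (2 * t)) = A * t * (A + 2 * s * k)" if "s * s = t" for s t k :: real
    using that by (auto simp: algebra_simps)
  from this[of "sqrt ?t" ?t "v ?t"]
  have "A * sqrt ?t * (A * sqrt ?t + v ?t * (2 * ?t)) = A * ?t * (A + 2 * sqrt ?t * v ?t)"
    using t by (simp only: real_sqrt_mult_self abs_of_pos)
  then have w: "- v ?t / (A * sqrt ?t * (A * sqrt ?t + v ?t * (2 * ?t))) = w_coeff A v ?t"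
    unfolding w_coeff_def by (rule arg_cong)
  have "matrix_inv (G_mat M g A v c z)
      = (1 / (A * sqrt ?t)) *\<^sub>R g_up M g c (fst z) + w_coeff A v ?t *\<^sub>R outer (velocity M g c z)"
    unfolding G_mat_eq matrix_inv_rank_one_update[OF pos_def_g_low[OF M g c] g_low_velocity[OF M g c]
        rank_one_coefficient_pos[OF assms]] p w g_up_def ..
  then show ?thesis
    by (simp add: vec_eq_iff H_mat_def H_up_def Let_def outer_def g0_eq_velocity[OF M g c])
qed

lemma pos_def_H_mat:
  assumes z: "z \<in> nonzero_cotangent_set M" and c: "c \<in> M" "fst z \<in> fst c"
  shows "pos_def (H_mat M g A v c z)"
  unfolding H_mat_eq[OF assms] by (rule pos_def_matrix_inv[OF pos_def_G_mat[OF assms]])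

lemma G_H_mat:
  assumes z: "z \<in> nonzero_cotangent_set M" and c: "c \<in> M" "fst z \<in> fst c"
  shows "G_mat M g A v c z *v (H_mat M g A v c z *v u) = u"
    and "H_mat M g A v c z *v (G_mat M g A v c z *v u) = u"
  unfolding H_mat_eq[OF assms]
  by (rule matrix_inv_vector[OF pos_def_invertible[OF pos_def_G_mat[OF assms]]])+


section \<open>Independence of the chart\<close>

lemma G_mat_change:
  assumes z: "z \<in> nonzero_cotangent_set M" and c: "c \<in> M" "fst z \<in> fst c" and d: "d \<in> M" "fst z \<in> fst d"
  shows "tr_deriv c d (fst z) u \<bullet> (G_mat M g A v d z *v tr_deriv c d (fst z) w)
       = u \<bullet> (G_mat M g A v c z *v w)"
proof -
  note p = momentum_change[OF M nonzero_cotangentD[OF z] c d]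
  have "energy M g d z = energy M g c z"
    by (simp add: energy_eq velocity_change[OF M g nonzero_cotangentD[OF z] c d] p)
  then show ?thesis
    by (simp add: G_mat_eq matrix_add_vector matrix_scaleR_vector outer_vector inner_add_right
        g_low_change[OF M g c d] p inner_commute[of "tr_deriv c d (fst z) u" "momentum M d z"]
        inner_commute[of u "momentum M c z"])
qed

lemma H_mat_Dp_vec_change:
  assumes X: "X \<in> tangent_space (nonzero_cotangent_bundle M) z"
    and z: "z \<in> nonzero_cotangent_set M" and c: "c \<in> M" "fst z \<in> fst c" and d: "d \<in> M" "fst z \<in> fst d"
  shows "H_mat M g A v d z *v Dp_vec M g d z X
    = tr_deriv c d (fst z) (H_mat M g A v c z *v Dp_vec M g c z X)"
  unfolding H_mat_eq[OF z c] H_mat_eq[OF z d]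
  by (rule matrix_inv_change_basis[OF pos_def_invertible[OF pos_def_G_mat[OF z c]]
        pos_def_invertible[OF pos_def_G_mat[OF z d]] surj_tr_deriv[OF M c d]
        G_mat_change[OF z c d] Dp_vec_change[OF X z c d]])

lemma G_local_change:
  assumes X: "X \<in> tangent_space (nonzero_cotangent_bundle M) z"
    and Y: "Y \<in> tangent_space (nonzero_cotangent_bundle M) z"
    and z: "z \<in> nonzero_cotangent_set M" and c: "c \<in> M" "fst z \<in> fst c" and d: "d \<in> M" "fst z \<in> fst d"
  shows "G_local M g A v d z X Y = G_local M g A v c z X Y"
  unfolding G_local_eq H_mat_Dp_vec_change[OF Y z c d] Dp_vec_change[OF X z c d]
  by (simp add: dq_vec_def induced_chart_tangent_change(1)[OF M _ z c d] X Y G_mat_change[OF z c d])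

lemma J_local_tangent:
  assumes z: "z \<in> nonzero_cotangent_set M" and c: "c \<in> M" "fst z \<in> fst c"
  shows "J_local M g A v c z X \<in> tangent_space (nonzero_cotangent_bundle M) z"
proof -
  note N = smooth_atlas_nonzero_cotangent_bundle[OF M]
  have zc: "z \<in> fst (induced_chart M c)"
    using z c by (simp add: induced_chart_domain)
  note T = coord_vec_tangent[OF N induced_chart_in_bundle[OF c(1)] zc]
  have "delta_dq M g c z k \<in> tangent_space (nonzero_cotangent_bundle M) z" for k
    unfolding delta_dq_def d_dq_def d_dp_def
    by (intro tangent_space_add[OF N] tangent_space_sum[OF N] tangent_space_scale[OF N] T)
  then have "(\<lambda>e. - 1 *\<^sub>R (\<Sum>k\<in>UNIV. H_up M g A v c z i k *\<^sub>R delta_dq M g c z k e))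
      \<in> tangent_space (nonzero_cotangent_bundle M) z" for i
    by (intro tangent_space_sum[OF N] tangent_space_scale[OF N])
  then show ?thesis
    unfolding J_local_def d_dp_def scaleR_minus1_left
    by (intro tangent_space_add[OF N] tangent_space_sum[OF N] tangent_space_scale[OF N] T)
qed

text \<open>In the adapted frame, the complex structure is the block matrix with entries \<open>0\<close>, \<open>- H_mat\<close>,
  \<open>G_mat\<close>, \<open>0\<close>. The symmetry of the Christoffel symbols enters because a combination of frame vectors
  sums over their first lower index, the dual frame over the second.\<close>

lemma J_local_components:
  assumes z: "z \<in> nonzero_cotangent_set M" and c: "c \<in> M" "fst z \<in> fst c"
  shows "dq_vec M c (J_local M g A v c z X) = - (H_mat M g A v c z *v Dp_vec M g c z X)"
    and "Dp_vec M g c z (J_local M g A v c z X) = G_mat M g A v c z *v dq_vec M c X"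
proof -
  let ?H = "H_mat M g A v c z" and ?G = "G_mat M g A v c z" and ?\<Gamma> = "Gamma_mat M g c z"
  let ?D = "Dp_vec M g c z X" and ?u = "dq_vec M c X" and ?ic = "induced_chart M c"
  note N = smooth_atlas_nonzero_cotangent_bundle[OF M]
  have zc: "z \<in> fst ?ic"
    using z c by (simp add: induced_chart_domain)
  note self = coord_vec_self[OF N induced_chart_in_bundle[OF c(1)] zc]
  have axes: "(\<Sum>k\<in>UNIV. x $ k *\<^sub>R axis k 1) = x" for x :: "real ^ 'n"
    using basis_expansion[of x] by (simp add: scalar_mult_eq_scaleR)
  have rows: "(\<Sum>k\<in>UNIV. x $ k *\<^sub>R B $ k) = B *v x"
    if "\<And>u w. u \<bullet> (B *v w) = w \<bullet> (B *v u)" for B :: "real ^ 'n ^ 'n" and x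
  proof (rule inner_right_eqI)
    fix y
    have "(\<Sum>k\<in>UNIV. x $ k *\<^sub>R B $ k) \<bullet> y = x \<bullet> (B *v y)"
      by (simp add: inner_sum_left inner_vec_def[of x] matrix_vector_mul_component)
    also have "\<dots> = (B *v x) \<bullet> y"
      unfolding that[of x y] by (rule inner_commute)
    finally show "(\<Sum>k\<in>UNIV. x $ k *\<^sub>R B $ k) \<bullet> y = (B *v x) \<bullet> y" .
  qed
  note H = rows[OF pos_def_sym[OF pos_def_H_mat[OF assms]]]
    and G = rows[OF pos_def_sym[OF pos_def_G_mat[OF assms]]]
    and \<Gamma> = rows[OF Gamma_mat_sym[OF M g c]]
  have d_dp: "d_dp M c z k ?ic = (0, axis k 1)" for k
    by (simp add: d_dp_def self)
  have "(\<Sum>h\<in>UNIV. Gamma0 M g c z k h *\<^sub>R axis h 1) = ?\<Gamma> $ k" for k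
    using axes[of "?\<Gamma> $ k"] by (simp add: Gamma_mat_def)
  then have delta: "delta_dq M g c z k ?ic = (axis k 1, ?\<Gamma> $ k)" for k
    by (simp add: delta_dq_def d_dq_def d_dp self prod_eq_iff fst_sum snd_sum)
  have Gk: "(\<Sum>k\<in>UNIV. G_low M g A v c z i k *\<^sub>R d_dp M c z k ?ic) = (0, ?G $ i)" for i
    using axes[of "?G $ i"] by (simp add: d_dp prod_eq_iff fst_sum snd_sum G_mat_def)
  have Hk: "(\<Sum>k\<in>UNIV. H_up M g A v c z i k *\<^sub>R delta_dq M g c z k ?ic) = (?H $ i, ?\<Gamma> *v ?H $ i)" for i
    using axes[of "?H $ i"] \<Gamma>[of "?H $ i"] by (simp add: delta prod_eq_iff fst_sum snd_sum H_mat_def)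
  have "linear ((*v) ?\<Gamma>)"
    by simp
  then have \<Gamma>H: "(\<Sum>i\<in>UNIV. ?D $ i *\<^sub>R (?\<Gamma> *v ?H $ i)) = ?\<Gamma> *v (?H *v ?D)"
    unfolding H[symmetric] by (simp only: linear_sum linear_scale)
  have J: "J_local M g A v c z X ?ic = (- (?H *v ?D), ?G *v ?u - ?\<Gamma> *v (?H *v ?D))"
    unfolding J_local_def Gk Hk dq_eq Dp_eq
    by (simp add: prod_eq_iff fst_sum snd_sum sum_negf H G \<Gamma>H)
  show dq: "dq_vec M c (J_local M g A v c z X) = - (?H *v ?D)"
    by (simp add: dq_vec_def J)
  have "?\<Gamma> *v - (?H *v ?D) = - (?\<Gamma> *v (?H *v ?D))"
    using linear_neg[of "(*v) ?\<Gamma>"] by simp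
  then show "Dp_vec M g c z (J_local M g A v c z X) = ?G *v ?u"
    by (simp add: Dp_vec_def dq J)
qed

text \<open>A tangent vector is determined by its adapted components in one chart, and those of the two
  expressions have the same law.\<close>

lemma J_local_change:
  assumes X: "X \<in> tangent_space (nonzero_cotangent_bundle M) z"
    and z: "z \<in> nonzero_cotangent_set M" and c: "c \<in> M" "fst z \<in> fst c" and d: "d \<in> M" "fst z \<in> fst d"
  shows "J_local M g A v d z X = J_local M g A v c z X"
proof (rule tangent_eqI_components[OF J_local_tangent[OF z d] J_local_tangent[OF z c] z d])
  let ?L = "tr_deriv c d (fst z)"
  note Jc = J_local_tangent[OF z c, of X]
  have dq: "dq_vec M d Y = ?L (dq_vec M c Y)"
    if "Y \<in> tangent_space (nonzero_cotangent_bundle M) z" for Y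
    unfolding dq_vec_def by (rule induced_chart_tangent_change(1)[OF M that z c d])
  show "dq_vec M d (J_local M g A v d z X) = dq_vec M d (J_local M g A v c z X)"
    unfolding dq[OF Jc] J_local_components(1)[OF z c] J_local_components(1)[OF z d]
      H_mat_Dp_vec_change[OF X z c d]
    by (rule linear_neg[OF tr_deriv_linear[OF M c(1) d(1) c(2) d(2)], symmetric])
  show "Dp_vec M g d z (J_local M g A v d z X) = Dp_vec M g d z (J_local M g A v c z X)"
  proof (rule inner_right_eqI)
    fix y
    obtain w where y: "y = ?L w"
      using surj_tr_deriv[OF M c d] by (metis surjD)
    have "Dp_vec M g d z (J_local M g A v d z X) \<bullet> y = ?L w \<bullet> (G_mat M g A v d z *v ?L (dq_vec M c X))"
      unfolding J_local_components(2)[OF z d] y dq[OF X] by (rule inner_commute)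
    also have "\<dots> = Dp_vec M g c z (J_local M g A v c z X) \<bullet> w"
      unfolding G_mat_change[OF z c d] J_local_components(2)[OF z c] by (rule inner_commute)
    also have "\<dots> = Dp_vec M g d z (J_local M g A v c z X) \<bullet> y"
      unfolding y by (rule Dp_vec_change[OF Jc z c d, symmetric])
    finally show "Dp_vec M g d z (J_local M g A v d z X) \<bullet> y = Dp_vec M g d z (J_local M g A v c z X) \<bullet> y" .
  qed
qed

lemma kaehler_G_eq:
  assumes X: "X \<in> tangent_space (nonzero_cotangent_bundle M) z"
    and Y: "Y \<in> tangent_space (nonzero_cotangent_bundle M) z"
    and z: "z \<in> nonzero_cotangent_set M" and c: "c \<in> M" "fst z \<in> fst c"
  shows "kaehler_G M g A v z X Y = dq_vec M c X \<bullet> (G_mat M g A v c z *v dq_vec M c Y)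
    + Dp_vec M g c z X \<bullet> (H_mat M g A v c z *v Dp_vec M g c z Y)"
proof -
  have "(SOME c. c \<in> charts_at M (fst z)) \<in> charts_at M (fst z)"
    by (rule someI[of _ c]) (use c in \<open>simp add: charts_at_iff\<close>)
  then show ?thesis
    using G_local_change[OF X Y z c] by (simp add: kaehler_G_def charts_at_iff G_local_eq)
qed

lemma kaehler_J_eq:
  assumes X: "X \<in> tangent_space (nonzero_cotangent_bundle M) z"
    and z: "z \<in> nonzero_cotangent_set M" and c: "c \<in> M" "fst z \<in> fst c"
  shows "kaehler_J M g A v z X = J_local M g A v c z X"
proof -
  have "(SOME c. c \<in> charts_at M (fst z)) \<in> charts_at M (fst z)"
    by (rule someI[of _ c]) (use c in \<open>simp add: charts_at_iff\<close>)
  then show ?thesis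
    using J_local_change[OF X z c] by (simp add: kaehler_J_def charts_at_iff)
qed

lemma kaehler_J_tangent:
  assumes "X \<in> tangent_space (nonzero_cotangent_bundle M) z"
    and "z \<in> nonzero_cotangent_set M" "c \<in> M" "fst z \<in> fst c"
  shows "kaehler_J M g A v z X \<in> tangent_space (nonzero_cotangent_bundle M) z"
  unfolding kaehler_J_eq[OF assms] by (rule J_local_tangent[OF assms(2-)])

lemma kaehler_J_components:
  assumes "X \<in> tangent_space (nonzero_cotangent_bundle M) z"
    and "z \<in> nonzero_cotangent_set M" "c \<in> M" "fst z \<in> fst c"
  shows "dq_vec M c (kaehler_J M g A v z X) = - (H_mat M g A v c z *v Dp_vec M g c z X)"
    and "Dp_vec M g c z (kaehler_J M g A v z X) = G_mat M g A v c z *v dq_vec M c X"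
  unfolding kaehler_J_eq[OF assms] by (rule J_local_components[OF assms(2-)])+


section \<open>Pointwise properties and the fundamental form\<close>

lemma kaehler_G_positive:
  assumes X: "X \<in> tangent_space (nonzero_cotangent_bundle M) z" "X \<noteq> (\<lambda>_. 0)"
    and z: "z \<in> nonzero_cotangent_set M" and c: "c \<in> M" "fst z \<in> fst c"
  shows "kaehler_G M g A v z X X > 0"
proof -
  note Gp = pos_def_pos[OF pos_def_G_mat[OF z c]] and Hp = pos_def_pos[OF pos_def_H_mat[OF z c]]
  have "dq_vec M c X \<noteq> 0 \<or> Dp_vec M g c z X \<noteq> 0"
    using tangent_eqI_components[OF X(1) tangent_space_zero[OF
          smooth_atlas_nonzero_cotangent_bundle[OF M]] z c] X(2)
    by (auto simp: dq_vec_def Dp_vec_def)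
  moreover have "0 \<le> u \<bullet> (G_mat M g A v c z *v u)" for u
    using Gp[of u] by (cases "u = 0") auto
  moreover have "0 \<le> u \<bullet> (H_mat M g A v c z *v u)" for u
    using Hp[of u] by (cases "u = 0") auto
  ultimately show ?thesis
    unfolding kaehler_G_eq[OF X(1) X(1) z c]
    using Gp[of "dq_vec M c X"] Hp[of "Dp_vec M g c z X"]
    by (metis add_nonneg_pos add_pos_nonneg)
qed

lemma kaehler_J_square:
  assumes X: "X \<in> tangent_space (nonzero_cotangent_bundle M) z"
    and z: "z \<in> nonzero_cotangent_set M" and c: "c \<in> M" "fst z \<in> fst c"
  shows "kaehler_J M g A v z (kaehler_J M g A v z X) = (\<lambda>e. - X e)"
proof -
  note N = smooth_atlas_nonzero_cotangent_bundle[OF M]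
  note JX = kaehler_J_tangent[OF X z c]
  have mX: "(\<lambda>e. - X e) \<in> tangent_space (nonzero_cotangent_bundle M) z"
    using tangent_space_scale[OF N X, of "- 1"] by simp
  have neg: "B *v - u = - (B *v u)" for B :: "real ^ 'n ^ 'n" and u
    using linear_neg[of "(*v) B"] by simp
  show ?thesis
    by (rule tangent_eqI_components[where g = g, OF kaehler_J_tangent[OF JX z c] mX z c])
      (simp_all add: kaehler_J_components[OF JX z c] kaehler_J_components[OF X z c] neg G_H_mat[OF z c],
       simp_all add: dq_vec_def Dp_vec_def neg)
qed

text \<open>The complex structure exchanges the two blocks of the metric, which are inverse to each other.\<close>

lemma kaehler_J_isometry:
  assumes X: "X \<in> tangent_space (nonzero_cotangent_bundle M) z"
    and Y: "Y \<in> tangent_space (nonzero_cotangent_bundle M) z"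
    and z: "z \<in> nonzero_cotangent_set M" and c: "c \<in> M" "fst z \<in> fst c"
  shows "kaehler_G M g A v z (kaehler_J M g A v z X) (kaehler_J M g A v z Y) = kaehler_G M g A v z X Y"
proof -
  have neg: "B *v - u = - (B *v u)" for B :: "real ^ 'n ^ 'n" and u
    using linear_neg[of "(*v) B"] by simp
  show ?thesis
    by (simp add: kaehler_G_eq[OF X Y z c]
        kaehler_G_eq[OF kaehler_J_tangent[OF X z c] kaehler_J_tangent[OF Y z c] z c]
        kaehler_J_components[OF X z c] kaehler_J_components[OF Y z c] neg G_H_mat[OF z c]
        inner_commute[of "H_mat M g A v c z *v Dp_vec M g c z X"]
        inner_commute[of "G_mat M g A v c z *v dq_vec M c X"]
        pos_def_sym[OF pos_def_H_mat[OF z c], of "Dp_vec M g c z Y"]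
        pos_def_sym[OF pos_def_G_mat[OF z c], of "dq_vec M c Y"])
qed

text \<open>The matrices of metric and complex structure cancel, so that the fundamental form pairs \<open>Dp\<close> with
  \<open>dq\<close>. The Christoffel symbols in \<open>Dp\<close> drop out by their symmetry, and what remains is the
  canonical symplectic form of the cotangent bundle.\<close>

lemma fundamental_form_canonical:
  assumes X: "X \<in> tangent_space (nonzero_cotangent_bundle M) z"
    and Y: "Y \<in> tangent_space (nonzero_cotangent_bundle M) z"
    and z: "z \<in> nonzero_cotangent_set M" and c: "c \<in> M" "fst z \<in> fst c"
  shows "fundamental_form (kaehler_G M g A v) (kaehler_J M g A v) z X Y
       = snd (X (induced_chart M c)) \<bullet> fst (Y (induced_chart M c))
       - fst (X (induced_chart M c)) \<bullet> snd (Y (induced_chart M c))"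
proof -
  have neg: "B *v - u = - (B *v u)" for B :: "real ^ 'n ^ 'n" and u
    using linear_neg[of "(*v) B"] by simp
  have "fundamental_form (kaehler_G M g A v) (kaehler_J M g A v) z X Y
      = Dp_vec M g c z X \<bullet> dq_vec M c Y - dq_vec M c X \<bullet> Dp_vec M g c z Y"
    by (simp add: fundamental_form_def kaehler_G_eq[OF X kaehler_J_tangent[OF Y z c] z c]
        kaehler_J_components[OF Y z c] neg G_H_mat[OF z c])
  then show ?thesis
    using Gamma_mat_sym[OF M g c, of "dq_vec M c X" "dq_vec M c Y"]
    by (simp add: Dp_vec_def dq_vec_def inner_diff_left inner_diff_right inner_commute)
qed


section \<open>Smoothness of the metric and the almost complex structure\<close>

lemma bundle_smooth_G_mat:
  assumes c: "c \<in> M" and sv: "smooth_on {0<..} v"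
  shows "bundle_smooth c (G_mat M g A v c)"
proof -
  have e: "bundle_smooth c (energy M g c)"
    unfolding energy_eq
    by (intro bundle_smooth_mult bundle_smooth_inner bundle_smooth_const bundle_smooth_velocity
        bundle_smooth_momentum c)
  have pos: "energy M g c (chart_inv (induced_chart M c) y) > 0"
    if "y \<in> snd (induced_chart M c) ` fst (induced_chart M c)" for y
    by (rule energy_pos[OF induced_chart_inv(1)[OF c that] c induced_chart_inv(2)[OF c that]])
  have "bundle_smooth c (\<lambda>z. sqrt (energy M g c z))"
    using e pos unfolding bundle_smooth_def by (intro smooth_on_sqrt open_induced_image c)
  moreover have "bundle_smooth c (\<lambda>z. v (energy M g c z))"
    using e pos unfolding bundle_smooth_def
    by (intro smooth_on_compose[OF open_induced_image[OF c] sv]) auto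
  moreover have "bundle_smooth c (\<lambda>z. outer (momentum M c z))"
    unfolding outer_def
    by (intro bundle_smooth_vec bundle_smooth_mult bundle_smooth_nth bundle_smooth_momentum c)
  ultimately show ?thesis
    unfolding G_mat_eq
    by (intro bundle_smooth_add bundle_smooth_scaleR bundle_smooth_mult bundle_smooth_const
        bundle_smooth_g_low c)
qed

lemma bundle_smooth_H_mat:
  assumes c: "c \<in> M" and sv: "smooth_on {0<..} v"
  shows "bundle_smooth c (H_mat M g A v c)"
proof (rule bundle_smooth_cong[OF c])
  show "H_mat M g A v c z = matrix_inv (G_mat M g A v c z)"
    if "z \<in> nonzero_cotangent_set M" "fst z \<in> fst c" for z
    by (rule H_mat_eq[OF that(1) c that(2)])
  show "bundle_smooth c (\<lambda>z. matrix_inv (G_mat M g A v c z))"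
    by (rule bundle_smooth_matrix_inv[OF c bundle_smooth_G_mat[OF c sv]])
      (rule pos_def_G_mat[OF _ c])
qed

text \<open>By independence of the chart, the arbitrary choice in \<open>kaehler_G\<close> can be replaced by the chart
  \<open>c\<close> at all points of its domain.\<close>

lemma smooth_kaehler_G:
  assumes c: "c \<in> M" and sv: "smooth_on {0<..} v"
  shows "bundle_smooth c (\<lambda>z. kaehler_G M g A v z
    (coord_vec (nonzero_cotangent_bundle M) (induced_chart M c) z u)
    (coord_vec (nonzero_cotangent_bundle M) (induced_chart M c) z w))"
proof (rule bundle_smooth_cong[OF c])
  fix z assume z: "z \<in> nonzero_cotangent_set M" "fst z \<in> fst c"
  show "kaehler_G M g A v z
      (coord_vec (nonzero_cotangent_bundle M) (induced_chart M c) z u)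
      (coord_vec (nonzero_cotangent_bundle M) (induced_chart M c) z w)
    = fst u \<bullet> (G_mat M g A v c z *v fst w)
    + (snd u - Gamma_mat M g c z *v fst u) \<bullet> (H_mat M g A v c z *v (snd w - Gamma_mat M g c z *v fst w))"
    using coord_vec_components[OF z(1) c z(2)] kaehler_G_eq[OF _ _ z(1) c z(2)]
    by (simp add: dq_vec_def Dp_vec_def)
next
  show "bundle_smooth c (\<lambda>z. fst u \<bullet> (G_mat M g A v c z *v fst w)
    + (snd u - Gamma_mat M g c z *v fst u) \<bullet> (H_mat M g A v c z *v (snd w - Gamma_mat M g c z *v fst w)))"
    by (intro bundle_smooth_add bundle_smooth_inner bundle_smooth_matrix_vector bundle_smooth_diff
        bundle_smooth_const bundle_smooth_Gamma_mat bundle_smooth_G_mat bundle_smooth_H_mat c sv)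
qed

lemma smooth_kaehler_J:
  assumes c: "c \<in> M" and sv: "smooth_on {0<..} v"
  shows "bundle_smooth c (\<lambda>z. kaehler_J M g A v z
    (coord_vec (nonzero_cotangent_bundle M) (induced_chart M c) z u) (induced_chart M c))"
proof (rule bundle_smooth_cong[OF c])
  let ?D = "\<lambda>z. snd u - Gamma_mat M g c z *v fst u"
  let ?y = "\<lambda>z. - (H_mat M g A v c z *v ?D z)"
  fix z assume z: "z \<in> nonzero_cotangent_set M" "fst z \<in> fst c"
  let ?X = "coord_vec (nonzero_cotangent_bundle M) (induced_chart M c) z u"
  note X = coord_vec_components(2)[OF z(1) c z(2), of u]
  have dq: "dq_vec M c ?X = fst u" and Dp: "Dp_vec M g c z ?X = ?D z"
    using coord_vec_components(1)[OF z(1) c z(2)] by (simp_all add: dq_vec_def Dp_vec_def)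
  have "fst (kaehler_J M g A v z ?X (induced_chart M c)) = ?y z"
    using kaehler_J_components(1)[OF X z(1) c z(2)] unfolding Dp by (simp only: dq_vec_def)
  moreover have "snd (kaehler_J M g A v z ?X (induced_chart M c)) - Gamma_mat M g c z *v ?y z
      = G_mat M g A v c z *v fst u"
    using kaehler_J_components[OF X z(1) c z(2)] unfolding Dp dq by (simp add: Dp_vec_def)
  ultimately show "kaehler_J M g A v z ?X (induced_chart M c)
      = (?y z, G_mat M g A v c z *v fst u + Gamma_mat M g c z *v ?y z)"
    by (simp add: prod_eq_iff algebra_simps)
next
  let ?y = "\<lambda>z. - (H_mat M g A v c z *v (snd u - Gamma_mat M g c z *v fst u))"
  have y: "bundle_smooth c ?y"
    by (intro bundle_smooth_minus bundle_smooth_matrix_vector bundle_smooth_diff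
        bundle_smooth_const bundle_smooth_Gamma_mat bundle_smooth_H_mat c sv)
  have "bundle_smooth c (\<lambda>z. G_mat M g A v c z *v fst u + Gamma_mat M g c z *v ?y z)"
    by (intro bundle_smooth_add bundle_smooth_matrix_vector bundle_smooth_const
        bundle_smooth_Gamma_mat bundle_smooth_G_mat c sv y)
  with y show "bundle_smooth c (\<lambda>z. (?y z, G_mat M g A v c z *v fst u + Gamma_mat M g c z *v ?y z))"
    unfolding bundle_smooth_def by (rule smooth_on_Pair[OF open_induced_image[OF c]])
qed


section \<open>The almost Kaehler structure\<close>

lemma riemannian_metric_kaehler_G:
  assumes sv: "smooth_on {0<..} v"
  shows "riemannian_metric (nonzero_cotangent_bundle M) (kaehler_G M g A v)"
  unfolding riemannian_metric_def smooth_bilinear_field_def carrier_nonzero_cotangent_bundle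
proof (intro conjI ballI allI impI)
  let ?N = "nonzero_cotangent_bundle M"
  note N = smooth_atlas_nonzero_cotangent_bundle[OF M]
  fix z assume z: "z \<in> nonzero_cotangent_set M"
  obtain c where c: "c \<in> M" "fst z \<in> fst c"
    using nonzero_cotangent_chart[OF z] .
  show sym: "kaehler_G M g A v z X Y = kaehler_G M g A v z Y X"
    if X: "X \<in> tangent_space ?N z" and Y: "Y \<in> tangent_space ?N z" for X Y
    unfolding kaehler_G_eq[OF X Y z c] kaehler_G_eq[OF Y X z c]
    by (intro arg_cong2[where f = "(+)"] pos_def_sym pos_def_G_mat[OF z c] pos_def_H_mat[OF z c])
  have lin1: "kaehler_G M g A v z X (\<lambda>e. r *\<^sub>R Y e + s *\<^sub>R Y' e)
      = r * kaehler_G M g A v z X Y + s * kaehler_G M g A v z X Y'"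
    if X: "X \<in> tangent_space ?N z" and Y: "Y \<in> tangent_space ?N z" "Y' \<in> tangent_space ?N z"
    for X Y Y' r s
    unfolding kaehler_G_eq[OF X tangent_space_lincomb[OF N Y] z c] kaehler_G_eq[OF X Y(1) z c]
      kaehler_G_eq[OF X Y(2) z c] dq_vec_lincomb Dp_vec_lincomb
    by (simp add: matrix_vector_right_distrib matrix_vector_mult_scaleR inner_add_right algebra_simps)
  fix X assume X: "X \<in> tangent_space ?N z"
  show "tangent_linear ?N z (kaehler_G M g A v z X)"
    unfolding tangent_linear_def by (intro ballI allI lin1 X)
  show "tangent_linear ?N z (\<lambda>Y. kaehler_G M g A v z Y X)"
    unfolding tangent_linear_def
  proof (intro ballI allI)
    fix Y Y' r s assume Y: "Y \<in> tangent_space ?N z" and Y': "Y' \<in> tangent_space ?N z"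
    show "kaehler_G M g A v z (\<lambda>e. r *\<^sub>R Y e + s *\<^sub>R Y' e) X
        = r * kaehler_G M g A v z Y X + s * kaehler_G M g A v z Y' X"
      unfolding sym[OF tangent_space_lincomb[OF N Y Y'] X] sym[OF Y X] sym[OF Y' X]
      by (rule lin1[OF X Y Y'])
  qed
  show "kaehler_G M g A v z X X > 0" if "X \<noteq> (\<lambda>_. 0)"
    by (rule kaehler_G_positive[OF X that z c])
next
  fix e u w assume "e \<in> nonzero_cotangent_bundle M"
  then obtain c where c: "e = induced_chart M c" "c \<in> M"
    unfolding nonzero_cotangent_bundle_eq by (rule imageE)
  show "smooth_on (snd e ` fst e) ((\<lambda>z. kaehler_G M g A v z
      (coord_vec (nonzero_cotangent_bundle M) e z u)
      (coord_vec (nonzero_cotangent_bundle M) e z w)) \<circ> chart_inv e)"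
    using smooth_kaehler_G[OF c(2) sv, of u w] unfolding bundle_smooth_def c(1) o_def .
qed

lemma almost_complex_structure_kaehler_J:
  assumes sv: "smooth_on {0<..} v"
  shows "almost_complex_structure (nonzero_cotangent_bundle M) (kaehler_J M g A v)"
  unfolding almost_complex_structure_def carrier_nonzero_cotangent_bundle
proof (intro conjI ballI allI)
  let ?N = "nonzero_cotangent_bundle M"
  note N = smooth_atlas_nonzero_cotangent_bundle[OF M]
  fix z X assume z: "z \<in> nonzero_cotangent_set M" and X: "X \<in> tangent_space ?N z"
  obtain c where c: "c \<in> M" "fst z \<in> fst c"
    using nonzero_cotangent_chart[OF z] .
  show "kaehler_J M g A v z X \<in> tangent_space ?N z"
    by (rule kaehler_J_tangent[OF X z c])
  show "kaehler_J M g A v z (kaehler_J M g A v z X) = (\<lambda>e. - X e)"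
    by (rule kaehler_J_square[OF X z c])
  fix Y r s assume Y: "Y \<in> tangent_space ?N z"
  note XY = tangent_space_lincomb[OF N X Y, of r s]
  note JXY = tangent_space_lincomb[OF N kaehler_J_tangent[OF X z c] kaehler_J_tangent[OF Y z c], of r s]
  show "kaehler_J M g A v z (\<lambda>e. r *\<^sub>R X e + s *\<^sub>R Y e)
      = (\<lambda>e. r *\<^sub>R kaehler_J M g A v z X e + s *\<^sub>R kaehler_J M g A v z Y e)"
    by (rule tangent_eqI_components[where g = g, OF kaehler_J_tangent[OF XY z c] JXY z c])
      (simp_all add: kaehler_J_components[OF XY z c] kaehler_J_components[OF X z c]
        kaehler_J_components[OF Y z c] dq_vec_lincomb Dp_vec_lincomb
        matrix_vector_right_distrib matrix_vector_mult_scaleR)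
next
  fix e u assume "e \<in> nonzero_cotangent_bundle M"
  then obtain c where c: "e = induced_chart M c" "c \<in> M"
    unfolding nonzero_cotangent_bundle_eq by (rule imageE)
  show "smooth_on (snd e ` fst e) ((\<lambda>z. kaehler_J M g A v z
      (coord_vec (nonzero_cotangent_bundle M) e z u) e) \<circ> chart_inv e)"
    using smooth_kaehler_J[OF c(2) sv, of u] unfolding bundle_smooth_def c(1) o_def .
qed

lemma fundamental_form_coord_vec:
  assumes "c \<in> M" "z \<in> fst (induced_chart M c)"
  shows "fundamental_form (kaehler_G M g A v) (kaehler_J M g A v) z
      (coord_vec (nonzero_cotangent_bundle M) (induced_chart M c) z u)
      (coord_vec (nonzero_cotangent_bundle M) (induced_chart M c) z w)
    = snd u \<bullet> fst w - fst u \<bullet> snd w"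
proof -
  have z: "z \<in> nonzero_cotangent_set M" and c: "c \<in> M" "fst z \<in> fst c"
    using assms by (simp_all add: induced_chart_domain)
  show ?thesis
    using fundamental_form_canonical[OF coord_vec_components(2)[OF z c] coord_vec_components(2)[OF z c] z c]
    by (simp only: coord_vec_components(1)[OF z c])
qed

lemma two_form_fundamental_form:
  "two_form (nonzero_cotangent_bundle M) (fundamental_form (kaehler_G M g A v) (kaehler_J M g A v))"
  (is "two_form ?N ?\<phi>")
  unfolding two_form_def smooth_bilinear_field_def carrier_nonzero_cotangent_bundle
proof (intro conjI ballI allI)
  note N = smooth_atlas_nonzero_cotangent_bundle[OF M]
  fix z X assume z: "z \<in> nonzero_cotangent_set M" and X: "X \<in> tangent_space ?N z"
  obtain c where c: "c \<in> M" "fst z \<in> fst c"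
    using nonzero_cotangent_chart[OF z] .
  note canonical = fundamental_form_canonical[OF _ _ z c]
  show "tangent_linear ?N z (?\<phi> z X)" "tangent_linear ?N z (\<lambda>Y. ?\<phi> z Y X)"
    unfolding tangent_linear_def
    by (simp_all add: canonical X tangent_space_lincomb[OF N] inner_add_left inner_add_right
        algebra_simps)
  show "?\<phi> z X Y = - ?\<phi> z Y X" if Y: "Y \<in> tangent_space ?N z" for Y
    by (simp add: canonical X Y inner_commute)
next
  fix e u w assume "e \<in> ?N"
  then obtain c where c: "e = induced_chart M c" "c \<in> M"
    unfolding nonzero_cotangent_bundle_eq by (rule imageE)
  have "bundle_smooth c (\<lambda>z. ?\<phi> z (coord_vec ?N e z u) (coord_vec ?N e z w))"
    using fundamental_form_coord_vec[OF c(2), of _ u w]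
    by (intro bundle_smooth_cong[OF c(2) _ bundle_smooth_const]) (simp add: c(1) induced_chart_domain)
  then show "smooth_on (snd e ` fst e)
      ((\<lambda>z. ?\<phi> z (coord_vec ?N e z u) (coord_vec ?N e z w)) \<circ> chart_inv e)"
    unfolding bundle_smooth_def c(1) o_def .
qed

text \<open>The coefficients of the canonical form in an induced chart are constant, so all the derivatives that
  make up the exterior derivative vanish.\<close>

lemma closed_fundamental_form:
  "closed_two_form (nonzero_cotangent_bundle M)
    (fundamental_form (kaehler_G M g A v) (kaehler_J M g A v))" (is "closed_two_form ?N ?\<phi>")
  unfolding closed_two_form_def
proof (intro conjI ballI allI two_form_fundamental_form)
  fix e z u1 u2 u3 assume e: "e \<in> ?N" and z: "z \<in> fst e"
  obtain c where c: "e = induced_chart M c" "c \<in> M"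
    using e unfolding nonzero_cotangent_bundle_eq by (rule imageE)
  have "chart_deriv e (\<lambda>b. ?\<phi> b (coord_vec ?N e b u) (coord_vec ?N e b w)) z h = 0" for u w h
  proof -
    have "frechet_derivative ((\<lambda>b. ?\<phi> b (coord_vec ?N e b u) (coord_vec ?N e b w)) \<circ> chart_inv e)
        (at (snd e z)) = frechet_derivative (\<lambda>_. snd u \<bullet> fst w - fst u \<bullet> snd w) (at (snd e z))"
    proof (rule frechet_derivative_cong[OF open_induced_image[OF c(2)]])
      show "snd e z \<in> snd (induced_chart M c) ` fst (induced_chart M c)"
        using z by (simp add: c(1))
      fix y assume "y \<in> snd (induced_chart M c) ` fst (induced_chart M c)"
      then show "((\<lambda>b. ?\<phi> b (coord_vec ?N e b u) (coord_vec ?N e b w)) \<circ> chart_inv e) y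
          = snd u \<bullet> fst w - fst u \<bullet> snd w"
        unfolding c(1) o_def by (intro fundamental_form_coord_vec[OF c(2)] chart_inv_in)
    qed
    then show ?thesis
      by (simp add: chart_deriv_def frechet_derivative_const)
  qed
  then show "ext_deriv2 ?N ?\<phi> e z u1 u2 u3 = 0"
    by (simp add: ext_deriv2_def)
qed

end

end

end

theorem theorem1:
  fixes M :: "('a, real ^ 'n) atlas"
    and g :: "('a, real ^ 'n) bform"
    and A :: real
    and v :: "real \<Rightarrow> real"
  assumes "smooth_manifold M"
    and "riemannian_metric M g"
    and "smooth_on {0<..} v"
    and "A > 0"
    and "\<And>t. t > 0 \<Longrightarrow> v t > - A / (2 * sqrt t)"
  shows "almost_kaehler_manifold (nonzero_cotangent_bundle M)
           (kaehler_G M g A v) (kaehler_J M g A v)"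
proof -
  have M: "smooth_atlas M"
    using assms(1) by (simp add: smooth_manifold_iff)
  note * = M assms(2,4,5)
  show ?thesis
    unfolding almost_kaehler_manifold_def
  proof (intro conjI ballI smooth_manifold_nonzero_cotangent_bundle assms(1)
      riemannian_metric_kaehler_G[OF * assms(3)] almost_complex_structure_kaehler_J[OF * assms(3)]
      closed_fundamental_form[OF *])
    fix z X Y
    assume "z \<in> carrier (nonzero_cotangent_bundle M)"
      and X: "X \<in> tangent_space (nonzero_cotangent_bundle M) z"
      and Y: "Y \<in> tangent_space (nonzero_cotangent_bundle M) z"
    then have z: "z \<in> nonzero_cotangent_set M"
      by (simp add: carrier_nonzero_cotangent_bundle)
    obtain c where "c \<in> M" "fst z \<in> fst c"
      using nonzero_cotangent_chart[OF z] .
    with X Y z show "kaehler_G M g A v z (kaehler_J M g A v z X) (kaehler_J M g A v z Y)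
        = kaehler_G M g A v z X Y"
      by (intro kaehler_J_isometry[OF *])
  qed
qed

end
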